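(* Let $J$ be a semi-infinite Jacobi matrix with coefficients $a_n>0$, $b_n\in\mathbb{R}$ ($n\ge 1$) satisfying $\sup_n a_n^{-1}+\sup_n a_n+\sup_n|b_n|<\infty$ and $$\sum_{n=1}^\infty |a_{n+1}-a_n|^2+\sum_{n=1}^\infty|b_{n+1}-b_n|^2<\infty .$$ Then, modulo sets of Lebesgue measure zero, $$\Sigma_{\mathrm{ac}}(J)=\Big[\limsup_{n\to\infty}(b_n-2a_n),\ \liminf_{n\to\infty}(b_n+2a_n)\Big].$$ Moreover, for each closed interval $I$ contained in the interior of this interval, $$\int_I\log f(x)\,dx>-\infty,$$ where $f$ is the density of the absolutely continuous part of the canonical spectral measure of $J$.
   Context: The semi-infinite Jacobi matrix $J$ with coefficients $\{a_n,b_n\}_{n\ge1}$ is the tridiagonal matrix with diagonal entries $b_1,b_2,\dots$ and off-diagonal entries $a_1,a_2,\dots$, a bounded self-adjoint operator on $\ell^2(\mathbb{N})$, $\mathbb{N}=\{1,2,\dots\}$. Its canonical spectral measure $\mu$ is the spectral measure of $\delta_1$: $\int x^n\,d\mu(x)=\langle\delta_1,J^n\delta_1\rangle$, $n\ge0$. Write the Lebesgue decomposition $d\mu=f(x)\,dx+d\mu_{\mathrm{s}}$; the essential support of the a.c. spectrum is $\Sigma_{\mathrm{ac}}(J)=\{x\in\mathbb{R}\mid f(x)>0\}$, viewed as an equivalence class modulo sets of Lebesgue measure zero. Convention: $[\alpha,\beta]=\emptyset$ if $\alpha>\beta$. *)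

theory Defs
  imports "HOL-Analysis.Analysis"
begin

text \<open>
  Sequences and matrices are indexed by \<open>{1, 2, \<dots>}\<close>; values at index \<open>0\<close> are never
  used.
\<close>

definition jacobi_matrix :: "(nat \<Rightarrow> real) \<Rightarrow> (nat \<Rightarrow> real) \<Rightarrow> nat \<Rightarrow> nat \<Rightarrow> real" where
  "jacobi_matrix a b m n =
     (if m = n then b n
      else if m = Suc n then a n
      else if n = Suc m then a m
      else 0)"

definition jacobi_op :: "(nat \<Rightarrow> real) \<Rightarrow> (nat \<Rightarrow> real) \<Rightarrow> (nat \<Rightarrow> real) \<Rightarrow> nat \<Rightarrow> real" where
  "jacobi_op a b u m = (\<Sum>\<^sub>\<infinity>n\<in>{1..}. jacobi_matrix a b m n * u n)"

definition l2_inner :: "(nat \<Rightarrow> real) \<Rightarrow> (nat \<Rightarrow> real) \<Rightarrow> real" where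
  "l2_inner u v = (\<Sum>\<^sub>\<infinity>n\<in>{1..}. u n * v n)"

definition unit_seq :: "nat \<Rightarrow> nat \<Rightarrow> real" where
  "unit_seq k n = (if n = k then 1 else 0)"

text \<open>
  For bounded coefficients the moment problem is determinate, so the moments single out exactly
  one Borel measure, the spectral measure of the first unit vector. All vectors involved are
  real and finitely supported, so the scalars can be taken real.
\<close>

definition canonical_spectral_measure ::
    "(nat \<Rightarrow> real) \<Rightarrow> (nat \<Rightarrow> real) \<Rightarrow> real measure \<Rightarrow> bool" where
  "canonical_spectral_measure a b \<mu> \<longleftrightarrow>
     sets \<mu> = sets borel \<and>
     (\<forall>n. integrable \<mu> (\<lambda>x. x ^ n) \<and>
          (\<integral>x. x ^ n \<partial>\<mu>) = l2_inner (unit_seq 1) ((jacobi_op a b ^^ n) (unit_seq 1)))"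

text \<open>\<open>f\<close> is a version of the density in the Lebesgue decomposition
  \<open>d\<mu> = f(x) dx + d\<mu>\<^sub>s\<close>.\<close>

definition ac_density :: "real measure \<Rightarrow> (real \<Rightarrow> real) \<Rightarrow> bool" where
  "ac_density \<mu> f \<longleftrightarrow>
     f \<in> borel_measurable borel \<and> (\<forall>x. 0 \<le> f x) \<and>
     (\<exists>\<mu>\<^sub>s. sets \<mu>\<^sub>s = sets borel \<and>
           (\<exists>N\<in>null_sets lborel. emeasure \<mu>\<^sub>s (UNIV - N) = 0) \<and>
           (\<forall>A\<in>sets borel.
              emeasure \<mu> A = (\<integral>\<^sup>+x\<in>A. ennreal (f x) \<partial>lborel) + emeasure \<mu>\<^sub>s A))"

definition sigma_ac :: "(real \<Rightarrow> real) \<Rightarrow> real set" where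
  "sigma_ac f = {x. f x > 0}"

definition eq_mod_null :: "real set \<Rightarrow> real set \<Rightarrow> bool" where
  "eq_mod_null A B \<longleftrightarrow> sym_diff A B \<in> null_sets lborel"

text \<open>Logarithm with \<open>log 0 = -\<infinity>\<close>, in contrast to the library's \<open>ln 0 = 0\<close>.\<close>

definition elog :: "real \<Rightarrow> ereal" where
  "elog t = (if t > 0 then ereal (ln t) else -\<infinity>)"

text \<open>
  Integral with values in \<open>[-\<infinity>, \<infinity>]\<close>, as positive part minus negative part
  (\<^const>\<open>e2ennreal\<close> truncates negative values to \<open>0\<close>). Since \<open>\<infinity> - \<infinity> = \<infinity>\<close>
  on \<^typ>\<open>ereal\<close>, the value is meaningful only if one part is finite; for \<open>log f\<close> with
  \<open>f\<close> integrable the positive part is, because \<open>log t \<le> t\<close>.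
\<close>

definition eintegral_on :: "real set \<Rightarrow> (real \<Rightarrow> ereal) \<Rightarrow> ereal" where
  "eintegral_on A g =
     enn2ereal (\<integral>\<^sup>+x\<in>A. e2ennreal (g x) \<partial>lborel) -
     enn2ereal (\<integral>\<^sup>+x\<in>A. e2ennreal (- g x) \<partial>lborel)"

end

(*
  Let P_n be the orthonormal polynomials (P_1 = 1) and mu the spectral measure.

  Outside the interval: where |x - b_m| exceeds a_m + a_(m-1) by a fixed factor on a long block of
  indices, the masses of P_m^2 d mu decay geometrically towards the middle of the block. Since the
  Wronskian of P_n and u_n(z) = int P_n(t)/(t - z) d mu(t) is 1 and |u_n(x + i e)|^(1/2) is locally
  integrable in x, uniformly in n and e (Kolmogorov), P_n cannot become small on a set of positive
  Lebesgue measure on which f is bounded below.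

  Inside: put Phi_N = a_N P_(N+1) + i P_N. The measure dx/|Phi_N|^2 reproduces, up to a bounded factor,
  the integrals of Q^2 d mu for every polynomial Q of degree less than N. In the upper half plane Phi_N
  is compared with the product of the large roots of lambda + 1/lambda = (z - b_n)/alpha_n, which are
  unimodular on the real interval; square summability bounds the logarithm of the quotient by
  C / Im z uniformly in N, and Cauchy's theorem on half discs with the weight R^2 - z^2 turns this into
  an upper bound for the weighted integral of log |Phi_N|^2. Testing log t <= t - 1 against polynomials
  close to 1/f transfers the bound to the integral of -log f.
*)
theory Submission
  imports Defs "HOL-Complex_Analysis.Complex_Analysis"
begin

subsection \<open>Contour integration over half discs\<close>

text \<open>Square summability is too weak for pointwise asymptotics of \<open>Phi N\<close> on the
  real axis, where nothing damps the errors of the recursion. At height y = Im z the recursion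
  contracts by 1 - q with q of order y, so a loss of order 1/y is natural and has to be accepted.
  This dictates the weight: on the arc |z| = R its modulus is 2 R Im z, which cancels precisely such
  a loss. The same half disc estimate therefore also serves the Kolmogorov bound, where a Cauchy
  transform grows like 1/y, and the evaluation of the integrals of P_j / \<open>Phi N\<close>. What
  survives is a bound for a mean of log |\<open>Phi N\<close>|^2, uniform in N, and never a value of
  f at a single point. It has to be passed on to mu by squares of polynomials of bounded degree,
  since these are the functions on which mu and dx / |\<open>Phi N\<close>|^2 can be compared. The
  term i P_N in \<open>Phi N\<close> keeps it free of zeros in the closed upper half plane, so that
  logarithms and quotients make sense up to the boundary.\<close>

definition upper_half_disc :: "real \<Rightarrow> complex set" where
  "upper_half_disc R = {z. 0 \<le> Im z} \<inter> cball 0 R"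

lemma interior_upper_half_disc: "interior (upper_half_disc R) = {z. 0 < Im z} \<inter> ball 0 R"
proof -
  have "interior {z. 0 \<le> Im z} = {z. 0 < Im z}"
    using interior_halfspace_ge[of \<i> 0] by (simp add: inner_complex_def)
  then show ?thesis by (simp add: upper_half_disc_def)
qed

lemma convex_upper_half_disc: "convex (upper_half_disc R)"
proof -
  have "convex {z. 0 \<le> Im z}" using convex_halfspace_ge[of 0 \<i>] by (simp add: inner_complex_def)
  then show ?thesis by (simp add: upper_half_disc_def convex_Int)
qed

text \<open>On the circle \<open>R\<close>^2 = z cnj z, so the weight factors as -z (z - cnj z) and
  vanishes to first order exactly where the arc meets the real axis.\<close>

lemma norm_arc_weight:
  assumes "norm z = R" shows "norm (of_real (R\<^sup>2) - z\<^sup>2 :: complex) = 2 * R * \<bar>Im z\<bar>"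
proof -
  have "of_real (R\<^sup>2) = z * cnj z" using assms complex_norm_square[of z] by simp
  then have "of_real (R\<^sup>2) - z\<^sup>2 = - z * (z - cnj z)" by (simp add: algebra_simps power2_eq_square)
  also have "\<dots> = - z * (of_real (2 * Im z) * \<i>)" by (simp add: complex_diff_cnj)
  finally show ?thesis using assms by (simp add: norm_mult)
qed

text \<open>The constant \<open>C\<close> controls only Im z times |\<open>G\<close>|, so it can
  stay bounded along families whose supremum on the arc explodes. With the weight the integrand is
  at most 2 R C on an arc of length pi R, and Cauchy's theorem moves the bound to the diameter. The
  first conclusion records integrability, so that real and imaginary parts can be taken
  later.\<close>

lemma half_disc_mean_bound:
  fixes G :: "complex \<Rightarrow> complex"
  assumes R: "0 < R" and cont: "continuous_on (upper_half_disc R) G"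
    and hol: "G holomorphic_on {z. 0 < Im z} \<inter> ball 0 R"
    and bd: "\<And>z. norm z = R \<Longrightarrow> 0 \<le> Im z \<Longrightarrow> Im z * norm (G z) \<le> C"
  shows "((\<lambda>x. of_real (R\<^sup>2 - x\<^sup>2) * G (of_real x)) has_integral
            integral {-R..R} (\<lambda>x. of_real (R\<^sup>2 - x\<^sup>2) * G (of_real x))) {-R..R}"
    and "norm (integral {-R..R} (\<lambda>x. of_real (R\<^sup>2 - x\<^sup>2) * G (of_real x))) \<le> 2 * pi * R\<^sup>2 * C"
proof -
  let ?g = "\<lambda>z. (of_real (R\<^sup>2) - z\<^sup>2) * G z"
  let ?line = "linepath (of_real (-R)) (of_real R) :: real \<Rightarrow> complex"
  let ?arc = "part_circlepath 0 R 0 pi"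
  have pin: "path_image ?arc \<subseteq> upper_half_disc R"
    using R by (auto simp: path_image_part_circlepath' upper_half_disc_def norm_mult sin_ge_zero closed_segment_eq_real_ivl
        simp flip: cis_conv_exp simp del: of_real_mult)
  have end1: "pathstart ?arc = of_real R" "pathfinish ?arc = of_real (-R)"
    by simp_all
  have lin: "path_image ?line \<subseteq> upper_half_disc R"
    using R closed_segment_subset[OF _ _ convex_upper_half_disc, of "of_real (-R)" R "of_real R"]
    by (auto simp: upper_half_disc_def)
  have contg: "continuous_on (upper_half_disc R) ?g" by (intro continuous_intros cont)
  have z0: "(?g has_contour_integral 0) (?line +++ ?arc)"
  proof (rule Cauchy_theorem_convex[OF contg convex_upper_half_disc, of "{}"])
    show "?g field_differentiable at z" if "z \<in> interior (upper_half_disc R) - {}" for z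
      using that hol
      by (intro derivative_intros holomorphic_on_imp_differentiable_at[of G "{z. 0 < Im z} \<inter> ball 0 R"])
         (auto simp: interior_upper_half_disc open_halfspace_Im_gt)
    show "valid_path (?line +++ ?arc)" by (rule valid_path_join) (use end1 in auto)
    show "path_image (?line +++ ?arc) \<subseteq> upper_half_disc R"
      using path_image_join_subset[of ?line ?arc] lin pin by blast
    show "pathfinish (?line +++ ?arc) = pathstart (?line +++ ?arc)"
      using end1 by (simp only: pathfinish_join pathstart_join pathstart_linepath)
  qed simp
  have ia: "?g contour_integrable_on ?arc"
    by (intro contour_integrable_continuous_part_circlepath continuous_on_subset[OF contg pin])
  have il: "?g contour_integrable_on ?line"
    by (intro contour_integrable_continuous_linepath continuous_on_subset[OF contg])
       (use lin in auto)
  have "contour_integral (?line +++ ?arc) ?g = contour_integral ?line ?g + contour_integral ?arc ?g"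
    by (rule contour_integral_join) (use il ia in auto)
  then have eq: "contour_integral ?line ?g = - contour_integral ?arc ?g"
    using contour_integral_unique[OF z0] by (simp add: eq_neg_iff_add_eq_0)
  \<comment> \<open>At the corner z = R the hypothesis reads 0 \<le> C.\<close>
  have C0: "0 \<le> C" using bd[of "of_real R"] R by simp
  have "norm (contour_integral ?arc ?g) \<le> (2 * R * C) * R * (pi - 0)"
  proof (rule has_contour_integral_bound_part_circlepath[OF has_contour_integral_integral[OF ia]])
    fix z assume z: "z \<in> path_image ?arc"
    then have nz: "norm z = R" "0 \<le> Im z" using pin R
      by (auto simp: path_image_part_circlepath' norm_mult upper_half_disc_def simp flip: cis_conv_exp)
    show "norm (?g z) \<le> 2 * R * C"
      using norm_arc_weight[OF nz(1)] bd[OF nz] R nz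
      by (simp add: norm_mult mult.assoc)
  qed (use R C0 in auto)
  then have nb: "norm (contour_integral ?line ?g) \<le> 2 * pi * R\<^sup>2 * C"
    using eq by (simp add: power2_eq_square mult_ac)
  have hi: "((\<lambda>x. ?g (of_real x)) has_integral contour_integral ?line ?g) {-R..R}"
    using has_contour_integral_integral[OF il] R
    by (subst (asm) has_contour_integral_linepath_Reals_iff) auto
  have hi': "((\<lambda>x. of_real (R\<^sup>2 - x\<^sup>2) * G (of_real x)) has_integral contour_integral ?line ?g) {-R..R}"
    using hi by (simp only: of_real_diff of_real_power)
  show "((\<lambda>x. of_real (R\<^sup>2 - x\<^sup>2) * G (of_real x)) has_integral
            integral {-R..R} (\<lambda>x. of_real (R\<^sup>2 - x\<^sup>2) * G (of_real x))) {-R..R}"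
    using hi' by (simp only: integral_unique[OF hi'])
  show "norm (integral {-R..R} (\<lambda>x. of_real (R\<^sup>2 - x\<^sup>2) * G (of_real x))) \<le> 2 * pi * R\<^sup>2 * C"
    using nb by (simp only: integral_unique[OF hi'])
qed

subsection \<open>Cauchy transforms\<close>

text \<open>The factor \<open>g\<close> is kept apart from the measure: \<open>g\<close> =
  \<open>P n\<close> gives the second solution of the three-term recursion, while a square as
  \<open>g\<close> gives a function with nonnegative imaginary part, to which Kolmogorov's argument
  applies.\<close>

definition cauchy_transform :: "real measure \<Rightarrow> (real \<Rightarrow> real) \<Rightarrow> complex \<Rightarrow> complex" where
  "cauchy_transform M g z = (\<integral>t. of_real (g t) / (of_real t - z) \<partial>M)"

lemma norm_real_minus_complex: "\<bar>Im z\<bar> \<le> norm (of_real t - z)"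
  using abs_Im_le_cmod[of "of_real t - z"] by simp

context
  fixes M :: "real measure" and g :: "real \<Rightarrow> real"
  assumes sets_M: "sets M = sets borel" and int_g: "integrable M g"
begin

lemma measurable_kernel: "(\<lambda>t. f (of_real t :: complex)) \<in> borel_measurable M"
  if "f \<in> borel_measurable borel" for f :: "complex \<Rightarrow> complex"
  unfolding measurable_cong_sets[OF sets_M refl]
  by (rule measurable_compose[OF _ that]) (intro borel_measurable_continuous_onI continuous_intros)

lemma integrable_cauchy_power:
  assumes "Im z \<noteq> 0"
  shows "integrable M (\<lambda>t. of_real (g t) / (of_real t - z) ^ k)"
proof (rule Bochner_Integration.integrable_bound)
  show "integrable M (\<lambda>t. g t / \<bar>Im z\<bar> ^ k)" using int_g by simp
  have "(\<lambda>t. complex_of_real (g t)) \<in> borel_measurable M" using int_g by (intro measurable_compose[OF borel_measurable_integrable borel_measurable_of_real])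
  then show "(\<lambda>t. of_real (g t) / (of_real t - z) ^ k) \<in> borel_measurable M"
    by (intro borel_measurable_divide measurable_kernel[of "\<lambda>w. (w - z) ^ k"]) auto
  show "AE t in M. norm (of_real (g t) / (of_real t - z) ^ k) \<le> norm (g t / \<bar>Im z\<bar> ^ k)"
  proof (intro AE_I2)
    fix t
    have "\<bar>Im z\<bar> ^ k \<le> norm (of_real t - z) ^ k" using norm_real_minus_complex by (intro power_mono) auto
    then show "norm (of_real (g t) / (of_real t - z) ^ k) \<le> norm (g t / \<bar>Im z\<bar> ^ k)"
      using assms by (simp add: norm_divide norm_power frac_le)
  qed
qed

lemma integrable_cauchy: "Im z \<noteq> 0 \<Longrightarrow> integrable M (\<lambda>t. of_real (g t) / (of_real t - z))"
  using integrable_cauchy_power[of z 1] by simp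

lemma norm_cauchy_transform_le:
  assumes "Im z \<noteq> 0"
  shows "norm (cauchy_transform M g z) \<le> (\<integral>t. \<bar>g t\<bar> \<partial>M) / \<bar>Im z\<bar>"
proof -
  have "norm (cauchy_transform M g z) \<le> (\<integral>t. norm (complex_of_real (g t) / (of_real t - z)) \<partial>M)"
    unfolding cauchy_transform_def by (rule integral_norm_bound)
  also have "\<dots> \<le> (\<integral>t. \<bar>g t\<bar> / \<bar>Im z\<bar> \<partial>M)"
  proof (rule integral_mono)
    show "integrable M (\<lambda>t. norm (complex_of_real (g t) / (of_real t - z)))"
      using integrable_cauchy[OF assms] by simp
    show "integrable M (\<lambda>t. \<bar>g t\<bar> / \<bar>Im z\<bar>)" using int_g by simp
    show "norm (complex_of_real (g t) / (of_real t - z)) \<le> \<bar>g t\<bar> / \<bar>Im z\<bar>" for t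
      using assms norm_real_minus_complex[of z t] by (auto simp: norm_divide intro!: frac_le)
  qed
  finally show ?thesis by simp
qed

text \<open>The difference quotient minus the candidate derivative is exactly h times an integral
  with three kernel factors. For |h| < Im z / 2 these factors are at least Im z, Im z and Im z / 2,
  so the error is linear in |h|.\<close>

lemma cauchy_transform_has_derivative:
  assumes z: "0 < Im z"
  shows "(cauchy_transform M g has_field_derivative (\<integral>t. of_real (g t) / (of_real t - z) ^ 2 \<partial>M)) (at z)"
  unfolding DERIV_def
proof (rule LIM_zero_cancel)
  let ?G = "\<integral>t. \<bar>g t\<bar> \<partial>M"
  show "((\<lambda>h. (cauchy_transform M g (z + h) - cauchy_transform M g z) / h
        - (\<integral>t. of_real (g t) / (of_real t - z) ^ 2 \<partial>M)) \<longlongrightarrow> 0) (at 0)"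
  proof (rule Lim_null_comparison)
    have "((\<lambda>h::complex. norm h * (?G / (Im z * Im z * (Im z / 2)))) \<longlongrightarrow> norm (0::complex) * (?G / (Im z * Im z * (Im z / 2)))) (at 0)"
      by (rule tendsto_mult[OF tendsto_norm[OF tendsto_ident_at] tendsto_const])
    then show "((\<lambda>h::complex. norm h * (?G / (Im z * Im z * (Im z / 2)))) \<longlongrightarrow> 0) (at 0)" by simp
    have "norm ((cauchy_transform M g (z + h) - cauchy_transform M g z) / h
        - (\<integral>t. of_real (g t) / (of_real t - z) ^ 2 \<partial>M)) \<le> norm h * (?G / (Im z * Im z * (Im z / 2)))"
      if h: "h \<noteq> 0" "norm h < Im z / 2" for h
    proof -
      have ih: "Im z / 2 \<le> Im (z + h)" using h abs_Im_le_cmod[of h] by simp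
      have nz: "of_real t - z \<noteq> 0" "of_real t - (z + h) \<noteq> 0" for t
        using z ih by (auto simp: complex_eq_iff)
      have e: "(cauchy_transform M g (z + h) - cauchy_transform M g z) / h - (\<integral>t. of_real (g t) / (of_real t - z) ^ 2 \<partial>M)
         = (\<integral>t. (of_real (g t) / (of_real t - (z + h)) - of_real (g t) / (of_real t - z)) / h
               - of_real (g t) / (of_real t - z) ^ 2 \<partial>M)"
        unfolding cauchy_transform_def using z ih integrable_cauchy[of z] integrable_cauchy[of "z + h"]
          integrable_cauchy_power[of z 2] by (simp del: plus_complex.sel)
      have "norm ((cauchy_transform M g (z + h) - cauchy_transform M g z) / h - (\<integral>t. of_real (g t) / (of_real t - z) ^ 2 \<partial>M))
          \<le> (\<integral>t. norm ((of_real (g t) / (of_real t - (z + h)) - of_real (g t) / (of_real t - z)) / h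
               - of_real (g t) / (of_real t - z) ^ 2) \<partial>M)"
        unfolding e by (rule integral_norm_bound)
      also have "\<dots> \<le> (\<integral>t. norm h * (\<bar>g t\<bar> / (Im z * Im z * (Im z / 2))) \<partial>M)"
      proof (rule integral_mono)
        fix t
        have "(of_real (g t) / (of_real t - (z + h)) - of_real (g t) / (of_real t - z)) / h
               - of_real (g t) / (of_real t - z) ^ 2
            = of_real (g t) * h / ((of_real t - z) * (of_real t - z) * (of_real t - (z + h)))"
        proof -
          have "(G / (Y - h) - G / Y) / h - G / Y ^ 2 = G * h / (Y * Y * (Y - h))"
            if "Y \<noteq> 0" "Y - h \<noteq> 0" for G Y :: complex
            using that h(1) by (simp add: divide_simps power2_eq_square) (simp add: algebra_simps)
          from this[of "of_real t - z" "of_real (g t)"] nz[of t] show ?thesis by (simp add: diff_diff_eq)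
        qed
        also have "norm \<dots> = \<bar>g t\<bar> * norm h / (norm (of_real t - z) * norm (of_real t - z) * norm (of_real t - (z + h)))"
          by (simp add: norm_mult norm_divide)
        also have "\<dots> \<le> \<bar>g t\<bar> * norm h / (Im z * Im z * (Im z / 2))"
          using z norm_real_minus_complex[of z t] norm_real_minus_complex[of "z + h" t] ih
          by (intro frac_le mult_mono mult_pos_pos) (auto simp del: plus_complex.sel)
        finally show "norm ((of_real (g t) / (of_real t - (z + h)) - of_real (g t) / (of_real t - z)) / h
               - of_real (g t) / (of_real t - z) ^ 2) \<le> norm h * (\<bar>g t\<bar> / (Im z * Im z * (Im z / 2)))" by (simp add: mult_ac)
      next
        show "integrable M (\<lambda>t. norm ((of_real (g t) / (of_real t - (z + h)) - of_real (g t) / (of_real t - z)) / h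
               - of_real (g t) / (of_real t - z) ^ 2))"
          using z ih integrable_cauchy[of z] integrable_cauchy[of "z + h"]
          integrable_cauchy_power[of z 2] by (simp del: plus_complex.sel)
        show "integrable M (\<lambda>t. norm h * (\<bar>g t\<bar> / (Im z * Im z * (Im z / 2))))" using int_g by simp
      qed
      finally show ?thesis by simp
    qed
    then show "\<forall>\<^sub>F h in at 0. norm ((cauchy_transform M g (z + h) - cauchy_transform M g z) / h
        - (\<integral>t. of_real (g t) / (of_real t - z) ^ 2 \<partial>M)) \<le> norm h * (?G / (Im z * Im z * (Im z / 2)))"
      unfolding eventually_at using z by (intro exI[of _ "Im z / 2"]) (auto simp: dist_norm)
  qed
qed

lemma holomorphic_cauchy_transform: "cauchy_transform M g holomorphic_on {z. 0 < Im z}"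
  using cauchy_transform_has_derivative
  by (auto simp: holomorphic_on_open open_halfspace_Im_gt)

end

text \<open>Kolmogorov's argument: for \<open>g \<ge> 0\<close> the function \<open>1 - \<i> A\<close> has positive real part, so its square
  root \<open>h\<close> satisfies \<open>\<bar>h\<bar> \<le> sqrt 2 Re h\<close>, and the mean of \<open>Re h\<close> is controlled by contour integration.\<close>

lemma Re_csqrt_ge:
  assumes "0 \<le> Re v" shows "sqrt (norm v) \<le> sqrt 2 * Re (csqrt v)"
proof -
  have "sqrt 2 * Re (csqrt v) = sqrt (2 * ((norm v + Re v) / 2))" by (simp only: csqrt.simps real_sqrt_mult)
  also have "\<dots> \<ge> sqrt (norm v)" using assms by (intro real_sqrt_le_mono) simp
  finally show ?thesis .
qed

text \<open>Multiplication by -i turns Im v \<ge> 0 into a nonnegative real part, and adding 1 then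
  only increases the modulus.\<close>

lemma norm_le_one_minus_ii: "0 \<le> Im v \<Longrightarrow> norm v \<le> norm (1 - \<i> * v)"
proof (rule power2_le_imp_le)
  assume "0 \<le> Im v"
  moreover have "(norm (1 - \<i> * v))\<^sup>2 = (norm v)\<^sup>2 + 2 * Im v + 1"
    unfolding cmod_power2 by (simp add: power2_sum)
  ultimately show "(norm v)\<^sup>2 \<le> (norm (1 - \<i> * v))\<^sup>2" by linarith
qed simp

text \<open>The right-hand side sees \<open>g\<close> only through the bound \<open>m\<close> on its
  integral and involves neither \<open>x0\<close> nor \<open>e\<close>. Hence the estimate is
  uniform over normalised squares of polynomials and up to the real axis.\<close>

lemma cauchy_transform_sqrt_bound:
  fixes M :: "real measure" and g :: "real \<Rightarrow> real"
  assumes sets_M: "sets M = sets borel" and int_g: "integrable M g" and g: "\<And>t. 0 \<le> g t"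
    and m: "(\<integral>t. g t \<partial>M) \<le> m" and R: "0 < R" and e: "0 < e"
  shows "integral {-R..R} (\<lambda>x. (R\<^sup>2 - x\<^sup>2) * sqrt (norm (cauchy_transform M g (of_real (x0 + x) + \<i> * of_real e))))
           \<le> sqrt 2 * (2 * pi * R\<^sup>2 * (R + m))"
proof -
  let ?A = "cauchy_transform M g"
  define w where "w = Complex x0 e"
  define V where "V z = 1 - \<i> * ?A (z + w)" for z
  have ImA: "0 \<le> Im (?A z)" if "0 < Im z" for z
  proof -
    have "Im (?A z) = (\<integral>t. Im (of_real (g t) / (of_real t - z)) \<partial>M)"
      unfolding cauchy_transform_def using integrable_cauchy[OF sets_M int_g, of z] that by simp
    also have "\<dots> \<ge> 0"
    proof (rule integral_nonneg_AE, intro AE_I2)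
      fix t
      have "Im (of_real (g t) / (of_real t - z)) = g t * Im z / (norm (of_real t - z))\<^sup>2"
        by (simp add: Im_divide cmod_power2)
      then show "0 \<le> Im (of_real (g t) / (of_real t - z))" using that g by simp
    qed
    finally show ?thesis .
  qed
  have ReV: "1 \<le> Re (V z)" if "- e < Im z" for z using ImA[of "z + w"] that e by (simp add: V_def w_def)
  have V_slit: "V z \<notin> \<real>\<^sub>\<le>\<^sub>0" if "- e < Im z" for z
    using ReV[OF that] by (auto simp: complex_nonpos_Reals_iff)
  have holV: "V holomorphic_on {z. - e < Im z}"
    unfolding V_def
    by (intro holomorphic_intros holomorphic_on_compose_gen[OF _ holomorphic_cauchy_transform[OF sets_M int_g], unfolded o_def])
       (auto simp: w_def)
  have holc: "(\<lambda>z. csqrt (V z)) holomorphic_on {z. - e < Im z}"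
    by (intro holomorphic_intros holV) (use V_slit in auto)
  note contc = holomorphic_on_imp_continuous_on[OF holc]
  have bd: "Im z * norm (csqrt (V z)) \<le> R + m" if z: "norm z = R" "0 \<le> Im z" for z
  proof -
    have "0 \<le> (\<integral>t. g t \<partial>M)" using g by (simp add: Bochner_Integration.integral_nonneg)
    then have m0: "0 \<le> m" using m by linarith
    have iz: "0 < Im z + e" using z e by simp
    have "norm (?A (z + w)) \<le> (\<integral>t. \<bar>g t\<bar> \<partial>M) / \<bar>Im (z + w)\<bar>"
      by (rule norm_cauchy_transform_le[OF sets_M int_g]) (use iz in \<open>simp add: w_def\<close>)
    also have "\<dots> \<le> m / (Im z + e)" using g m iz by (auto simp: w_def intro!: divide_right_mono)
    finally have "norm (V z) \<le> 1 + m / (Im z + e)"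
      using norm_triangle_ineq4[of 1 "\<i> * ?A (z + w)"] by (simp add: V_def norm_mult)
    \<comment> \<open>The number 1 + m / (Im z + e) is at least 1, so it dominates its own square
      root; this removes the root from the estimate on the arc.\<close>
    then have "sqrt (norm (V z)) \<le> sqrt ((1 + m / (Im z + e))\<^sup>2)"
    proof (intro real_sqrt_le_mono)
      assume a: "norm (V z) \<le> 1 + m / (Im z + e)"
      have "1 \<le> 1 + m / (Im z + e)" using m0 iz by simp
      then have "(1 + m / (Im z + e)) * 1 \<le> (1 + m / (Im z + e)) * (1 + m / (Im z + e))"
        by (intro mult_left_mono) auto
      then show "norm (V z) \<le> (1 + m / (Im z + e))\<^sup>2" using a by (simp add: power2_eq_square)
    qed
    then have "norm (csqrt (V z)) \<le> 1 + m / (Im z + e)" using m0 iz by simp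
    then have "Im z * norm (csqrt (V z)) \<le> Im z * (1 + m / (Im z + e))" using z by (intro mult_left_mono)
    also have "\<dots> = Im z + m * (Im z / (Im z + e))" by (simp add: algebra_simps)
    \<comment> \<open>Here the dependence on the shift \<open>e\<close> disappears.\<close>
    also have "Im z / (Im z + e) \<le> 1" using iz e z by (simp add: field_simps)
    then have "m * (Im z / (Im z + e)) \<le> m" using m0 by (rule mult_left_le)
    also have "Im z \<le> R" using z abs_Im_le_cmod[of z] by simp
    finally show ?thesis by simp
  qed
  note hd = half_disc_mean_bound[of R "\<lambda>z. csqrt (V z)" "R + m", OF R continuous_on_subset[OF contc]
      holomorphic_on_subset[OF holc] bd]
  have hi: "((\<lambda>x. of_real (R\<^sup>2 - x\<^sup>2) * csqrt (V (of_real x))) has_integral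
            integral {-R..R} (\<lambda>x. of_real (R\<^sup>2 - x\<^sup>2) * csqrt (V (of_real x)))) {-R..R}"
    by (rule hd(1)) (use e in \<open>auto simp: upper_half_disc_def\<close>)
  have nb: "norm (integral {-R..R} (\<lambda>x. of_real (R\<^sup>2 - x\<^sup>2) * csqrt (V (of_real x)))) \<le> 2 * pi * R\<^sup>2 * (R + m)"
    by (rule hd(2)) (use e in \<open>auto simp: upper_half_disc_def\<close>)
  have "integral {-R..R} (\<lambda>x. (R\<^sup>2 - x\<^sup>2) * sqrt (norm (?A (of_real (x0 + x) + \<i> * of_real e))))
     \<le> integral {-R..R} (\<lambda>x. sqrt 2 * Re (of_real (R\<^sup>2 - x\<^sup>2) * csqrt (V (of_real x))))"
  proof (rule integral_le)
    have eq: "of_real (x0 + x) + \<i> * of_real e = of_real x + w" for x by (simp add: w_def complex_eq_iff)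
    have "continuous_on {-R..R} (\<lambda>x. ?A (of_real x + w))"
      by (rule continuous_on_compose2[OF holomorphic_on_imp_continuous_on[OF holomorphic_cauchy_transform[OF sets_M int_g]]])
         (auto intro!: continuous_intros simp: w_def e)
    then show "(\<lambda>x. (R\<^sup>2 - x\<^sup>2) * sqrt (norm (?A (of_real (x0 + x) + \<i> * of_real e)))) integrable_on {-R..R}"
      unfolding eq by (intro integrable_continuous_real continuous_intros)
    show "(\<lambda>x. sqrt 2 * Re (of_real (R\<^sup>2 - x\<^sup>2) * csqrt (V (of_real x)))) integrable_on {-R..R}"
      using has_integral_mult_right[OF has_integral_Re[OF hi], of "sqrt 2"] unfolding integrable_on_def by blast
    fix x assume x: "x \<in> {-R..R}"
    have "sqrt (norm (?A (of_real x + w))) \<le> sqrt (norm (V (of_real x)))"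
    proof (intro real_sqrt_le_mono)
      have "0 \<le> Im (?A (of_real x + w))" using e by (intro ImA) (simp add: w_def)
      then show "norm (?A (of_real x + w)) \<le> norm (V (of_real x))"
        unfolding V_def by (rule norm_le_one_minus_ii)
    qed
    also have "\<dots> \<le> sqrt 2 * Re (csqrt (V (of_real x)))"
      using ReV[of "of_real x"] e by (intro Re_csqrt_ge) simp
    finally have "sqrt (norm (?A (of_real x + w))) \<le> sqrt 2 * Re (csqrt (V (of_real x)))" .
    moreover have "0 \<le> R\<^sup>2 - x\<^sup>2" using x R abs_le_square_iff[of x R] by (auto simp: abs_le_iff)
    ultimately have le: "(R\<^sup>2 - x\<^sup>2) * sqrt (norm (?A (of_real x + w))) \<le> (R\<^sup>2 - x\<^sup>2) * (sqrt 2 * Re (csqrt (V (of_real x))))"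
      by (intro mult_left_mono)
    show "(R\<^sup>2 - x\<^sup>2) * sqrt (norm (?A (of_real (x0 + x) + \<i> * of_real e)))
        \<le> sqrt 2 * Re (of_real (R\<^sup>2 - x\<^sup>2) * csqrt (V (of_real x)))"
    proof -
      have "Re (of_real s * v) = s * Re v" for s v by simp
      then show ?thesis using le unfolding eq by (simp only: mult.left_commute)
    qed
  qed
  also have "\<dots> = sqrt 2 * Re (integral {-R..R} (\<lambda>x. of_real (R\<^sup>2 - x\<^sup>2) * csqrt (V (of_real x))))"
    using has_integral_mult_right[OF has_integral_Re[OF hi], of "sqrt 2"] by (rule integral_unique)
  also have "\<dots> \<le> sqrt 2 * (2 * pi * R\<^sup>2 * (R + m))"
    using nb complex_Re_le_cmod order_trans by (intro mult_left_mono) auto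
  finally show ?thesis .
qed

subsection \<open>Orthogonal polynomials and the spectral measure\<close>

text \<open>Indexed so that \<open>P\<^sub>n\<close> has degree \<open>n - 1\<close>. The convention \<open>P\<^sub>0 = 0\<close> makes the three-term
  recursion hold at \<open>n = 1\<close> whatever the junk value \<open>a 0\<close> is.\<close>

fun orth_poly :: "(nat \<Rightarrow> real) \<Rightarrow> (nat \<Rightarrow> real) \<Rightarrow> nat \<Rightarrow> 'a::real_normed_field \<Rightarrow> 'a" where
  "orth_poly a b 0 z = 0"
| "orth_poly a b (Suc 0) z = 1"
| "orth_poly a b (Suc (Suc n)) z =
     ((z - of_real (b (Suc n))) * orth_poly a b (Suc n) z - of_real (a n) * orth_poly a b n z) / of_real (a (Suc n))"

lemma orth_poly_of_real: "orth_poly a b n (of_real x :: 'a::real_normed_field) = of_real (orth_poly a b n x)"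
  by (induction a b n x rule: orth_poly.induct) auto

lemma continuous_on_orth_poly [continuous_intros]:
  "continuous_on S f \<Longrightarrow> continuous_on S (\<lambda>z. orth_poly a b n (f z))"
proof -
  assume f: "continuous_on S f"
  have "continuous_on S (\<lambda>z. orth_poly a b n (f z) / of_real (a n)) \<and> continuous_on S (\<lambda>z. orth_poly a b n (f z))
      \<and> continuous_on S (\<lambda>z. orth_poly a b (Suc n) (f z))"
  proof (induction n)
    case (Suc n)
    have "continuous_on S (\<lambda>z. inverse (of_real (a (Suc n))) *
         ((f z - of_real (b (Suc n))) * orth_poly a b (Suc n) (f z) - of_real (a n) * orth_poly a b n (f z)))"
      using Suc by (intro continuous_intros f) auto
    moreover have "continuous_on S (\<lambda>z. orth_poly a b (Suc n) (f z) * inverse (of_real (a (Suc n))))"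
      using Suc by (intro continuous_intros) auto
    ultimately show ?case using Suc by (simp add: divide_inverse mult.commute)
  qed auto
  then show ?thesis by blast
qed

lemma holomorphic_on_orth_poly [holomorphic_intros]: "(\<lambda>z. orth_poly a b n z) holomorphic_on S"
proof -
  have "(\<lambda>z. orth_poly a b n z) holomorphic_on S \<and> (\<lambda>z. orth_poly a b (Suc n) z) holomorphic_on S"
  proof (induction n)
    case (Suc n)
    have "(\<lambda>z. inverse (of_real (a (Suc n))) *
         ((z - of_real (b (Suc n))) * orth_poly a b (Suc n) z - of_real (a n) * orth_poly a b n z)) holomorphic_on S"
      using Suc by (intro holomorphic_intros) auto
    then show ?case using Suc by (simp add: divide_inverse mult.commute)
  qed auto
  then show ?thesis by blast
qed

lemma borel_measurable_orth_poly [measurable]: "orth_poly a b n \<in> borel_measurable (borel :: real measure)"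
  by (intro borel_measurable_continuous_onI continuous_intros)

text \<open>The Riccati variable of the recursion. With the factor \<open>a n\<close> its recursion
  is r' = z - b' - a^2 / r, which maps the upper half plane into itself.\<close>

definition orth_ratio :: "(nat \<Rightarrow> real) \<Rightarrow> (nat \<Rightarrow> real) \<Rightarrow> nat \<Rightarrow> complex \<Rightarrow> complex" where
  "orth_ratio a b n z = of_real (a n) * orth_poly a b (Suc n) z / orth_poly a b n z"

section \<open>Riccati ratios in the upper half plane and near infinity, and the span of the
  orthogonal polynomials\<close>

locale jacobi_coeffs =
  fixes a b :: "nat \<Rightarrow> real" and c0 K :: real
  assumes c0: "0 < c0" and a_ge: "\<And>n. 1 \<le> n \<Longrightarrow> c0 \<le> a n" and a_le: "\<And>n. 1 \<le> n \<Longrightarrow> a n \<le> K"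
    and b_le: "\<And>n. 1 \<le> n \<Longrightarrow> \<bar>b n\<bar> \<le> K"
begin

abbreviation "P \<equiv> orth_poly a b"
abbreviation "r \<equiv> orth_ratio a b"

lemma a_pos: "1 \<le> n \<Longrightarrow> 0 < a n" using a_ge[of n] c0 by linarith

lemma K_pos: "0 < K" using a_pos[of 1] a_le[of 1] by simp

lemma P_rec: "1 \<le> n \<Longrightarrow> z * P n z = of_real (a n) * P (Suc n) z + of_real (b n) * P n z + of_real (a (n - 1)) * P (n - 1) z"
  using a_pos[of n] by (cases n) (auto simp: field_simps)

lemma P_rec_real: "1 \<le> n \<Longrightarrow> x * P n x = a n * P (Suc n) x + b n * P n x + a (n - 1) * P (n - 1) x" for x :: real
  using P_rec[of n x] by simp

lemma r_1: "r (Suc 0) z = z - of_real (b 1)"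
  using a_pos[of 1] by (simp add: orth_ratio_def)

lemma r_Suc:
  assumes "1 \<le> n" "P n z \<noteq> 0" "P (Suc n) z \<noteq> 0"
  shows "r (Suc n) z = z - of_real (b (Suc n)) - of_real ((a n)\<^sup>2) / r n z"
  using assms a_pos[of "Suc n"] a_pos[of n] by (simp add: orth_ratio_def field_simps power2_eq_square)

text \<open>If Im r > 0 then -a^2 / r also has positive imaginary part, so each step keeps at least
  Im z. A nonzero ratio makes the next polynomial nonzero, which is why both claims share one
  induction.\<close>

lemma r_upper:
  assumes z: "0 < Im z" and n: "1 \<le> n"
  shows "P n z \<noteq> 0 \<and> Im z \<le> Im (r n z)"
  using n
proof (induction n rule: nat_induct_at_least)
  case base
  then show ?case using r_1[of z] by simp
next
  case (Suc n)
  then have r0: "r n z \<noteq> 0" and im: "0 < Im (r n z)" using z by auto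
  then have nz: "P (Suc n) z \<noteq> 0" by (auto simp: orth_ratio_def)
  have "Im (of_real ((a n)\<^sup>2) / r n z) \<le> 0"
    using im by (simp add: Im_divide divide_nonpos_nonneg mult_nonneg_nonneg)
  then show ?case using nz r_Suc[OF Suc(1) _ nz] Suc by simp
qed

lemma P_nz: "0 < Im z \<Longrightarrow> 1 \<le> n \<Longrightarrow> P n z \<noteq> 0" using r_upper by blast
lemma r_im: "0 < Im z \<Longrightarrow> 1 \<le> n \<Longrightarrow> Im z \<le> Im (r n z)" using r_upper by blast

lemma r_norm_ge: "0 < Im z \<Longrightarrow> 1 \<le> n \<Longrightarrow> Im z \<le> norm (r n z)"
  using r_im[of z n] abs_Im_le_cmod[of "r n z"] by linarith

lemma r_norm_le:
  assumes z: "0 < Im z" and n: "1 \<le> n"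
  shows "norm (r n z) \<le> norm z + K + K\<^sup>2 / Im z"
proof (cases "n = 1")
  case True
  then show ?thesis using norm_triangle_ineq4[of z "of_real (b 1)"] b_le[of 1] z K_pos
    by (simp add: r_1) (smt (verit) divide_nonneg_nonneg zero_le_power2)
next
  case False
  then obtain k where k: "n = Suc k" "1 \<le> k" using n by (cases n) auto
  have "norm (of_real ((a k)\<^sup>2) / r k z) \<le> K\<^sup>2 / Im z"
    unfolding norm_divide using r_norm_ge[OF z k(2)] z a_le[OF k(2)] a_pos[OF k(2)]
    by (intro frac_le) (auto simp: norm_power intro!: power_mono)
  moreover have "r n z = z - of_real (b n) - of_real ((a k)\<^sup>2) / r k z"
    using r_Suc[OF k(2) P_nz[OF z k(2)] P_nz[OF z]] k by simp
  ultimately show ?thesis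
    using norm_triangle_ineq4[of "z - of_real (b n)" "of_real ((a k)\<^sup>2) / r k z"]
      norm_triangle_ineq4[of z "of_real (b n)"] b_le[OF n] by simp
qed

text \<open>The bound |r| \<ge> |z| / 2 reproduces itself: it makes the subtracted term a^2 / r at
  most K / 2, and |z| - 3 K / 2 \<ge> |z| / 2 once |z| \<ge> 4 K.\<close>

lemma r_large:
  assumes z: "4 * K \<le> norm z" and n: "1 \<le> n"
  shows "P n z \<noteq> 0 \<and> norm z / 2 \<le> norm (r n z)"
  using n
proof (induction n rule: nat_induct_at_least)
  case base
  have "norm z - K \<le> norm (r 1 z)"
    using norm_triangle_ineq2[of z "of_real (b 1)"] b_le[of 1] by (simp add: r_1)
  then show ?case using z K_pos by simp
next
  case (Suc n)
  have zp: "0 < norm z" using z K_pos by linarith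
  then have rn: "0 < norm (r n z)" "norm z / 2 \<le> norm (r n z)" using Suc by auto
  then have nz: "P (Suc n) z \<noteq> 0" by (auto simp: orth_ratio_def)
  have "norm (of_real ((a n)\<^sup>2) / r n z) \<le> K\<^sup>2 / (2 * K)"
    unfolding norm_divide using rn z a_le[OF Suc(1)] a_pos[OF Suc(1)] K_pos
    by (intro frac_le) (auto simp: norm_power intro!: power_mono)
  also have "\<dots> = K / 2" using K_pos by (simp add: power2_eq_square)
  finally have "norm (of_real ((a n)\<^sup>2) / r n z) \<le> K / 2" .
  then have "norm z - K - K / 2 \<le> norm (r (Suc n) z)"
    unfolding r_Suc[OF Suc(1) conjunct1[OF Suc(2)] nz]
    using norm_triangle_ineq2[of "z - of_real (b (Suc n))" "of_real ((a n)\<^sup>2) / r n z"]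
      norm_triangle_ineq2[of z "of_real (b (Suc n))"] b_le[of "Suc n"] by simp
  then show ?case using nz z K_pos by simp
qed

lemma P_not_both_zero:
  assumes "1 \<le> n" shows "P n z \<noteq> 0 \<or> P (Suc n) z \<noteq> (0::'a::real_normed_field)"
  using assms
proof (induction n rule: nat_induct_at_least)
  case (Suc n)
  then show ?case using P_rec[of "Suc n" z] a_pos[of n] by auto
qed auto

lemma P_poly: "\<exists>p :: real poly. \<forall>x. P n x = poly p x"
proof -
  have "(\<exists>p :: real poly. \<forall>x. P n x = poly p x) \<and> (\<exists>p :: real poly. \<forall>x. P (Suc n) x = poly p x)"
  proof (induction n)
    case 0
    have "\<forall>x::real. P 0 x = poly 0 x" "\<forall>x::real. P (Suc 0) x = poly 1 x" by auto
    then show ?case by blast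
  next
    case (Suc n)
    then obtain p q :: "real poly" where pq: "\<And>x. P n x = poly p x" "\<And>x. P (Suc n) x = poly q x" by blast
    have "\<forall>x::real. P (Suc (Suc n)) x = poly (smult (inverse (a (Suc n))) ([:- b (Suc n), 1:] * q - smult (a n) p)) x"
      using pq by (simp add: divide_inverse algebra_simps)
    then show ?case using Suc by blast
  qed
  then show ?thesis by blast
qed

definition in_span :: "(real \<Rightarrow> real) \<Rightarrow> bool" where
  "in_span q \<longleftrightarrow> (\<exists>N c. \<forall>x. q x = (\<Sum>j=1..N. c j * P j x))"

lemma in_span_add:
  assumes "in_span p" "in_span q" shows "in_span (\<lambda>x. p x + q x)"
proof -
  obtain N c M d where p: "\<And>x. p x = (\<Sum>j=1..N. c j * P j x)" and q: "\<And>x. q x = (\<Sum>j=1..M. d j * P j x)"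
    using assms unfolding in_span_def by blast
  have pad: "(\<Sum>j=1..N. c j * P j x) = (\<Sum>j=1..max N M. (if j \<le> N then c j else 0) * P j x)"
    "(\<Sum>j=1..M. d j * P j x) = (\<Sum>j=1..max N M. (if j \<le> M then d j else 0) * P j x)" for x
    by (rule sum.mono_neutral_cong_left; auto)+
  have "p x + q x = (\<Sum>j=1..max N M. ((if j \<le> N then c j else 0) + (if j \<le> M then d j else 0)) * P j x)" for x
    unfolding p q pad by (simp add: sum.distrib distrib_right)
  then show ?thesis unfolding in_span_def by (intro exI allI)
qed

lemma in_span_scale: "in_span p \<Longrightarrow> in_span (\<lambda>x. s * p x)"
  unfolding in_span_def by (auto simp: sum_distrib_left mult.assoc[symmetric]) (metis (no_types))

lemma in_span_P: "in_span (P j)"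
proof (cases "j = 0")
  case True
  then have "\<forall>x. P j x = (\<Sum>i=1..0. 0 * P i x)" for x :: real by simp
  then show ?thesis unfolding in_span_def using True by fastforce
next
  case False
  then have "P j x = (\<Sum>i=1..j. (if i = j then 1 else 0) * P i x)" for x :: real
    by (subst sum.mono_neutral_right[of _ "{j}"]) auto
  then show ?thesis unfolding in_span_def by (intro exI allI)
qed

lemma in_span_sum: "(\<And>i. i \<in> A \<Longrightarrow> in_span (f i)) \<Longrightarrow> in_span (\<lambda>x. \<Sum>i\<in>A. f i x)"
proof (induction A rule: infinite_finite_induct)
  case (insert i A)
  then show ?case using in_span_add[of "f i" "\<lambda>x. \<Sum>i\<in>A. f i x"] by simp
qed (use in_span_scale[OF in_span_P, of 0] in auto)

lemma in_span_shift:
  assumes "in_span p" shows "in_span (\<lambda>x. x * p x)"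
proof -
  obtain N c where p: "\<And>x. p x = (\<Sum>j=1..N. c j * P j x)" using assms unfolding in_span_def by blast
  have "x * p x = (\<Sum>j=1..N. c j * (a j * P (Suc j) x + b j * P j x + a (j - 1) * P (j - 1) x))" for x
    unfolding p sum_distrib_left
  proof (rule sum.cong)
    fix j assume "j \<in> {1..N}"
    then show "x * (c j * P j x) = c j * (a j * P (Suc j) x + b j * P j x + a (j - 1) * P (j - 1) x)"
      using P_rec_real[of j x] by (metis atLeastAtMost_iff mult.left_commute)
  qed simp
  moreover have "in_span (\<lambda>x. \<Sum>j=1..N. c j * (a j * P (Suc j) x + b j * P j x + a (j - 1) * P (j - 1) x))"
    by (intro in_span_sum in_span_scale in_span_add in_span_P)
  ultimately show ?thesis by presburger
qed

text \<open>Horner's scheme: the constant is a multiple of \<open>P 1\<close> = 1, and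
  multiplication by x preserves the span by the three-term recursion.\<close>

lemma in_span_poly: "in_span (poly p)"
proof (induction p)
  case 0
  show ?case using in_span_scale[OF in_span_P, of 0 0] by simp
next
  case (pCons a p)
  have "in_span (\<lambda>x. a * P (Suc 0) x + x * poly p x)"
    by (intro in_span_add in_span_scale in_span_P in_span_shift pCons)
  then show ?case by simp
qed

end

section \<open>From the moments of the spectral measure to orthonormality and compact
  support\<close>

lemma jacobi_op_apply:
  assumes "1 \<le> m"
  shows "jacobi_op a b u m = (if m = 1 then 0 else a (m - 1) * u (m - 1)) + b m * u m + a m * u (Suc m)"
proof -
  have "jacobi_op a b u m = (\<Sum>\<^sub>\<infinity>n\<in>{m - 1, m, Suc m} \<inter> {1..}. jacobi_matrix a b m n * u n)"
    unfolding jacobi_op_def by (rule infsum_cong_neutral) (auto simp: jacobi_matrix_def)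
  also have "\<dots> = (\<Sum>n\<in>{m - 1, m, Suc m} \<inter> {1..}. jacobi_matrix a b m n * u n)" by (rule infsum_finite) auto
  also have "\<dots> = (if m = 1 then 0 else a (m - 1) * u (m - 1)) + b m * u m + a m * u (Suc m)"
  proof (cases "m = 1")
    case True
    then have "{m - 1, m, Suc m} \<inter> {1..} = {m, Suc m}" by auto
    then show ?thesis using True by (simp add: jacobi_matrix_def)
  next
    case False
    then obtain k where k: "m = Suc k" "1 \<le> k" using assms by (cases m) auto
    then have "{m - 1, m, Suc m} \<inter> {1..} = {k, Suc k, Suc (Suc k)}" by auto
    then show ?thesis using k by (simp add: jacobi_matrix_def)
  qed
  finally show ?thesis .
qed

text \<open>Agreement is asked for only at indices from 1 on. This suffices because the sum defining
  \<open>jacobi_op\<close> starts at 1, so the arbitrary value at 0 never feeds back.\<close>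

lemma jacobi_op_pow_lincomb:
  assumes "\<And>m. 1 \<le> m \<Longrightarrow> w m = (\<Sum>i\<in>A. s i * u i m)"
  shows "1 \<le> m \<Longrightarrow> (jacobi_op a b ^^ k) w m = (\<Sum>i\<in>A. s i * (jacobi_op a b ^^ k) (u i) m)"
proof (induction k arbitrary: m)
  case (Suc k)
  then show ?case
    by (cases "m = 1") (simp_all add: jacobi_op_apply sum_distrib_left sum.distrib[symmetric] algebra_simps)
qed (use assms in simp)

lemma l2_inner_unit_1: "l2_inner (unit_seq 1) v = v 1"
proof -
  have "l2_inner (unit_seq 1) v = (\<Sum>\<^sub>\<infinity>n\<in>{1}. unit_seq 1 n * v n)"
    unfolding l2_inner_def by (rule infsum_cong_neutral) (auto simp: unit_seq_def)
  then show ?thesis by (simp add: unit_seq_def)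
qed

locale jacobi_measure = jacobi_coeffs +
  fixes \<mu> :: "real measure"
  assumes spectral: "canonical_spectral_measure a b \<mu>"
begin

lemma sets_mu [measurable_cong, simp]: "sets \<mu> = sets borel"
  using spectral by (simp add: canonical_spectral_measure_def)

lemma space_mu [simp]: "space \<mu> = UNIV" using sets_eq_imp_space_eq[OF sets_mu] by simp

lemma integrable_poly: "integrable \<mu> (poly p)"
proof -
  have "poly p = (\<lambda>x. \<Sum>i\<le>degree p. coeff p i * x ^ i)" by (simp add: poly_altdef fun_eq_iff)
  moreover have "integrable \<mu> (\<lambda>x. x ^ i)" for i
    using spectral unfolding canonical_spectral_measure_def by blast
  ultimately show ?thesis by (simp add: Bochner_Integration.integrable_sum)
qed

lemma integrable_PP: "integrable \<mu> (\<lambda>x. P i x * P j x)" "integrable \<mu> (P i)" "integrable \<mu> (\<lambda>x. x * (P i x * P j x))"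
   "integrable \<mu> (\<lambda>x. x ^ k * P j x)"
proof -
  obtain p :: "real poly" where "\<And>x. P i x = poly p x" using P_poly[of i] by blast
  moreover obtain q :: "real poly" where "\<And>x. P j x = poly q x" using P_poly[of j] by blast
  ultimately have "(\<lambda>x. P i x * P j x) = poly (p * q)" "(P i) = poly p" "(\<lambda>x. x * (P i x * P j x)) = poly ([:0,1:] * (p * q))"
    "(\<lambda>x. x ^ k * P j x) = poly (monom 1 k * q)"
    by (auto simp: fun_eq_iff poly_monom)
  then show "integrable \<mu> (\<lambda>x. P i x * P j x)" "integrable \<mu> (P i)" "integrable \<mu> (\<lambda>x. x * (P i x * P j x))"
    "integrable \<mu> (\<lambda>x. x ^ k * P j x)"
    using integrable_poly by metis+
qed

lemma moment: "(\<integral>x. x ^ k \<partial>\<mu>) = (jacobi_op a b ^^ k) (unit_seq 1) 1"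
  using spectral unfolding canonical_spectral_measure_def l2_inner_unit_1 by blast

text \<open>The spectral theorem for polynomials in coordinates: \<open>P j\<close> applied to the
  matrix sends the first unit vector to the j-th one. Only moments are given, so this is proved by
  running the recursions of \<open>P\<close> and of the matrix side by side; for j = 0 both sides
  vanish.\<close>

lemma moment_P: "(\<integral>x. x ^ k * P j x \<partial>\<mu>) = (jacobi_op a b ^^ k) (unit_seq j) 1"
proof (induction j arbitrary: k rule: induct_nat_012)
  case 0
  have "(jacobi_op a b ^^ k) (unit_seq 0) 1 = (\<Sum>i\<in>{}. 0 * (jacobi_op a b ^^ k) (\<lambda>_. 0) 1)"
    by (rule jacobi_op_pow_lincomb) (auto simp: unit_seq_def)
  then show ?case by simp
next
  case 1
  then show ?case using moment by simp
next
  case (ge2 n)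
  let ?n = "Suc n"
  have rec: "x ^ k * P (Suc ?n) x = (1 / a ?n) * (x ^ Suc k * P ?n x) + ((- b ?n / a ?n) * (x ^ k * P ?n x) + (- a n / a ?n) * (x ^ k * P n x))" for x :: real
    using a_pos[of ?n] by (simp add: field_simps)
  have "(\<integral>x. x ^ k * P (Suc ?n) x \<partial>\<mu>) = (1 / a ?n) * (\<integral>x. x ^ Suc k * P ?n x \<partial>\<mu>)
      + ((- b ?n / a ?n) * (\<integral>x. x ^ k * P ?n x \<partial>\<mu>) + (- a n / a ?n) * (\<integral>x. x ^ k * P n x \<partial>\<mu>))"
    unfolding rec using integrable_PP(4)[of "Suc k" ?n] integrable_PP(4)[of k ?n] integrable_PP(4)[of k n]
    by (simp del: orth_poly.simps power_Suc)
  also have "\<dots> = (1 / a ?n) * (jacobi_op a b ^^ k) (jacobi_op a b (unit_seq ?n)) 1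
      + ((- b ?n / a ?n) * (jacobi_op a b ^^ k) (unit_seq ?n) 1 + (- a n / a ?n) * (jacobi_op a b ^^ k) (unit_seq n) 1)"
    unfolding ge2 by (simp add: funpow_Suc_right del: funpow.simps)
  also have "\<dots> = (\<Sum>i\<in>{0,1,2::nat}. [1 / a ?n, - b ?n / a ?n, - a n / a ?n] ! i *
        (jacobi_op a b ^^ k) ([jacobi_op a b (unit_seq ?n), unit_seq ?n, unit_seq n] ! i) 1)"
    by simp
  also have "\<dots> = (jacobi_op a b ^^ k) (unit_seq (Suc ?n)) 1"
  proof (rule jacobi_op_pow_lincomb[symmetric])
    fix m :: nat assume m: "1 \<le> m"
    have "jacobi_op a b (unit_seq ?n) m
        = (if m = Suc ?n then a ?n else 0) + (if m = ?n then b ?n else 0) + (if m = n then a n else 0)"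
      using m by (cases m) (auto simp: jacobi_op_apply unit_seq_def)
    then show "unit_seq (Suc ?n) m = (\<Sum>i\<in>{0,1,2::nat}. [1 / a ?n, - b ?n / a ?n, - a n / a ?n] ! i *
        ([jacobi_op a b (unit_seq ?n), unit_seq ?n, unit_seq n] ! i) m)"
      using a_pos[of ?n] by (simp add: unit_seq_def)
  qed simp
  finally show ?case .
qed

text \<open>The case i = 1 is the zeroth power in \<open>moment_P\<close>. In the step the recursion
  for \<open>P i\<close> creates a factor x, which the recursion for \<open>P j\<close> absorbs, so
  that only smaller first indices remain.\<close>

lemma orthonormal: "(\<integral>x. P i x * P j x \<partial>\<mu>) = (if i = j \<and> 1 \<le> i then 1 else 0)"
proof (induction i arbitrary: j rule: induct_nat_012)
  case 0
  then show ?case by simp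
next
  case 1
  then show ?case using moment_P[of 0 j] by (simp add: unit_seq_def)
next
  case (ge2 n)
  let ?n = "Suc n"
  show ?case
  proof (cases "j = 0")
    case False
    have rec: "P (Suc ?n) x * P j x = (1 / a ?n) * ((a j * (P ?n x * P (Suc j) x) + b j * (P ?n x * P j x) + a (j - 1) * (P ?n x * P (j - 1) x))
        - b ?n * (P ?n x * P j x) - a n * (P n x * P j x))" for x :: real
    proof -
      have "a j * (P ?n x * P (Suc j) x) + b j * (P ?n x * P j x) + a (j - 1) * (P ?n x * P (j - 1) x) = P ?n x * (x * P j x)"
        using False by (subst P_rec_real) (auto simp: algebra_simps)
      then show ?thesis using a_pos[of ?n] by (simp add: field_simps)
    qed
    have "(\<integral>x. P (Suc ?n) x * P j x \<partial>\<mu>) = (1 / a ?n) * ((a j * (\<integral>x. P ?n x * P (Suc j) x \<partial>\<mu>)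
        + b j * (\<integral>x. P ?n x * P j x \<partial>\<mu>) + a (j - 1) * (\<integral>x. P ?n x * P (j - 1) x \<partial>\<mu>))
        - b ?n * (\<integral>x. P ?n x * P j x \<partial>\<mu>) - a n * (\<integral>x. P n x * P j x \<partial>\<mu>))"
      unfolding rec using integrable_PP(1) by (simp del: orth_poly.simps)
    then show ?thesis unfolding ge2 using False a_pos[of ?n] by auto
  qed simp
qed

lemma finite_measure_mu: "finite_measure \<mu>"
proof -
  have "integrable \<mu> (\<lambda>x. 1::real)" using integrable_PP(4)[of 0 1] by simp
  then show ?thesis by (intro finite_measureI) (auto simp: integrable_iff_bounded less_top[symmetric])
qed

text \<open>Each row of the matrix has at most three entries of size at most K, so one application
  enlarges the supremum norm by at most 3 K.\<close>

lemma moment_bound: "\<bar>\<integral>x. x ^ k \<partial>\<mu>\<bar> \<le> (3 * K) ^ k"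
proof -
  have "1 \<le> m \<Longrightarrow> \<bar>(jacobi_op a b ^^ k) (unit_seq 1) m\<bar> \<le> (3 * K) ^ k" for m
  proof (induction k arbitrary: m)
    case 0
    then show ?case by (simp add: unit_seq_def)
  next
    case (Suc k)
    let ?u = "(jacobi_op a b ^^ k) (unit_seq 1)" and ?B = "(3 * K) ^ k"
    have B0: "0 \<le> ?B" using K_pos by simp
    have t: "\<bar>s * ?u i\<bar> \<le> K * ?B" if "1 \<le> i" "\<bar>s\<bar> \<le> K" for s i
      unfolding abs_mult using Suc.IH[OF that(1)] that(2) by (intro mult_mono) auto
    have "\<bar>a m * ?u (Suc m)\<bar> \<le> K * ?B" "\<bar>b m * ?u m\<bar> \<le> K * ?B"
      by (rule t; use Suc.prems a_pos[of m] a_le[of m] b_le[of m] in simp)+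
    moreover have "\<bar>if m = 1 then 0 else a (m - 1) * ?u (m - 1)\<bar> \<le> K * ?B"
    proof (cases "m = 1")
      case False
      then have "\<bar>a (m - 1) * ?u (m - 1)\<bar> \<le> K * ?B"
      proof (intro t)
        show m1: "1 \<le> m - 1" using False Suc.prems by linarith
        show "\<bar>a (m - 1)\<bar> \<le> K" using a_pos[OF m1] a_le[OF m1] by linarith
      qed
      then show ?thesis using False by simp
    qed (use K_pos B0 in simp)
    ultimately have "\<bar>jacobi_op a b ?u m\<bar> \<le> 3 * K * ?B" unfolding jacobi_op_apply[OF Suc.prems] by linarith
    then show ?case by simp
  qed
  then show ?thesis unfolding moment by simp
qed

text \<open>Chebyshev's inequality with the power 2 k: the radius 3 K + 1 exceeds the growth rate 3
  K of the moments, so the quotient of the powers tends to 0.\<close>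

lemma AE_support: "AE x in \<mu>. \<bar>x\<bar> < 3 * K + 1"
proof -
  interpret finite_measure \<mu> by (rule finite_measure_mu)
  let ?R = "3 * K + 1" and ?A = "{x::real. 3 * K + 1 \<le> \<bar>x\<bar>}"
  have A: "?A \<in> sets \<mu>" by (auto intro!: borel_closed closed_Collect_le continuous_intros)
  have R: "0 < ?R" using K_pos by simp
  have le: "measure \<mu> ?A \<le> ((3 * K / ?R)\<^sup>2) ^ k" for k
  proof -
    have "measure \<mu> ?A * ?R ^ (2 * k) = (\<integral>x. ?R ^ (2 * k) * indicator ?A x \<partial>\<mu>)"
      using A by (simp add: mult.commute)
    also have "\<dots> \<le> (\<integral>x. x ^ (2 * k) \<partial>\<mu>)"
    proof (rule integral_mono)
      show "integrable \<mu> (\<lambda>x. ?R ^ (2 * k) * indicator ?A x)" using A by (intro integrable_mult_right integrable_real_indicator) (auto simp: emeasure_finite less_top[symmetric])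
      show "integrable \<mu> (\<lambda>x. x ^ (2 * k))" using integrable_PP(4)[of "2 * k" 1] by simp
      show "?R ^ (2 * k) * indicator ?A x \<le> x ^ (2 * k)" for x :: real
      proof (cases "x \<in> ?A")
        case True
        then have "?R ^ (2 * k) \<le> \<bar>x\<bar> ^ (2 * k)" using R by (intro power_mono) auto
        then show ?thesis using True by (simp add: power_even_abs)
      qed simp
    qed
    also have "\<dots> \<le> (3 * K) ^ (2 * k)" using moment_bound[of "2 * k"] by linarith
    finally have "measure \<mu> ?A * ?R ^ (2 * k) \<le> (3 * K) ^ (2 * k)" .
    moreover have "0 < ?R ^ (2 * k)" using R by (rule zero_less_power)
    ultimately have "measure \<mu> ?A \<le> (3 * K) ^ (2 * k) / ?R ^ (2 * k)" by (simp only: pos_le_divide_eq)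
    then show ?thesis by (simp only: power_mult power_divide)
  qed
  have "(\<lambda>k. ((3 * K / ?R)\<^sup>2) ^ k) \<longlonglongrightarrow> 0"
    using K_pos R by (intro LIMSEQ_realpow_zero) (auto simp: power_less_one_iff abs_square_less_1)
  then have "measure \<mu> ?A \<le> 0" using le by (intro LIMSEQ_le_const) auto
  then have "emeasure \<mu> ?A = 0" using emeasure_eq_measure measure_nonneg[of \<mu> ?A] by simp
  then show ?thesis using A by (intro AE_I[of _ _ ?A]) auto
qed

lemma integral_square_span:
  "(\<integral>x. (\<Sum>j=1..N. c j * P j x)\<^sup>2 \<partial>\<mu>) = (\<Sum>j=1..N. (c j)\<^sup>2)"
proof -
  have "(\<integral>x. (\<Sum>j=1..N. c j * P j x)\<^sup>2 \<partial>\<mu>) = (\<integral>x. (\<Sum>i=1..N. \<Sum>j=1..N. c i * c j * (P i x * P j x)) \<partial>\<mu>)"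
    by (simp add: power2_eq_square sum_product mult_ac)
  also have "\<dots> = (\<Sum>i=1..N. \<Sum>j=1..N. c i * c j * (\<integral>x. P i x * P j x \<partial>\<mu>))"
    using integrable_PP(1) by (simp add: Bochner_Integration.integrable_sum)
  also have "\<dots> = (\<Sum>i=1..N. \<Sum>j=1..N. if j = i then c i * c i else 0)"
    by (intro sum.cong) (auto simp: orthonormal)
  finally show ?thesis by (simp add: power2_eq_square)
qed

end

subsection \<open>Absence of absolutely continuous spectrum outside the band\<close>

context jacobi_measure
begin

section \<open>The second solution: Wronskian and uniform square root integrals\<close>

abbreviation u :: "nat \<Rightarrow> complex \<Rightarrow> complex" where "u n \<equiv> cauchy_transform \<mu> (P n)"

text \<open>Writing t = z + (t - z) in the recursion for \<open>P n\<close> t reproduces z under the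
  kernel and leaves the plain integral of \<open>P n\<close>. Orthogonality to \<open>P 1\<close> =
  1 makes that 0 except for n = 1, the source of the inhomogeneous term.\<close>

lemma u_rec:
  assumes z: "0 < Im z" and n: "1 \<le> n"
  shows "of_real (a n) * u (Suc n) z = (z - of_real (b n)) * u n z - of_real (a (n - 1)) * u (n - 1) z + (if n = 1 then 1 else 0)"
proof -
  have iz: "Im z \<noteq> 0" using z by simp
  have nz: "of_real t - z \<noteq> 0" for t using z by (auto simp: complex_eq_iff)
  have int: "integrable \<mu> (\<lambda>t. of_real (P k t) / (of_real t - z))" for k
    by (rule integrable_cauchy[OF sets_mu integrable_PP(2) iz])
  have intP: "integrable \<mu> (\<lambda>t. complex_of_real (P k t))" for k
    using integrable_PP(2)[of k] by (rule integrable_of_real)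
  have e1: "of_real (a n) * (of_real (P (Suc n) t) / (of_real t - z)) + of_real (b n) * (of_real (P n t) / (of_real t - z))
      + of_real (a (n - 1)) * (of_real (P (n - 1) t) / (of_real t - z))
      = of_real (P n t) + z * (of_real (P n t) / (of_real t - z))" for t
  proof -
    have "of_real (a n) * of_real (P (Suc n) t) + of_real (b n) * of_real (P n t) + of_real (a (n - 1)) * of_real (P (n - 1) t)
        = complex_of_real t * of_real (P n t)"
      unfolding of_real_mult[symmetric] of_real_add[symmetric] P_rec_real[OF n, of t] ..
    also have "\<dots> = of_real (P n t) * (of_real t - z) + z * of_real (P n t)" by (simp add: algebra_simps)
    finally show ?thesis using nz[of t] by (simp add: add_divide_distrib[symmetric] divide_simps)
  qed
  define q where "q k t = complex_of_real (P k t) / (of_real t - z)" for k t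
  have uq: "u k z = (\<integral>t. q k t \<partial>\<mu>)" for k by (simp add: cauchy_transform_def q_def)
  have intq: "integrable \<mu> (q k)" for k unfolding q_def by (rule int)
  note e1 = e1[folded q_def]
  have "of_real (a n) * u (Suc n) z + of_real (b n) * u n z + of_real (a (n - 1)) * u (n - 1) z
      = (\<integral>t. of_real (a n) * q (Suc n) t + of_real (b n) * q n t + of_real (a (n - 1)) * q (n - 1) t \<partial>\<mu>)"
    unfolding uq using intq by simp
  also have "\<dots> = (\<integral>t. of_real (P n t) \<partial>\<mu>) + z * u n z"
    unfolding e1 uq using intq intP by simp
  also have "(\<integral>t. complex_of_real (P n t) \<partial>\<mu>) = (if n = 1 then 1 else 0)"
    using moment_P[of 0 n] by (simp add: unit_seq_def integral_of_real)
  finally show ?thesis by (simp add: algebra_simps)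
qed

text \<open>Two solutions of the same recursion have constant Wronskian from n = 1 on; the
  inhomogeneous term in \<open>u_rec\<close> at n = 1 fixes its value to 1.\<close>

lemma wronskian:
  assumes z: "0 < Im z" and n: "1 \<le> n"
  shows "of_real (a n) * (P n z * u (Suc n) z - P (Suc n) z * u n z) = 1"
  using n
proof (induction n rule: nat_induct_at_least)
  case base
  have "u 0 z = 0" by (simp add: cauchy_transform_def)
  then have "of_real (a 1) * u (Suc 1) z = (z - of_real (b 1)) * u 1 z + 1" using u_rec[OF z, of 1] by simp
  moreover have "of_real (a 1) * P (Suc 1) z = z - of_real (b 1)" using P_rec[of 1 z] by (simp add: algebra_simps)
  moreover have "of_real (a 1) * (P 1 z * u (Suc 1) z - P (Suc 1) z * u 1 z)
      = of_real (a 1) * u (Suc 1) z - (of_real (a 1) * P (Suc 1) z) * u 1 z"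
    by (simp add: right_diff_distrib del: orth_poly.simps(3))
  ultimately show ?case by (simp only:) simp
next
  case (Suc n)
  have uu: "of_real (a (Suc n)) * u (Suc (Suc n)) z = (z - of_real (b (Suc n))) * u (Suc n) z - of_real (a n) * u n z"
    using u_rec[OF z, of "Suc n"] Suc(1) by simp
  have PP: "of_real (a (Suc n)) * P (Suc (Suc n)) z = (z - of_real (b (Suc n))) * P (Suc n) z - of_real (a n) * P n z"
    using P_rec[of "Suc n" z] by (simp add: algebra_simps del: orth_poly.simps)
  have "of_real (a (Suc n)) * (P (Suc n) z * u (Suc (Suc n)) z - P (Suc (Suc n)) z * u (Suc n) z)
      = P (Suc n) z * ((z - of_real (b (Suc n))) * u (Suc n) z - of_real (a n) * u n z)
        - ((z - of_real (b (Suc n))) * P (Suc n) z - of_real (a n) * P n z) * u (Suc n) z"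
  proof -
    have "s * (x * y - w * v) = x * (s * y) - (s * w) * v" for s x y w v :: complex by (simp add: algebra_simps)
    then show ?thesis using uu PP by presburger
  qed
  also have "\<dots> = of_real (a n) * (P n z * u (Suc n) z - P (Suc n) z * u n z)" by (simp add: algebra_simps)
  finally show ?case unfolding Suc(2) .
qed

text \<open>Kolmogorov's argument needs a nonnegative integrand and \<open>P n\<close> changes sign.
  Polarisation against \<open>P 1\<close> = 1 writes 4 \<open>P n\<close> as a difference of two
  squares.\<close>

lemma u_split:
  assumes z: "0 < Im z"
  shows "u n z = (cauchy_transform \<mu> (\<lambda>t. (P 1 t + P n t)\<^sup>2) z - cauchy_transform \<mu> (\<lambda>t. (P 1 t - P n t)\<^sup>2) z) / 4"
proof -
  have i: "integrable \<mu> (\<lambda>t. (P 1 t + P n t)\<^sup>2)" "integrable \<mu> (\<lambda>t. (P 1 t - P n t)\<^sup>2)"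
    using integrable_PP(1)[of 1 1] integrable_PP(1)[of 1 n] integrable_PP(1)[of n n]
    by (simp_all add: power2_eq_square algebra_simps)
  have iz: "Im z \<noteq> 0" using z by simp
  have "u n z = (\<integral>t. (of_real ((P 1 t + P n t)\<^sup>2) / (of_real t - z) - of_real ((P 1 t - P n t)\<^sup>2) / (of_real t - z)) / 4 \<partial>\<mu>)"
    unfolding cauchy_transform_def
  proof (rule Bochner_Integration.integral_cong)
    fix t
    have "of_real ((P 1 t + P n t)\<^sup>2) - of_real ((P 1 t - P n t)\<^sup>2) = 4 * complex_of_real (P n t)"
      unfolding of_real_diff[symmetric] by (simp add: power2_eq_square algebra_simps)
    note e = this
    have pe: "p / y = 4 * p / y / 4" for p y :: complex by simp
    show "of_real (P n t) / (of_real t - z) =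
        (of_real ((P 1 t + P n t)\<^sup>2) / (of_real t - z) - of_real ((P 1 t - P n t)\<^sup>2) / (of_real t - z)) / 4"
      unfolding diff_divide_distrib[symmetric] e by (rule pe)
  qed simp
  also have "\<dots> = (cauchy_transform \<mu> (\<lambda>t. (P 1 t + P n t)\<^sup>2) z - cauchy_transform \<mu> (\<lambda>t. (P 1 t - P n t)\<^sup>2) z) / 4"
    unfolding cauchy_transform_def
    using integrable_cauchy[OF sets_mu i(1) iz] integrable_cauchy[OF sets_mu i(2) iz] by simp
  finally show ?thesis .
qed

lemma u_sqrt_integral:
  assumes n: "1 \<le> n" and R: "0 < R" and e: "0 < e"
  shows "integral {-R..R} (\<lambda>x. (R\<^sup>2 - x\<^sup>2) * sqrt (norm (u n (of_real x + \<i> * of_real e))))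
    \<le> sqrt 2 * (2 * pi * R\<^sup>2 * (R + 4))"
proof -
  define A B where "A = cauchy_transform \<mu> (\<lambda>t. (P 1 t + P n t)\<^sup>2)" and "B = cauchy_transform \<mu> (\<lambda>t. (P 1 t - P n t)\<^sup>2)"
  note P1 = orth_poly.simps(2)[of a b, folded One_nat_def]
  have i: "integrable \<mu> (\<lambda>t. (P 1 t + P n t)\<^sup>2)" "integrable \<mu> (\<lambda>t. (P 1 t - P n t)\<^sup>2)"
    using integrable_PP(1)[of 1 1] integrable_PP(1)[of 1 n] integrable_PP(1)[of n n]
    by (simp_all add: power2_eq_square algebra_simps)
  \<comment> \<open>Expanding gives 1 + 2 s delta + 1, where delta = 1 only for n = 1; the worst
    case is 4.\<close>
  have sq: "(\<integral>t. (P 1 t + s * P n t)\<^sup>2 \<partial>\<mu>) \<le> 4" if "\<bar>s\<bar> = 1" for s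
  proof -
    have "(\<integral>t. (P 1 t + s * P n t)\<^sup>2 \<partial>\<mu>) = (\<integral>t. P 1 t * P 1 t + (2 * s) * (P 1 t * P n t) + s\<^sup>2 * (P n t * P n t) \<partial>\<mu>)"
      by (rule Bochner_Integration.integral_cong) (auto simp: power2_eq_square algebra_simps)
    also have "\<dots> = (\<integral>t. P 1 t * P 1 t \<partial>\<mu>) + (2 * s) * (\<integral>t. P 1 t * P n t \<partial>\<mu>) + s\<^sup>2 * (\<integral>t. P n t * P n t \<partial>\<mu>)"
      using integrable_PP(1)[of 1 1] integrable_PP(1)[of 1 n] integrable_PP(1)[of n n] by simp
    also have "s\<^sup>2 = 1" using that by (metis abs_square_eq_1)
    finally show ?thesis unfolding orthonormal using that n by (auto simp: abs_if split: if_splits)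
  qed
  have bA: "integral {-R..R} (\<lambda>x. (R\<^sup>2 - x\<^sup>2) * sqrt (norm (A (of_real x + \<i> * of_real e)))) \<le> sqrt 2 * (2 * pi * R\<^sup>2 * (R + 4))"
    using cauchy_transform_sqrt_bound[OF sets_mu i(1) _ _ R e, of 4 0] sq[of 1] by (simp add: A_def)
  have bB: "integral {-R..R} (\<lambda>x. (R\<^sup>2 - x\<^sup>2) * sqrt (norm (B (of_real x + \<i> * of_real e)))) \<le> sqrt 2 * (2 * pi * R\<^sup>2 * (R + 4))"
    using cauchy_transform_sqrt_bound[OF sets_mu i(2) _ _ R e, of 4 0] sq[of "-1"] by (simp add: B_def)
  have cont: "continuous_on {-R..R} (\<lambda>x. cauchy_transform \<mu> g (of_real x + \<i> * of_real e))" if "integrable \<mu> g" for g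
    by (rule continuous_on_compose2[OF holomorphic_on_imp_continuous_on[OF holomorphic_cauchy_transform[OF sets_mu that]]])
       (auto intro!: continuous_intros simp: e)
  have int: "(\<lambda>x. (R\<^sup>2 - x\<^sup>2) * sqrt (norm (cauchy_transform \<mu> g (of_real x + \<i> * of_real e)))) integrable_on {-R..R}"
    if "integrable \<mu> g" for g
    by (intro integrable_continuous_real continuous_intros cont that)
  have "integral {-R..R} (\<lambda>x. (R\<^sup>2 - x\<^sup>2) * sqrt (norm (u n (of_real x + \<i> * of_real e))))
      \<le> integral {-R..R} (\<lambda>x. (1/2) * ((R\<^sup>2 - x\<^sup>2) * sqrt (norm (A (of_real x + \<i> * of_real e))))
           + (1/2) * ((R\<^sup>2 - x\<^sup>2) * sqrt (norm (B (of_real x + \<i> * of_real e)))))"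
  proof (rule integral_le)
    fix x assume x: "x \<in> {-R..R}"
    let ?z = "of_real x + \<i> * of_real e"
    have sp: "u n ?z = (A ?z - B ?z) / 4" unfolding A_def B_def by (rule u_split) (use e in simp)
    have "norm (u n ?z) \<le> (norm (A ?z) + norm (B ?z)) / 4"
      unfolding sp using norm_triangle_ineq4[of "A ?z" "B ?z"] by (simp add: norm_divide)
    then have "sqrt (norm (u n ?z)) \<le> sqrt ((norm (A ?z) + norm (B ?z)) / 4)" by (rule real_sqrt_le_mono)
    also have "\<dots> \<le> (sqrt (norm (A ?z)) + sqrt (norm (B ?z))) / 2"
      using sqrt_add_le_add_sqrt[of "norm (A ?z)" "norm (B ?z)"] by (simp add: real_sqrt_divide)
    finally have "sqrt (norm (u n ?z)) \<le> (sqrt (norm (A ?z)) + sqrt (norm (B ?z))) / 2" .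
    moreover have "0 \<le> R\<^sup>2 - x\<^sup>2" using x R abs_le_square_iff[of x R] by (auto simp: abs_le_iff)
    ultimately have "(R\<^sup>2 - x\<^sup>2) * sqrt (norm (u n ?z)) \<le> (R\<^sup>2 - x\<^sup>2) * ((sqrt (norm (A ?z)) + sqrt (norm (B ?z))) / 2)"
      by (rule mult_left_mono)
    then show "(R\<^sup>2 - x\<^sup>2) * sqrt (norm (u n ?z)) \<le>
        (1/2) * ((R\<^sup>2 - x\<^sup>2) * sqrt (norm (A ?z))) + (1/2) * ((R\<^sup>2 - x\<^sup>2) * sqrt (norm (B ?z)))"
      by (simp only: distrib_left add_divide_distrib times_divide_eq_right)
  qed (use int[OF i(1)] int[OF i(2)] int[OF integrable_PP(2)] in \<open>auto simp: A_def B_def intro!: integrable_add\<close>)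
  also have "\<dots> = (1/2) * integral {-R..R} (\<lambda>x. (R\<^sup>2 - x\<^sup>2) * sqrt (norm (A (of_real x + \<i> * of_real e))))
           + (1/2) * integral {-R..R} (\<lambda>x. (R\<^sup>2 - x\<^sup>2) * sqrt (norm (B (of_real x + \<i> * of_real e))))"
    using int[OF i(1)] int[OF i(2)] by (subst integral_add) (auto simp: A_def B_def)
  also have "\<dots> \<le> sqrt 2 * (2 * pi * R\<^sup>2 * (R + 4))" using bA bB by linarith
  finally show ?thesis .
qed

text \<open>Doubling the radius makes the weight at least 4 \<rho>^2 - \<rho>^2 = 3 \<rho>^2 on the
  set, so it can be divided out.\<close>

lemma u_sqrt_set_integral:
  assumes F: "F \<in> sets borel" "F \<subseteq> {-\<rho>..\<rho>}" and \<rho>: "0 < \<rho>" and n: "1 \<le> n" and e: "0 < e"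
  shows "set_integrable lborel F (\<lambda>x. sqrt (norm (u n (of_real x + \<i> * of_real e))))"
    and "(LINT x:F|lborel. sqrt (norm (u n (of_real x + \<i> * of_real e)))) \<le> sqrt 2 * (2 * pi * (2 * \<rho>)\<^sup>2 * (2 * \<rho> + 4)) / (3 * \<rho>\<^sup>2)"
proof -
  let ?R = "2 * \<rho>"
  let ?h = "\<lambda>x. sqrt (norm (u n (of_real x + \<i> * of_real e)))"
  let ?g = "\<lambda>x. (?R\<^sup>2 - x\<^sup>2) * ?h x"
  have c: "continuous_on S ?h" for S
    by (intro continuous_intros continuous_on_compose2[OF holomorphic_on_imp_continuous_on[OF holomorphic_cauchy_transform[OF sets_mu integrable_PP(2)]]])
       (auto simp: e)
  have ih: "set_integrable lborel {-?R..?R} ?h" using borel_integrable_atLeastAtMost'[OF c] .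
  show iF: "set_integrable lborel F ?h"
    by (rule set_integrable_subset[OF ih]) (use F \<rho> in auto)
  have ig: "set_integrable lborel {-?R..?R} ?g"
    by (intro borel_integrable_atLeastAtMost' continuous_intros c)
  have "(LINT x:F|lborel. ?h x) * (3 * \<rho>\<^sup>2) = (LINT x:F|lborel. (3 * \<rho>\<^sup>2) * ?h x)" by simp
  also have "\<dots> \<le> (LINT x:{-?R..?R}|lborel. ?g x)"
    unfolding set_lebesgue_integral_def
  proof (rule integral_mono)
    show "integrable lborel (\<lambda>x. indicat_real F x *\<^sub>R (3 * \<rho>\<^sup>2 * ?h x))"
      using set_integrable_mult_right[OF iF, of "3 * \<rho>\<^sup>2"] by (simp add: set_integrable_def)
    show "integrable lborel (\<lambda>x. indicat_real {-?R..?R} x *\<^sub>R ?g x)" using ig by (simp add: set_integrable_def)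
    fix x
    show "indicat_real F x *\<^sub>R (3 * \<rho>\<^sup>2 * ?h x) \<le> indicat_real {-?R..?R} x *\<^sub>R ?g x"
    proof (cases "x \<in> F")
      case True
      then have "x\<^sup>2 \<le> \<rho>\<^sup>2" using F \<rho> abs_le_square_iff[of x \<rho>] by (auto simp: abs_le_iff)
      then have "3 * \<rho>\<^sup>2 * ?h x \<le> ?g x" by (intro mult_right_mono) (auto simp: power_mult_distrib)
      then show ?thesis using True F \<rho> by (auto simp: indicator_def)
    next
      case False
      have "0 \<le> ?g x" if "x \<in> {-?R..?R}"
        using that \<rho> abs_le_square_iff[of x ?R] by (intro mult_nonneg_nonneg) (auto simp: abs_le_iff)
      then show ?thesis using False by (auto simp: indicator_def)
    qed
  qed
  also have "\<dots> = integral {-?R..?R} ?g" by (rule set_borel_integral_eq_integral(2)[OF ig])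
  also have "\<dots> \<le> sqrt 2 * (2 * pi * ?R\<^sup>2 * (?R + 4))" by (rule u_sqrt_integral[OF n _ e]) (use \<rho> in simp)
  finally show "(LINT x:F|lborel. ?h x) \<le> sqrt 2 * (2 * pi * ?R\<^sup>2 * (?R + 4)) / (3 * \<rho>\<^sup>2)"
    using \<rho> by (simp add: pos_le_divide_eq)
qed

text \<open>With \<open>X\<close> the size of \<open>(P\<^sub>n, P\<^sub>n\<^sub>+\<^sub>1)\<close> and \<open>U\<close> that of the second solution, the Wronskian gives
  \<open>1 \<le> K X U\<close>, hence \<open>1 \<le> s sqrt U + (K X)\<^sup>2 / s\<^sup>4\<close> for every \<open>s > 0\<close>; now integrate over \<open>F\<close>.\<close>

lemma null_of_small_solutions:
  fixes F :: "real set" and \<rho> :: real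
  assumes F: "F \<in> sets borel" "F \<subseteq> {-\<rho>..\<rho>}" and \<rho>: "0 < \<rho>"
    and small: "\<And>\<eta>. 0 < \<eta> \<Longrightarrow> \<exists>n\<ge>1. (LINT x:F|lborel. (P n x)\<^sup>2 + (P (Suc n) x)\<^sup>2) \<le> \<eta>"
  shows "F \<in> null_sets lborel"
proof -
  define C1 where "C1 = sqrt 2 * (2 * pi * (2 * \<rho>)\<^sup>2 * (2 * \<rho> + 4)) / (3 * \<rho>\<^sup>2)"
  have C1: "0 \<le> C1" using \<rho> by (simp add: C1_def)
  define L where "L = measure lborel F"
  have eF: "emeasure lborel F < \<infinity>"
  proof -
    have "emeasure lborel F \<le> emeasure lborel {-\<rho>..\<rho>}" using F(2) by (intro emeasure_mono) auto
    also have "\<dots> = ennreal (2 * \<rho>)" using \<rho> by simp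
    finally show ?thesis by (simp add: order.strict_trans1 ennreal_less_top)
  qed
  then have LF: "emeasure lborel F = ennreal L" by (simp add: L_def emeasure_eq_ennreal_measure)
  \<comment> \<open>\<open>C1\<close> depends on \<rho> alone, so letting s tend to 0 at the end
    forces the measure \<open>L\<close> of the set to vanish.\<close>
  have main: "L \<le> s * (2 * C1 + 2)" if s: "0 < s" for s
  proof -
    \<comment> \<open>Multiplied by the later factor p = 3 K^2 / s^4 this tolerance contributes
      exactly s. The 3 comes from squaring a sum of three terms.\<close>
    have "0 < s ^ 5 / (3 * K\<^sup>2)" using s K_pos by simp
    from small[OF this] obtain n where n: "1 \<le> n" "(LINT x:F|lborel. (P n x)\<^sup>2 + (P (Suc n) x)\<^sup>2) \<le> s ^ 5 / (3 * K\<^sup>2)" by blast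
    \<comment> \<open>\<kappa> bounds the error of replacing x + i e by x in both polynomials. Its
      contribution p \<kappa>^2 L equals s L / (L + 1), which is at most s; the summand 1 guards
      against L = 0.\<close>
    define \<kappa> where "\<kappa> = sqrt (s ^ 5 / (3 * K\<^sup>2 * (L + 1)))"
    have L0: "0 \<le> L" by (simp add: L_def)
    have \<kappa>: "0 < \<kappa>" using s K_pos L0 by (simp add: \<kappa>_def)
    have ex: "\<exists>d>0. \<forall>e x. 0 < e \<longrightarrow> e \<le> d \<longrightarrow> x \<in> {-\<rho>..\<rho>} \<longrightarrow> norm (P k (of_real x + \<i> * of_real e)) \<le> \<bar>P k x\<bar> + \<kappa>" for k
    proof -
      have "uniformly_continuous_on (cball 0 (\<rho> + 1)) (\<lambda>z::complex. P k z)"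
        by (intro compact_uniformly_continuous continuous_intros) auto
      then obtain d where d: "0 < d" "\<And>z w. z \<in> cball 0 (\<rho> + 1) \<Longrightarrow> w \<in> cball 0 (\<rho> + 1) \<Longrightarrow> dist w z < d \<Longrightarrow> dist (P k w :: complex) (P k z) < \<kappa>"
        unfolding uniformly_continuous_on_def using \<kappa> by metis
      have "norm (P k (of_real x + \<i> * of_real e)) \<le> \<bar>P k x\<bar> + \<kappa>"
        if x: "x \<in> {-\<rho>..\<rho>}" and e: "0 < e" "e \<le> min 1 (d / 2)" for e x
      proof -
        have "norm (of_real x + \<i> * of_real e) \<le> \<bar>x\<bar> + e"
          using norm_triangle_ineq[of "of_real x" "\<i> * of_real e"] e by (simp add: norm_mult)
        then have "of_real x + \<i> * of_real e \<in> cball 0 (\<rho> + 1)" "complex_of_real x \<in> cball 0 (\<rho> + 1)"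
          using x e by (auto simp: abs_le_iff)
        moreover have "dist (of_real x + \<i> * of_real e) (complex_of_real x) < d"
          using e d(1) by (simp add: dist_norm norm_mult)
        ultimately have "dist (P k (of_real x + \<i> * of_real e) :: complex) (P k (of_real x)) < \<kappa>"
          by (intro d(2))
        then show ?thesis
          using norm_triangle_ineq2[of "P k (of_real x + \<i> * of_real e)" "P k (complex_of_real x)"]
          by (simp add: dist_norm orth_poly_of_real)
      qed
      then show ?thesis using d(1) by (intro exI[of _ "min 1 (d / 2)"]) auto
    qed
    obtain e1 where e1: "0 < e1" "\<And>e x. 0 < e \<Longrightarrow> e \<le> e1 \<Longrightarrow> x \<in> {-\<rho>..\<rho>} \<Longrightarrow> norm (P n (of_real x + \<i> * of_real e)) \<le> \<bar>P n x\<bar> + \<kappa>"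
      using ex[of n] by blast
    obtain e2 where e2: "0 < e2" "\<And>e x. 0 < e \<Longrightarrow> e \<le> e2 \<Longrightarrow> x \<in> {-\<rho>..\<rho>} \<Longrightarrow> norm (P (Suc n) (of_real x + \<i> * of_real e)) \<le> \<bar>P (Suc n) x\<bar> + \<kappa>"
      using ex[of "Suc n"] by blast
    \<comment> \<open>The height is fixed only after n. This is harmless because the integral bound
      for \<open>u n\<close> holds for every positive height with the same constant.\<close>
    define e where "e = min e1 e2"
    have e: "0 < e" "e \<le> e1" "e \<le> e2" using e1(1) e2(1) by (auto simp: e_def)
    define Y where "Y k x = sqrt (norm (u k (of_real x + \<i> * of_real e)))" for k x
    define p where "p = 3 * K\<^sup>2 / s ^ 4"
    have p0: "0 \<le> p" using s by (simp add: p_def)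
    have pt: "1 \<le> s * Y n x + s * Y (Suc n) x + p * ((P n x)\<^sup>2 + (P (Suc n) x)\<^sup>2) + p * \<kappa>\<^sup>2" if x: "x \<in> F" for x
    proof -
      define X where "X = \<bar>P n x\<bar> + \<bar>P (Suc n) x\<bar> + \<kappa>"
      let ?z = "of_real x + \<i> * of_real e :: complex"
      define U where "U = norm (u n ?z) + norm (u (Suc n) ?z)"
      have X0: "0 \<le> X" and U0: "0 \<le> U" using \<kappa> by (auto simp: X_def U_def)
      have xI: "x \<in> {-\<rho>..\<rho>}" using x F by auto
      have "1 = norm (of_real (a n) * (P n ?z * u (Suc n) ?z - P (Suc n) ?z * u n ?z))"
        using wronskian[of ?z n] n e by simp
      also have "\<dots> \<le> a n * (norm (P n ?z) * norm (u (Suc n) ?z) + norm (P (Suc n) ?z) * norm (u n ?z))"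
        using a_pos[OF n(1)] norm_triangle_ineq4[of "P n ?z * u (Suc n) ?z" "P (Suc n) ?z * u n ?z"]
        by (simp add: norm_mult)
      also have "\<dots> \<le> K * (X * norm (u (Suc n) ?z) + X * norm (u n ?z))"
        using e1(2)[OF e(1,2) xI] e2(2)[OF e(1,3) xI] a_le[OF n(1)] a_pos[OF n(1)] K_pos X0
        by (intro mult_mono add_mono) (auto simp: X_def)
      also have "\<dots> = K * X * U" by (simp add: U_def algebra_simps)
      finally have 1: "1 \<le> K * X * U" .
      have "1 \<le> s * sqrt U + (K * X)\<^sup>2 / s ^ 4"
      proof (cases "K * X \<le> s\<^sup>2")
        case True
        then have "1 \<le> s\<^sup>2 * U" using 1 U0 mult_right_mono[OF True U0] by linarith
        then have "sqrt 1 \<le> sqrt (s\<^sup>2 * U)" by (rule real_sqrt_le_mono)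
        then have "1 \<le> s * sqrt U" using s by (simp add: real_sqrt_mult)
        then show ?thesis using s by (smt (verit) divide_nonneg_nonneg zero_le_power2 zero_le_power)
      next
        case False
        then have "(s\<^sup>2)\<^sup>2 \<le> (K * X)\<^sup>2" by (intro power_mono) auto
        then have "1 \<le> (K * X)\<^sup>2 / s ^ 4" using s by (simp add: power_mult[symmetric])
        moreover have "0 \<le> s * sqrt U" using s U0 by simp
        ultimately show ?thesis by linarith
      qed
      moreover have "sqrt U \<le> Y n x + Y (Suc n) x"
        unfolding U_def Y_def by (rule sqrt_add_le_add_sqrt) auto
      then have "s * sqrt U \<le> s * (Y n x + Y (Suc n) x)" using s by (intro mult_left_mono) auto
      moreover have "(K * X)\<^sup>2 / s ^ 4 \<le> p * ((P n x)\<^sup>2 + (P (Suc n) x)\<^sup>2 + \<kappa>\<^sup>2)"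
      proof -
        have t: "(x1 + x2 + x3)\<^sup>2 \<le> 3 * (x1\<^sup>2 + x2\<^sup>2 + x3\<^sup>2)" for x1 x2 x3 :: real
        proof -
          have "0 \<le> (x1 - x2)\<^sup>2 + (x2 - x3)\<^sup>2 + (x1 - x3)\<^sup>2" by simp
          then show ?thesis by (simp add: power2_eq_square algebra_simps)
        qed
        have "X\<^sup>2 \<le> 3 * ((P n x)\<^sup>2 + (P (Suc n) x)\<^sup>2 + \<kappa>\<^sup>2)"
          using t[of "\<bar>P n x\<bar>" "\<bar>P (Suc n) x\<bar>" \<kappa>] by (simp add: X_def)
        then have "K\<^sup>2 / s ^ 4 * X\<^sup>2 \<le> K\<^sup>2 / s ^ 4 * (3 * ((P n x)\<^sup>2 + (P (Suc n) x)\<^sup>2 + \<kappa>\<^sup>2))"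
          using s by (intro mult_left_mono) auto
        moreover have "K\<^sup>2 / s ^ 4 * (3 * y) = p * y" for y by (simp add: p_def)
        ultimately show ?thesis by (simp only: power_mult_distrib times_divide_eq_left)
      qed
      ultimately show ?thesis by (simp add: distrib_left)
    qed
    have iY: "set_integrable lborel F (\<lambda>x. Y k x)" "(LINT x:F|lborel. Y k x) \<le> C1" if "1 \<le> k" for k
      using u_sqrt_set_integral[OF F \<rho> that e(1)] by (auto simp: Y_def C1_def)
    have iP: "set_integrable lborel F (\<lambda>x. (P n x)\<^sup>2 + (P (Suc n) x)\<^sup>2)"
      by (rule set_integrable_subset[OF borel_integrable_atLeastAtMost'[of "-\<rho>" \<rho>]])
         (use F in \<open>auto intro!: continuous_intros\<close>)
    have i1: "set_integrable lborel F (\<lambda>x. c)" for c :: real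
      by (rule set_integrable_subset[OF borel_integrable_atLeastAtMost'[of "-\<rho>" \<rho>]])
         (use F in \<open>auto intro!: continuous_intros\<close>)
    have cL: "(LINT x:F|lborel. c) = c * L" for c :: real
      using F eF by (simp add: set_lebesgue_integral_def L_def mult.commute)
    have "L = (LINT x:F|lborel. 1)" using cL[of 1] by simp
    also have "\<dots> \<le> (LINT x:F|lborel. s * Y n x + s * Y (Suc n) x + p * ((P n x)\<^sup>2 + (P (Suc n) x)\<^sup>2) + p * \<kappa>\<^sup>2)"
      by (rule set_integral_mono) (use iY(1) n iP i1 pt in \<open>auto intro!: set_integral_add(1) set_integrable_mult_right\<close>)
    also have "\<dots> = s * (LINT x:F|lborel. Y n x) + s * (LINT x:F|lborel. Y (Suc n) x)
         + p * (LINT x:F|lborel. (P n x)\<^sup>2 + (P (Suc n) x)\<^sup>2) + p * \<kappa>\<^sup>2 * L"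
      using iY(1)[of n] iY(1)[of "Suc n"] n iP i1
      by (simp add: set_integral_add(2) set_integral_add(1) set_integrable_mult_right cL del: orth_poly.simps)
    also have "\<dots> \<le> s * C1 + s * C1 + p * (s ^ 5 / (3 * K\<^sup>2)) + p * \<kappa>\<^sup>2 * L"
      using iY(2)[of n] iY(2)[of "Suc n"] n s p0 by (intro add_mono mult_left_mono) auto
    also have "p * (s ^ 5 / (3 * K\<^sup>2)) = s"
      using s K_pos by (simp add: p_def field_simps eval_nat_numeral)
    also have "p * \<kappa>\<^sup>2 * L = s * (L / (L + 1))"
    proof -
      have k2: "\<kappa>\<^sup>2 = s ^ 5 / (3 * K\<^sup>2 * (L + 1))" using s L0 unfolding \<kappa>_def by (intro real_sqrt_pow2) simp
      have cl: "X / s ^ 4 * (s ^ 5 / (X * t)) * L = s * (L / t)" if "X \<noteq> 0" for X t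
        using that s by (simp add: eval_nat_numeral)
      show ?thesis unfolding p_def k2 by (rule cl) (use K_pos in simp)
    qed
    also have "s * (L / (L + 1)) \<le> s * 1" using s L0 by (intro mult_left_mono) auto
    finally show ?thesis by (simp add: algebra_simps)
  qed
  have "L \<le> 0"
  proof (rule field_le_epsilon)
    fix d :: real assume d: "0 < d"
    have "L \<le> d / (2 * C1 + 2) * (2 * C1 + 2)" by (rule main) (use d C1 in simp)
    then show "L \<le> 0 + d" using C1 by simp
  qed
  then have "emeasure lborel F = 0" using LF by (simp add: ennreal_neg)
  then show ?thesis using F by (simp add: null_sets_def)
qed

section \<open>Geometric decay of the masses over long blocks of indices\<close>

definition mass :: "real set \<Rightarrow> nat \<Rightarrow> real" where
  "mass I n = (\<integral>x. indicator I x * (P n x)\<^sup>2 \<partial>\<mu>)"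

lemma integrable_mass: "I \<in> sets borel \<Longrightarrow> integrable \<mu> (\<lambda>x. indicator I x * (P n x)\<^sup>2)"
  using integrable_mult_indicator[of I \<mu> "\<lambda>x. P n x * P n x"] integrable_PP(1)[of n n]
  by (simp add: power2_eq_square)

lemma mass_le_1: "I \<in> sets borel \<Longrightarrow> mass I n \<le> 1"
proof -
  assume I: "I \<in> sets borel"
  have "mass I n \<le> (\<integral>x. P n x * P n x \<partial>\<mu>)"
    unfolding mass_def using I integrable_PP(1)[of n n]
    by (intro integral_mono integrable_mass) (auto simp: indicator_def power2_eq_square)
  also have "\<dots> \<le> 1" by (simp add: orthonormal)
  finally show ?thesis .
qed

text \<open>Where \<open>\<bar>x - b m\<bar>\<close> exceeds \<open>a m + a (m - 1)\<close>, the recursion and convexity of the square make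
  \<open>(P\<^sub>m)\<^sup>2\<close> smaller than a proper weighted mean of its neighbours.\<close>

lemma mass_step:
  assumes I: "I \<in> sets borel" and m: "2 \<le> m" and s: "0 < s"
    and hyp: "\<And>x. x \<in> I \<Longrightarrow> s * (a m + a (m - 1)) \<le> \<bar>x - b m\<bar>"
    and B: "mass I (Suc m) \<le> B" "mass I (m - 1) \<le> B"
  shows "mass I m \<le> B / s\<^sup>2"
proof -
  let ?a = "a m" and ?a' = "a (m - 1)"
  have ap: "0 < ?a" "0 < ?a'" using a_pos[of m] a_pos[of "m - 1"] m by auto
  have "s\<^sup>2 * (?a + ?a') * mass I m = (\<integral>x. s\<^sup>2 * (?a + ?a') * (indicator I x * (P m x)\<^sup>2) \<partial>\<mu>)"
    by (simp add: mass_def)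
  also have "\<dots> \<le> (\<integral>x. ?a * (indicator I x * (P (Suc m) x)\<^sup>2) + ?a' * (indicator I x * (P (m - 1) x)\<^sup>2) \<partial>\<mu>)"
  proof (rule integral_mono)
    fix x
    have "s\<^sup>2 * (?a + ?a') * (P m x)\<^sup>2 \<le> ?a * (P (Suc m) x)\<^sup>2 + ?a' * (P (m - 1) x)\<^sup>2" if x: "x \<in> I"
    proof -
      have "(s * (?a + ?a'))\<^sup>2 * (P m x)\<^sup>2 \<le> (x - b m)\<^sup>2 * (P m x)\<^sup>2"
        using hyp[OF x] s ap by (intro mult_right_mono) (auto simp: abs_le_square_iff[symmetric])
      also have "\<dots> = (?a * P (Suc m) x + ?a' * P (m - 1) x)\<^sup>2"
        using P_rec_real[of m x] m by (simp add: power_mult_distrib[symmetric] algebra_simps)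
      also have "\<dots> = (?a + ?a') * (?a * (P (Suc m) x)\<^sup>2 + ?a' * (P (m - 1) x)\<^sup>2) - ?a * ?a' * (P (Suc m) x - P (m - 1) x)\<^sup>2"
        by (simp add: power2_eq_square algebra_simps)
      also have "\<dots> \<le> (?a + ?a') * (?a * (P (Suc m) x)\<^sup>2 + ?a' * (P (m - 1) x)\<^sup>2)" using ap by simp
      finally have "(?a + ?a') * (s\<^sup>2 * (?a + ?a') * (P m x)\<^sup>2) \<le> (?a + ?a') * (?a * (P (Suc m) x)\<^sup>2 + ?a' * (P (m - 1) x)\<^sup>2)"
        by (simp add: power2_eq_square mult_ac)
      then show ?thesis using ap by (simp add: mult_le_cancel_left_pos)
    qed
    then show "s\<^sup>2 * (?a + ?a') * (indicator I x * (P m x)\<^sup>2) \<le> ?a * (indicator I x * (P (Suc m) x)\<^sup>2) + ?a' * (indicator I x * (P (m - 1) x)\<^sup>2)"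
      by (auto simp: indicator_def)
  qed (use I in \<open>auto intro!: integrable_mass Bochner_Integration.integrable_add integrable_mult_right\<close>)
  also have "\<dots> = ?a * mass I (Suc m) + ?a' * mass I (m - 1)"
    using integrable_mass[OF I] by (simp add: mass_def)
  also have "\<dots> \<le> ?a * B + ?a' * B" using B ap by (intro add_mono mult_left_mono) auto
  finally have "(?a + ?a') * (s\<^sup>2 * mass I m) \<le> (?a + ?a') * B" by (simp add: algebra_simps)
  then have "s\<^sup>2 * mass I m \<le> B" using ap by (simp add: mult_le_cancel_left_pos)
  then show ?thesis using s by (simp add: field_simps)
qed

text \<open>A bound at distance M - k from the centre n needs the previous bound one index further
  out on both sides; so every gained factor 1 / s^2 costs one index of the block. M + 2 \<le> n
  keeps the recursion away from the boundary of the matrix.\<close>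

lemma mass_decay:
  assumes I: "I \<in> sets borel" and n: "M + 2 \<le> n" and s: "0 < s"
    and hyp: "\<And>m x. n \<le> m + M \<Longrightarrow> m \<le> n + M \<Longrightarrow> x \<in> I \<Longrightarrow> s * (a m + a (m - 1)) \<le> \<bar>x - b m\<bar>"
  shows "k \<le> M \<Longrightarrow> n \<le> m + (M - k) \<Longrightarrow> m \<le> n + (M - k) \<Longrightarrow> mass I m \<le> (1 / s\<^sup>2) ^ k"
proof (induction k arbitrary: m)
  case 0
  then show ?case using mass_le_1[OF I] by simp
next
  case (Suc k)
  have "mass I m \<le> (1 / s\<^sup>2) ^ k / s\<^sup>2"
    by (rule mass_step[OF I _ s]) (use Suc n hyp in auto)
  then show ?case by (simp add: mult.commute)
qed

lemma nn_integral_density_le: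
  assumes f: "f \<in> borel_measurable borel" and "ac_density \<mu> f" and g: "g \<in> borel_measurable borel"
  shows "(\<integral>\<^sup>+x. ennreal (f x) * g x \<partial>lborel) \<le> (\<integral>\<^sup>+x. g x \<partial>\<mu>)"
proof -
  have "(\<integral>\<^sup>+x. ennreal (f x) * g x \<partial>lborel) = (\<integral>\<^sup>+x. g x \<partial>density lborel (\<lambda>x. ennreal (f x)))"
    using f g by (subst nn_integral_density) auto
  also have "\<dots> \<le> (\<integral>\<^sup>+x. g x \<partial>\<mu>)"
  proof (rule nn_integral_mono_measure)
    show "density lborel (\<lambda>x. ennreal (f x)) \<le> \<mu>"
      using assms by (subst le_measure) (auto simp: ac_density_def emeasure_density)
  qed simp
  finally show ?thesis .
qed

text \<open>On the part of \<open>I\<close> where f is at least \<delta>, Lebesgue measure is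
  dominated by \<mu> / \<delta>, so the decaying masses make the Lebesgue integrals of two
  consecutive squares small for some n. The level sets for \<delta> = 1 / (k + 1) then exhaust the
  set in question.\<close>

lemma ac_null_in_gap:
  assumes ac: "ac_density \<mu> f" and I: "I \<in> sets borel" "I \<subseteq> {-\<rho>..\<rho>}" and \<rho>: "0 < \<rho>" and s: "1 < s"
    and hyp: "\<And>M. \<exists>n\<ge>M + 2. \<forall>m. n \<le> m + M \<longrightarrow> m \<le> n + M \<longrightarrow> (\<forall>x\<in>I. s * (a m + a (m - 1)) \<le> \<bar>x - b m\<bar>)"
  shows "{x\<in>I. 0 < f x} \<in> null_sets lborel"
proof -
  have fm: "f \<in> borel_measurable borel" and f0: "\<And>x. 0 \<le> f x" using ac by (auto simp: ac_density_def)
  have lev: "{x\<in>I. \<delta> \<le> f x} \<in> null_sets lborel" if \<delta>: "0 < \<delta>" for \<delta>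
  proof (rule null_of_small_solutions[OF _ _ \<rho>])
    let ?F = "{x\<in>I. \<delta> \<le> f x}"
    have "?F = I \<inter> {x\<in>space borel. \<delta> \<le> f x}" by auto
    then show F: "?F \<in> sets borel" using I fm by (simp del: space_borel)
    show "?F \<subseteq> {-\<rho>..\<rho>}" using I by auto
    fix \<eta> :: real assume \<eta>: "0 < \<eta>"
    have bd: "(LINT x:?F|lborel. (P n x)\<^sup>2) \<le> mass I n / \<delta>" for n
    proof -
      have i: "set_integrable lborel ?F (\<lambda>x. (P n x)\<^sup>2)"
        by (rule set_integrable_subset[OF borel_integrable_atLeastAtMost'[of "-\<rho>" \<rho>]])
           (use F I in \<open>auto intro!: continuous_intros\<close>)
      have "ennreal (\<delta> * (LINT x:?F|lborel. (P n x)\<^sup>2)) = ennreal \<delta> * (\<integral>\<^sup>+x. ennreal (indicator ?F x * (P n x)\<^sup>2) \<partial>lborel)"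
        using i \<delta> by (subst nn_integral_eq_integral) (auto simp: set_integrable_def set_lebesgue_integral_def ennreal_mult' Bochner_Integration.integral_nonneg)
      also have "\<dots> = (\<integral>\<^sup>+x. ennreal \<delta> * ennreal (indicator ?F x * (P n x)\<^sup>2) \<partial>lborel)"
        using F by (subst nn_integral_cmult) auto
      also have "\<dots> \<le> (\<integral>\<^sup>+x. ennreal (f x) * ennreal (indicator I x * (P n x)\<^sup>2) \<partial>lborel)"
        by (intro nn_integral_mono) (auto simp: indicator_def intro!: mult_right_mono ennreal_leI)
      also have "\<dots> \<le> (\<integral>\<^sup>+x. ennreal (indicator I x * (P n x)\<^sup>2) \<partial>\<mu>)"
        by (rule nn_integral_density_le[OF fm ac]) (use I in measurable)
      also have "\<dots> = ennreal (mass I n)"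
        unfolding mass_def using integrable_mass[OF I(1)] by (intro nn_integral_eq_integral) auto
      finally have "\<delta> * (LINT x:?F|lborel. (P n x)\<^sup>2) \<le> mass I n"
        by (subst (asm) ennreal_le_iff) (auto simp: mass_def intro!: Bochner_Integration.integral_nonneg)
      then show ?thesis using \<delta> by (simp add: field_simps)
    qed
    have "(\<lambda>k. (1 / s\<^sup>2) ^ k) \<longlonglongrightarrow> 0" using s by (intro LIMSEQ_realpow_zero) auto
    then have "eventually (\<lambda>k. (1 / s\<^sup>2) ^ k < \<eta> * \<delta> / 2) sequentially"
      using \<eta> \<delta> by (intro order_tendstoD(2)) auto
    then obtain k where k: "(1 / s\<^sup>2) ^ k < \<eta> * \<delta> / 2" by (auto simp: eventually_sequentially)
    \<comment> \<open>The block has radius \<open>Suc k\<close>, one more than the exponent, so that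
      both n and n + 1 still get k steps of decay.\<close>
    obtain n where n: "n \<ge> Suc k + 2" "\<And>m x. n \<le> m + Suc k \<Longrightarrow> m \<le> n + Suc k \<Longrightarrow> x \<in> I \<Longrightarrow> s * (a m + a (m - 1)) \<le> \<bar>x - b m\<bar>"
      using hyp[of "Suc k"] by blast
    have "mass I n \<le> (1 / s\<^sup>2) ^ k" "mass I (Suc n) \<le> (1 / s\<^sup>2) ^ k"
      by (rule mass_decay[OF I(1) n(1) _ n(2)]; use s in simp)+
    then have "mass I n / \<delta> + mass I (Suc n) / \<delta> \<le> \<eta>" using k \<delta> by (simp add: field_simps)
    moreover have "(LINT x:?F|lborel. (P n x)\<^sup>2 + (P (Suc n) x)\<^sup>2) = (LINT x:?F|lborel. (P n x)\<^sup>2) + (LINT x:?F|lborel. (P (Suc n) x)\<^sup>2)"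
      by (intro set_integral_add(2) set_integrable_subset[OF borel_integrable_atLeastAtMost'[of "-\<rho>" \<rho>]])
           (use F I in \<open>auto intro!: continuous_intros\<close>)
    ultimately show "\<exists>n\<ge>1. (LINT x:?F|lborel. (P n x)\<^sup>2 + (P (Suc n) x)\<^sup>2) \<le> \<eta>"
      using bd[of n] bd[of "Suc n"] n(1) by (intro exI[of _ n]) auto
  qed
  have "{x\<in>I. 0 < f x} = (\<Union>k. {x\<in>I. 1 / real (Suc k) \<le> f x})"
  proof safe
    fix x assume x: "x \<in> I" "0 < f x"
    then obtain k where "inverse (real (Suc k)) < f x" using reals_Archimedean by blast
    then show "x \<in> (\<Union>k. {x\<in>I. 1 / real (Suc k) \<le> f x})" using x by (auto simp: inverse_eq_divide intro!: exI[of _ k])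
  next
    fix x k assume "1 / real (Suc k) \<le> f x"
    then show "0 < f x" by (smt (verit) divide_pos_pos of_nat_0_less_iff zero_less_Suc zero_less_one)
  qed
  then show ?thesis using lev by (auto intro!: null_sets_UN)
qed

text \<open>The sign \<sigma> treats both edges at once: \<sigma> = 1 concerns x below b - 2 a, and
  \<sigma> = -1 concerns x above b + 2 a. Infinitely many good indices suffice, because increments
  tending to 0 spread the inequality from one index to a block of any prescribed length.\<close>

lemma ac_null_beyond_edge:
  assumes ac: "ac_density \<mu> f"
    and da: "(\<lambda>n. a (Suc n) - a n) \<longlonglongrightarrow> 0" and db: "(\<lambda>n. b (Suc n) - b n) \<longlonglongrightarrow> 0"
    and \<sigma>: "\<bar>\<sigma>\<bar> = 1" and d: "d < d'" and freq: "frequently (\<lambda>n. d' < \<sigma> * b n - 2 * a n) sequentially"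
  shows "{x. \<sigma> * x \<le> d \<and> 0 < f x} \<in> null_sets lborel"
proof -
  \<comment> \<open>Since a_m + a_(m-1) \<le> 2 K, the excess of s over 1 spends at most half of the
    gap d' - d; the other half is left for the drift of the coefficients.\<close>
  define s where "s = 1 + (d' - d) / (4 * K)"
  have s: "1 < s" using d K_pos by (simp add: s_def)
  have win: "\<exists>n\<ge>M + 2. \<forall>m. n \<le> m + M \<longrightarrow> m \<le> n + M \<longrightarrow> (\<forall>x\<in>{x\<in>{-\<rho>..\<rho>}. \<sigma> * x \<le> d}. s * (a m + a (m - 1)) \<le> \<bar>x - b m\<bar>)" for M \<rho>
  proof -
    \<comment> \<open>Within distance M of n the drift costs M \<epsilon> for b_m, M \<epsilon> for
      a_m and (M + 1) \<epsilon> for a_(m-1), which is (3 M + 1) \<epsilon> in all.\<close>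
    define \<epsilon> where "\<epsilon> = (d' - d) / (2 * (3 * real M + 1))"
    have \<epsilon>: "0 < \<epsilon>" "(3 * real M + 1) * \<epsilon> = (d' - d) / 2" 
    proof -
      define t where "t = 3 * real M + 1"
      have "0 < t" by (simp add: t_def)
      then show "0 < \<epsilon>" "(3 * real M + 1) * \<epsilon> = (d' - d) / 2"
        using d unfolding \<epsilon>_def t_def[symmetric] by simp_all
    qed
    have ev: "eventually (\<lambda>n. \<bar>a (Suc n) - a n\<bar> < \<epsilon> \<and> \<bar>b (Suc n) - b n\<bar> < \<epsilon>) sequentially"
      using tendstoD[OF da \<epsilon>(1)] tendstoD[OF db \<epsilon>(1)] by eventually_elim (simp add: dist_real_def)
    then obtain N0 where N0: "\<And>n. N0 \<le> n \<Longrightarrow> \<bar>a (Suc n) - a n\<bar> \<le> \<epsilon>" "\<And>n. N0 \<le> n \<Longrightarrow> \<bar>b (Suc n) - b n\<bar> \<le> \<epsilon>"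
      unfolding eventually_sequentially by (meson less_imp_le)
    obtain n where n: "N0 + M + 2 \<le> n" "d' < \<sigma> * b n - 2 * a n"
      using freq unfolding frequently_sequentially by blast
    have slow: "\<bar>g (m + k) - g m\<bar> \<le> real k * \<epsilon>" if "\<And>n. N0 \<le> n \<Longrightarrow> \<bar>g (Suc n) - g n\<bar> \<le> \<epsilon>" "N0 \<le> m" for g :: "nat \<Rightarrow> real" and m k
    proof (induction k)
      case (Suc k)
      then show ?case using that(1)[of "m + k"] that(2) by (simp add: algebra_simps)
    qed simp
    have slow': "\<bar>g m - g n\<bar> \<le> real M * \<epsilon>" if g: "\<And>n. N0 \<le> n \<Longrightarrow> \<bar>g (Suc n) - g n\<bar> \<le> \<epsilon>" and m: "n \<le> m + M" "m \<le> n + M"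
      for g :: "nat \<Rightarrow> real" and m
    proof (cases "n \<le> m")
      case True
      have "\<bar>g (n + (m - n)) - g n\<bar> \<le> real (m - n) * \<epsilon>" by (rule slow[of g n "m - n", OF g]) (use n in auto)
      also have "\<dots> \<le> real M * \<epsilon>" using m \<epsilon> by (intro mult_right_mono) auto
      finally show ?thesis using True by simp
    next
      case False
      have "\<bar>g (m + (n - m)) - g m\<bar> \<le> real (n - m) * \<epsilon>" by (rule slow[of g m "n - m", OF g]) (use n m in auto)
      also have "\<dots> \<le> real M * \<epsilon>" using m \<epsilon> by (intro mult_right_mono) auto
      finally show ?thesis using False by (simp add: abs_minus_commute)
    qed
    show ?thesis
    proof (intro exI[of _ n] conjI allI impI ballI)
      show "M + 2 \<le> n" using n by simp
      fix m x assume m: "n \<le> m + M" "m \<le> n + M" and x: "x \<in> {x\<in>{-\<rho>..\<rho>}. \<sigma> * x \<le> d}"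
      have m2: "N0 + 2 \<le> m" using n m by simp
      have A: "\<bar>a m - a n\<bar> \<le> real M * \<epsilon>" "\<bar>b m - b n\<bar> \<le> real M * \<epsilon>" using slow' N0 m by blast+
      have A': "\<bar>a m - a (m - 1)\<bar> \<le> \<epsilon>" using N0(1)[of "m - 1"] m2 by simp
      have "\<bar>\<sigma> * b m - \<sigma> * b n\<bar> \<le> real M * \<epsilon>"
        using A(2) \<sigma> by (simp add: right_diff_distrib[symmetric] abs_mult)
      then have "d' - (3 * real M + 1) * \<epsilon> < \<sigma> * b m - (a m + a (m - 1))"
        using A A' n(2) by (simp add: algebra_simps abs_le_iff)
      then have 1: "d + (d' - d) / 2 + (a m + a (m - 1)) < \<sigma> * b m" unfolding \<epsilon>(2) by (simp add: field_simps)
      have "(d' - d) / (4 * K) * (a m + a (m - 1)) \<le> (d' - d) / (4 * K) * (2 * K)"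
      proof (rule mult_left_mono)
        have "1 \<le> m" "1 \<le> m - 1" using m2 by linarith+
        then show "a m + a (m - 1) \<le> 2 * K" using a_le[of m] a_le[of "m - 1"] by linarith
      qed (use d K_pos in simp)
      also have "\<dots> = (d' - d) / 2" using K_pos by (simp add: field_simps)
      finally have "s * (a m + a (m - 1)) \<le> (a m + a (m - 1)) + (d' - d) / 2" by (simp add: s_def algebra_simps)
      also have "\<dots> \<le> \<sigma> * b m - \<sigma> * x" using 1 x by simp
      also have "\<dots> \<le> \<bar>x - b m\<bar>"
      proof -
        have "\<bar>\<sigma> * b m - \<sigma> * x\<bar> = \<bar>x - b m\<bar>"
          using \<sigma> by (simp add: right_diff_distrib[symmetric] abs_mult abs_minus_commute)
        then show ?thesis by linarith
      qed
      finally show "s * (a m + a (m - 1)) \<le> \<bar>x - b m\<bar>" .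
    qed
  qed
  have "{x\<in>{x\<in>{-real (Suc k)..real (Suc k)}. \<sigma> * x \<le> d}. 0 < f x} \<in> null_sets lborel" for k
  proof (rule ac_null_in_gap[OF ac _ _ _ s win])
    have "{x\<in>{-real (Suc k)..real (Suc k)}. \<sigma> * x \<le> d} = {-real (Suc k)..real (Suc k)} \<inter> {x. \<sigma> * x \<le> d}" by auto
    also have "\<dots> \<in> sets borel"
      by (intro sets.Int borel_closed closed_Collect_le continuous_intros)
    finally show "{x\<in>{-real (Suc k)..real (Suc k)}. \<sigma> * x \<le> d} \<in> sets borel" .
  qed (auto simp del: of_nat_Suc)
  then have "(\<Union>k. {x\<in>{x\<in>{-real (Suc k)..real (Suc k)}. \<sigma> * x \<le> d}. 0 < f x}) \<in> null_sets lborel"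
    by (intro null_sets_UN)
  also have "(\<Union>k. {x\<in>{x\<in>{-real (Suc k)..real (Suc k)}. \<sigma> * x \<le> d}. 0 < f x}) = {x. \<sigma> * x \<le> d \<and> 0 < f x}"
  proof safe
    fix x assume x: "\<sigma> * x \<le> d" "0 < f x"
    obtain k where "\<bar>x\<bar> \<le> real k" using real_arch_simple by blast
    then show "x \<in> (\<Union>k. {x\<in>{x\<in>{-real (Suc k)..real (Suc k)}. \<sigma> * x \<le> d}. 0 < f x})"
      using x by (auto simp: abs_le_iff intro!: exI[of _ k])
  qed
  finally show ?thesis .
qed

end

subsection \<open>Approximating densities\<close>

lemma integrable_continuous_tail:
  fixes g h :: "real \<Rightarrow> real"
  assumes "continuous_on UNIV g" "integrable lborel h" "\<And>x. R \<le> \<bar>x\<bar> \<Longrightarrow> \<bar>g x\<bar> \<le> C * \<bar>h x\<bar>" "0 \<le> C"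
  shows "integrable lborel g"
proof (rule Bochner_Integration.integrable_bound)
  have "set_integrable lborel {-R..R} g"
    by (intro borel_integrable_atLeastAtMost' continuous_on_subset[OF assms(1)]) auto
  then show "integrable lborel (\<lambda>x. \<bar>indicator {-R..R} x *\<^sub>R g x\<bar> + C * \<bar>h x\<bar>)"
    using assms(2) by (auto simp: set_integrable_def)
  show "g \<in> borel_measurable lborel" using borel_measurable_continuous_onI[OF assms(1)] by simp
  show "AE x in lborel. norm (g x) \<le> norm (\<bar>indicator {-R..R} x *\<^sub>R g x\<bar> + C * \<bar>h x\<bar>)"
  proof (intro AE_I2)
    fix x
    show "norm (g x) \<le> norm (\<bar>indicator {-R..R} x *\<^sub>R g x\<bar> + C * \<bar>h x\<bar>)"
    proof (cases "R \<le> \<bar>x\<bar>")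
      case True
      then have "\<bar>g x\<bar> \<le> C * \<bar>h x\<bar>" by (rule assms(3))
      then show ?thesis by simp
    next
      case False
      then have "indicator {-R..R} x = (1::real)" by (auto simp: indicator_def)
      then show ?thesis using assms(4) by simp
    qed
  qed
qed

text \<open>The half disc weight on the real diameter, normalised to 1 at the origin.\<close>

definition cesaro :: "real \<Rightarrow> real \<Rightarrow> real" where
  "cesaro R x = indicator {-R..R} x * (1 - x\<^sup>2 / R\<^sup>2)"

lemma cesaro_bounds: "0 < R \<Longrightarrow> 0 \<le> cesaro R x" "cesaro R x \<le> 1"
proof -
  assume "0 < R"
  then show "0 \<le> cesaro R x"
    using abs_le_square_iff[of x R] by (auto simp: cesaro_def indicator_def abs_le_iff)
qed (auto simp: cesaro_def indicator_def)

lemma cesaro_tendsto: "(\<lambda>k. cesaro (real (Suc k)) x) \<longlonglongrightarrow> 1"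
proof -
  have "(\<lambda>k. x\<^sup>2 * (1 / real (Suc k)) ^ 2) \<longlonglongrightarrow> x\<^sup>2 * 0 ^ 2"
    by (intro tendsto_intros LIMSEQ_Suc lim_const_over_n)
  then have "(\<lambda>k. 1 - x\<^sup>2 / (real (Suc k))\<^sup>2) \<longlonglongrightarrow> 1 - 0"
    by (intro tendsto_diff tendsto_const) (simp add: power_divide)
  moreover obtain k0 where k0: "\<bar>x\<bar> \<le> real k0" using real_arch_simple by blast
  have "eventually (\<lambda>k. 1 - x\<^sup>2 / (real (Suc k))\<^sup>2 = cesaro (real (Suc k)) x) sequentially"
    using eventually_ge_at_top[of k0]
  proof eventually_elim
    case (elim k)
    then have "x \<in> {- real (Suc k)..real (Suc k)}" using k0 by (auto simp: abs_le_iff)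
    then show ?case by (simp add: cesaro_def del: of_nat_Suc)
  qed
  ultimately show ?thesis by (simp add: tendsto_cong)
qed

lemma borel_measurable_cesaro [measurable]: "cesaro R \<in> borel_measurable borel"
  unfolding cesaro_def by measurable

lemma cesaro_integral:
  fixes g :: "real \<Rightarrow> real"
  assumes g: "continuous_on UNIV g" and R: "0 < R"
  shows "integrable lborel (\<lambda>x. cesaro R x * g x)"
    and "(\<integral>x. cesaro R x * g x \<partial>lborel) = integral {-R..R} (\<lambda>x. (R\<^sup>2 - x\<^sup>2) * g x) / R\<^sup>2"
proof -
  have i: "set_integrable lborel {-R..R} (\<lambda>x. (R\<^sup>2 - x\<^sup>2) * g x)"
    by (intro borel_integrable_atLeastAtMost' continuous_intros continuous_on_subset[OF g]) auto
  have e: "cesaro R x * g x = (indicator {-R..R} x *\<^sub>R ((R\<^sup>2 - x\<^sup>2) * g x)) / R\<^sup>2" for x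
    using R by (simp add: cesaro_def field_simps)
  show "integrable lborel (\<lambda>x. cesaro R x * g x)"
    unfolding e using i by (simp add: set_integrable_def)
  show "(\<integral>x. cesaro R x * g x \<partial>lborel) = integral {-R..R} (\<lambda>x. (R\<^sup>2 - x\<^sup>2) * g x) / R\<^sup>2"
    unfolding e using set_borel_integral_eq_integral(2)[OF i] by (simp add: set_lebesgue_integral_def)
qed

text \<open>The weights tend to 1 pointwise, so Fatou's lemma turns bounds for the weighted
  integrals of a nonnegative function into integrability.\<close>

lemma integrable_of_cesaro_bound:
  fixes g :: "real \<Rightarrow> real"
  assumes g: "continuous_on UNIV g" "\<And>x. 0 \<le> g x"
    and bd: "\<And>R. R0 \<le> R \<Longrightarrow> integral {-R..R} (\<lambda>x. (R\<^sup>2 - x\<^sup>2) * g x) \<le> R\<^sup>2 * C"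
  shows "integrable lborel g" "(\<integral>x. g x \<partial>lborel) \<le> C"
proof -
  have m: "g \<in> borel_measurable borel" using g(1) by (rule borel_measurable_continuous_onI)
  obtain k0 where k0: "R0 \<le> real k0" using real_arch_simple by blast
  have le: "(\<integral>\<^sup>+x. ennreal (cesaro (real (Suc k)) x * g x) \<partial>lborel) \<le> ennreal C" if "k0 \<le> k" for k
  proof -
    let ?R = "real (Suc k)"
    have "(\<integral>\<^sup>+x. ennreal (cesaro ?R x * g x) \<partial>lborel) = ennreal (\<integral>x. cesaro ?R x * g x \<partial>lborel)"
      using cesaro_integral(1)[OF g(1), of ?R] cesaro_bounds(1)[of ?R] g(2) by (intro nn_integral_eq_integral) auto
    also have "(\<integral>x. cesaro ?R x * g x \<partial>lborel) \<le> C"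
    proof -
      have "integral {-?R..?R} (\<lambda>x. (?R\<^sup>2 - x\<^sup>2) * g x) \<le> ?R\<^sup>2 * C" by (rule bd) (use k0 that in linarith)
      then show ?thesis unfolding cesaro_integral(2)[OF g(1), of ?R, simplified]
        by (subst cesaro_integral(2)[OF g(1)]) (auto simp: pos_divide_le_eq mult.commute simp del: of_nat_Suc)
    qed
    finally show ?thesis by (auto intro: ennreal_leI)
  qed
  have "(\<integral>\<^sup>+x. ennreal (g x) \<partial>lborel) = (\<integral>\<^sup>+x. liminf (\<lambda>k. ennreal (cesaro (real (Suc k)) x * g x)) \<partial>lborel)"
  proof (rule nn_integral_cong)
    fix x
    have "(\<lambda>k. ennreal (cesaro (real (Suc k)) x * g x)) \<longlonglongrightarrow> ennreal (1 * g x)"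
      by (intro tendsto_ennrealI tendsto_mult cesaro_tendsto tendsto_const)
    then show "ennreal (g x) = liminf (\<lambda>k. ennreal (cesaro (real (Suc k)) x * g x))"
      using lim_imp_Liminf[of sequentially] by (metis mult_1 trivial_limit_sequentially)
  qed
  also have "\<dots> \<le> liminf (\<lambda>k. \<integral>\<^sup>+x. ennreal (cesaro (real (Suc k)) x * g x) \<partial>lborel)"
    using m by (intro nn_integral_liminf) auto
  also have "\<dots> \<le> liminf (\<lambda>k. ennreal C)"
    by (rule Liminf_mono) (rule eventually_mono[OF eventually_ge_at_top le])
  also have "\<dots> = ennreal C" by (simp add: Liminf_const)
  finally have fin: "(\<integral>\<^sup>+x. ennreal (g x) \<partial>lborel) \<le> ennreal C" .
  show i: "integrable lborel g"
    using m g(2) fin by (intro integrableI_bounded) (auto simp: order.strict_trans1 ennreal_less_top)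
  have "0 \<le> C"
  proof -
    have "0 \<le> integral {-max 1 R0..max 1 R0} (\<lambda>x. ((max 1 R0)\<^sup>2 - x\<^sup>2) * g x)"
    proof (rule Henstock_Kurzweil_Integration.integral_nonneg)
      show "(\<lambda>x. ((max 1 R0)\<^sup>2 - x\<^sup>2) * g x) integrable_on {-max 1 R0..max 1 R0}"
        by (intro integrable_continuous_real continuous_intros continuous_on_subset[OF g(1)]) auto
      fix x assume "x \<in> {-max 1 R0..max 1 R0}"
      then have "\<bar>x\<bar> \<le> \<bar>max 1 R0\<bar>" by (simp add: abs_le_iff)
      then have "x\<^sup>2 \<le> (max 1 R0)\<^sup>2" by (simp only: abs_le_square_iff)
      then show "0 \<le> ((max 1 R0)\<^sup>2 - x\<^sup>2) * g x" using g(2) by (intro mult_nonneg_nonneg) auto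
    qed
    then have "0 \<le> (max 1 R0)\<^sup>2 * C" using bd[of "max 1 R0"] by linarith
    moreover have "0 < (max 1 R0)\<^sup>2" by (intro zero_less_power) auto
    ultimately show ?thesis by (simp add: zero_le_mult_iff)
  qed
  then show "(\<integral>x. g x \<partial>lborel) \<le> C"
    using fin i g(2) by (subst (asm) nn_integral_eq_integral) auto
qed

text \<open>After division by R^2 the bound is C / R, while dominated convergence identifies the
  limit of the weighted integrals with the full integral.\<close>

lemma integral_zero_of_cesaro_bound:
  fixes g :: "real \<Rightarrow> real"
  assumes g: "continuous_on UNIV g" and i: "integrable lborel g"
    and bd: "\<And>R. R0 \<le> R \<Longrightarrow> \<bar>integral {-R..R} (\<lambda>x. (R\<^sup>2 - x\<^sup>2) * g x)\<bar> \<le> R * C"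
  shows "(\<integral>x. g x \<partial>lborel) = 0"
proof -
  have lim: "(\<lambda>k. \<integral>x. cesaro (real (Suc k)) x * g x \<partial>lborel) \<longlonglongrightarrow> (\<integral>x. g x \<partial>lborel)"
  proof (rule integral_dominated_convergence[where w = "\<lambda>x. \<bar>g x\<bar>"])
    show "AE x in lborel. (\<lambda>k. cesaro (real (Suc k)) x * g x) \<longlonglongrightarrow> g x"
    proof (intro AE_I2)
      fix x
      have "(\<lambda>k. cesaro (real (Suc k)) x * g x) \<longlonglongrightarrow> 1 * g x"
        by (intro tendsto_mult cesaro_tendsto tendsto_const)
      then show "(\<lambda>k. cesaro (real (Suc k)) x * g x) \<longlonglongrightarrow> g x" by simp
    qed
    show "AE x in lborel. norm (cesaro (real (Suc k)) x * g x) \<le> \<bar>g x\<bar>" for k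
      using cesaro_bounds[of "real (Suc k)"] by (intro AE_I2) (auto simp: abs_mult intro!: mult_left_le_one_le)
  qed (use i borel_measurable_integrable[OF i] in auto)
  obtain k0 where k0: "R0 \<le> real k0" using real_arch_simple by blast
  have "(\<lambda>k. \<integral>x. cesaro (real (Suc k)) x * g x \<partial>lborel) \<longlonglongrightarrow> 0"
  proof (rule Lim_null_comparison)
    show "(\<lambda>k. C / real (Suc k)) \<longlonglongrightarrow> 0" by (intro LIMSEQ_Suc lim_const_over_n)
    show "eventually (\<lambda>k. norm (\<integral>x. cesaro (real (Suc k)) x * g x \<partial>lborel) \<le> C / real (Suc k)) sequentially"
      using eventually_ge_at_top[of k0]
    proof eventually_elim
      case (elim k)
      let ?R = "real (Suc k)"
      have R: "0 < ?R" by simp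
      have "\<bar>integral {-?R..?R} (\<lambda>x. (?R\<^sup>2 - x\<^sup>2) * g x)\<bar> \<le> ?R * C" by (rule bd) (use k0 elim in linarith)
      then have "\<bar>integral {-?R..?R} (\<lambda>x. (?R\<^sup>2 - x\<^sup>2) * g x)\<bar> / ?R\<^sup>2 \<le> ?R * C / ?R\<^sup>2" by (rule divide_right_mono) simp
      also have "\<dots> = C / ?R" using R by (simp add: power2_eq_square del: of_nat_Suc)
      finally show ?case unfolding cesaro_integral(2)[OF g R] by (simp add: abs_divide del: of_nat_Suc)
    qed
  qed
  then show ?thesis using lim LIMSEQ_unique by blast
qed

section \<open>Orthogonality of the polynomials with respect to dx / |Phi_N|^2\<close>

context jacobi_coeffs
begin

lemma r_large_le:
  assumes z: "4 * K \<le> norm z" and n: "1 \<le> n"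
  shows "norm (r n z) \<le> 2 * norm z"
proof (cases "n = 1")
  case True
  then show ?thesis using norm_triangle_ineq4[of z "of_real (b 1)"] b_le[of 1] z K_pos by (simp add: r_1)
next
  case False
  then obtain k where k: "n = Suc k" "1 \<le> k" using n by (cases n) auto
  have rk: "norm z / 2 \<le> norm (r k z)" "P k z \<noteq> 0" "P (Suc k) z \<noteq> 0"
    using r_large[OF z k(2)] r_large[OF z, of "Suc k"] by auto
  have "norm (of_real ((a k)\<^sup>2) / r k z) \<le> K\<^sup>2 / (2 * K)"
    unfolding norm_divide using rk z a_le[OF k(2)] a_pos[OF k(2)] K_pos
    by (intro frac_le) (auto simp: norm_power intro!: power_mono)
  also have "\<dots> = K / 2" using K_pos by (simp add: power2_eq_square)
  finally have "norm (of_real ((a k)\<^sup>2) / r k z) \<le> K / 2" .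
  then show ?thesis unfolding k(1) r_Suc[OF k(2) rk(2,3)]
    using norm_triangle_ineq4[of "z - of_real (b (Suc k))" "of_real ((a k)\<^sup>2) / r k z"]
      norm_triangle_ineq4[of z "of_real (b (Suc k))"] b_le[of "Suc k"] z K_pos by simp
qed

text \<open>Each step up in the index gains a factor of at least |z| / (2 K), which is at least 2.
  Only one such factor is kept, since decay of one extra power of |z| is what the contour estimates
  use.\<close>

lemma P_ratio_large:
  assumes z: "4 * K \<le> norm z" and j: "1 \<le> j"
  shows "j < n \<Longrightarrow> norm (P j z) \<le> 2 * K / norm z * norm (P n (z::complex))"
proof (induction n)
  case (Suc n)
  have zp: "0 < norm z" using z K_pos by linarith
  have step: "norm (P k z) \<le> 2 * K / norm z * norm (P (Suc k) z)" if k: "1 \<le> k" for k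
  proof -
    have "of_real (a k) * P (Suc k) z = r k z * P k z"
      using r_large[OF z k] by (simp add: orth_ratio_def)
    then have "a k * norm (P (Suc k) z) = norm (r k z) * norm (P k z)"
      using a_pos[OF k] by (metis abs_of_pos norm_mult norm_of_real)
    moreover have "norm z / 2 * norm (P k z) \<le> norm (r k z) * norm (P k z)"
      using r_large[OF z k] by (intro mult_right_mono) auto
    moreover have "a k * norm (P (Suc k) z) \<le> K * norm (P (Suc k) z)"
      using a_le[OF k] by (intro mult_right_mono) auto
    ultimately have "norm z / 2 * norm (P k z) \<le> K * norm (P (Suc k) z)" by linarith
    then show ?thesis using zp by (simp add: field_simps)
  qed
  show ?case
  proof (cases "j = n")
    case True
    then show ?thesis using step[of j] j by blast
  next
    case False
    then have "norm (P j z) \<le> 2 * K / norm z * norm (P n z)" using Suc by simp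
    also have "\<dots> \<le> 2 * K / norm z * norm (P (Suc n) z)"
    proof (rule mult_left_mono)
      have "2 * K / norm z \<le> 1" using z K_pos zp by (simp add: field_simps)
      then have "2 * K / norm z * norm (P (Suc n) z) \<le> norm (P (Suc n) z)" by (intro mult_left_le_one_le) (use K_pos in auto)
      then show "norm (P n z) \<le> norm (P (Suc n) z)" using step[of n] Suc(2) j by linarith
    qed (use K_pos in simp)
    finally show ?thesis .
  qed
qed simp

text \<open>Since \<open>Phi N\<close> = P_N (r_N + i) and r_N has positive imaginary part in the
  open upper half plane, the summand i bounds the second factor below by 1. On the real line it
  makes the squared modulus a sum of two squares without common zero.\<close>

definition Phi :: "nat \<Rightarrow> complex \<Rightarrow> complex" where
  "Phi N z = of_real (a N) * P (Suc N) z + \<i> * P N z"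

lemma Phi_eq: "P N z \<noteq> 0 \<Longrightarrow> Phi N z = P N z * (r N z + \<i>)"
  by (simp add: Phi_def orth_ratio_def field_simps)

definition Phi_sq :: "nat \<Rightarrow> real \<Rightarrow> real" where
  "Phi_sq N x = (a N * P (Suc N) x)\<^sup>2 + (P N x)\<^sup>2"

lemma Phi_of_real: "Phi N (of_real x) = Complex (a N * P (Suc N) x) (P N x)"
  by (simp add: Phi_def orth_poly_of_real complex_eq_iff del: orth_poly.simps)

lemma norm_Phi_of_real: "(norm (Phi N (of_real x)))\<^sup>2 = Phi_sq N x"
  by (simp add: Phi_of_real cmod_power2 Phi_sq_def)

lemma Phi_sq_pos: "1 \<le> N \<Longrightarrow> 0 < Phi_sq N x"
  using P_not_both_zero[of N x] a_pos[of N] by (auto simp: Phi_sq_def sum_power2_gt_zero_iff)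

lemma Phi_nz:
  assumes "0 \<le> Im z" "1 \<le> N" shows "Phi N z \<noteq> 0"
proof (cases "Im z = 0")
  case True
  then have "z = of_real (Re z)" by (simp add: complex_eq_iff)
  then show ?thesis using norm_Phi_of_real[of N "Re z"] Phi_sq_pos[OF assms(2), of "Re z"] by auto
next
  case False
  then have z: "0 < Im z" using assms by simp
  then have "Im (r N z + \<i>) > 0" using r_im[OF z assms(2)] by simp
  then have "r N z + \<i> \<noteq> 0" by (metis less_irrefl zero_complex.sel(2))
  then show ?thesis using Phi_eq P_nz[OF z assms(2)] by simp
qed

lemma continuous_on_Phi [continuous_intros]: "continuous_on S f \<Longrightarrow> continuous_on S (\<lambda>z. Phi N (f z))"
  unfolding Phi_def by (intro continuous_intros)

lemma holomorphic_on_Phi [holomorphic_intros]: "Phi N holomorphic_on S"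
  unfolding Phi_def[abs_def] by (intro holomorphic_intros)

lemma continuous_on_Phi_sq [continuous_intros]: "continuous_on S (Phi_sq N)"
  unfolding Phi_sq_def[abs_def] by (intro continuous_intros)

context
  fixes N :: nat
  assumes N: "1 \<le> N"
begin

text \<open>The factor r_N + i accounts for one power of 1 / |z|, and j < N supplies a second one
  through \<open>P_ratio_large\<close>. The threshold 4 K + 4 leaves |r_N| - 1 \<ge> |z| /
  4.\<close>

lemma quotient_large:
  assumes z: "4 * K + 4 \<le> norm z" "0 \<le> Im z" and j: "1 \<le> j" "j \<le> N"
  shows "norm (P j z / Phi N z) \<le> 4 / norm z" "j < N \<Longrightarrow> norm (P j z / Phi N z) \<le> 8 * K / (norm z)\<^sup>2"
proof -
  have z4: "4 * K \<le> norm z" using z by simp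
  have zp: "0 < norm z" using z K_pos by linarith
  have PN: "P N z \<noteq> 0" "norm z / 2 \<le> norm (r N z)" using r_large[OF z4 N] by auto
  have "norm z / 4 \<le> norm (r N z) - 1" using PN(2) z K_pos by simp
  also have "\<dots> \<le> norm (r N z + \<i>)" using norm_diff_ineq[of "r N z" \<i>] by simp
  finally have rz: "norm z / 4 \<le> norm (r N z + \<i>)" .
  have g: "norm (P j z / Phi N z) \<le> t * 4 / norm z" if t: "norm (P j z) \<le> t * norm (P N z)" for t
  proof -
    have t0: "0 \<le> t" using t PN(1) by (metis norm_ge_zero order_trans zero_le_mult_iff zero_less_norm_iff not_le)
    have "norm (P j z / Phi N z) = norm (P j z) / (norm (P N z) * norm (r N z + \<i>))"
      by (simp add: Phi_eq[OF PN(1)] norm_divide norm_mult)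
    also have "\<dots> \<le> (t * norm (P N z)) / (norm (P N z) * (norm z / 4))"
      using t rz PN(1) zp t0 by (intro frac_le mult_left_mono mult_pos_pos) auto
    also have "\<dots> = t * 4 / norm z" using PN(1) by simp
    finally show ?thesis .
  qed
  show lt: "norm (P j z / Phi N z) \<le> 8 * K / (norm z)\<^sup>2" if "j < N"
    using g[OF P_ratio_large[OF z4 j(1) that]] by (simp add: power2_eq_square)
  show "norm (P j z / Phi N z) \<le> 4 / norm z"
  proof (cases "j = N")
    case True
    then show ?thesis using g[of 1] by simp
  next
    case False
    have "2 * K / norm z \<le> 1" using z4 K_pos zp by (simp add: field_simps)
    then have "2 * K / norm z * norm (P N z) \<le> 1 * norm (P N z)" by (intro mult_right_mono) auto
    then show ?thesis using g[of 1] P_ratio_large[OF z4 j(1), of N] False j by simp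
  qed
qed

lemma quotient_contour:
  assumes j: "1 \<le> j" and R: "0 < R"
    and bd: "\<And>z. norm z = R \<Longrightarrow> 0 \<le> Im z \<Longrightarrow> norm (P j z / Phi N z) \<le> B"
  shows "\<bar>integral {-R..R} (\<lambda>x. (R\<^sup>2 - x\<^sup>2) * Re (P j (of_real x) / Phi N (of_real x)))\<bar> \<le> 2 * pi * R\<^sup>2 * (R * B)"
    "\<bar>integral {-R..R} (\<lambda>x. (R\<^sup>2 - x\<^sup>2) * Im (P j (of_real x) / Phi N (of_real x)))\<bar> \<le> 2 * pi * R\<^sup>2 * (R * B)"
proof -
  let ?G = "\<lambda>z. P j z / Phi N z"
  have c: "continuous_on (upper_half_disc R) ?G"
    using N by (intro continuous_intros) (auto simp: upper_half_disc_def Phi_nz)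
  have h: "?G holomorphic_on {z. 0 < Im z} \<inter> ball 0 R"
    using N by (intro holomorphic_intros) (auto simp: Phi_nz)
  have b: "Im z * norm (?G z) \<le> R * B" if z: "norm z = R" "0 \<le> Im z" for z
    using abs_Im_le_cmod[of z] z bd[OF z] R by (intro mult_mono) auto
  note hd = half_disc_mean_bound[OF R c h b]
  have split: "Re (of_real s * v) = s * Re v" "Im (of_real s * v) = s * Im v" for s v by simp_all
  let ?I = "integral {-R..R} (\<lambda>x. of_real (R\<^sup>2 - x\<^sup>2) * ?G (of_real x))"
  have "integral {-R..R} (\<lambda>x. (R\<^sup>2 - x\<^sup>2) * Re (?G (of_real x))) = Re ?I"
    using has_integral_Re[OF hd(1)] unfolding split by (rule integral_unique)
  then show "\<bar>integral {-R..R} (\<lambda>x. (R\<^sup>2 - x\<^sup>2) * Re (?G (of_real x)))\<bar> \<le> 2 * pi * R\<^sup>2 * (R * B)"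
    using abs_Re_le_cmod[of ?I] hd(2) by simp
  have "integral {-R..R} (\<lambda>x. (R\<^sup>2 - x\<^sup>2) * Im (?G (of_real x))) = Im ?I"
    using has_integral_Im[OF hd(1)] unfolding split by (rule integral_unique)
  then show "\<bar>integral {-R..R} (\<lambda>x. (R\<^sup>2 - x\<^sup>2) * Im (?G (of_real x)))\<bar> \<le> 2 * pi * R\<^sup>2 * (R * B)"
    using abs_Im_le_cmod[of ?I] hd(2) by simp
qed

lemma quotient_Re_Im:
  "Re (P j (of_real x) / Phi N (of_real x)) = a N * P (Suc N) x * P j x / Phi_sq N x"
  "Im (P j (of_real x) / Phi N (of_real x)) = - (P N x * P j x / Phi_sq N x)"
  by (simp_all add: Phi_of_real orth_poly_of_real Re_divide Im_divide Phi_sq_def del: orth_poly.simps)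

lemma continuous_div_Phi_sq: "continuous_on S g \<Longrightarrow> continuous_on S (\<lambda>x. g x / Phi_sq N x)"
  using Phi_sq_pos[OF N] by (intro continuous_intros) (auto simp: less_imp_neq[symmetric])

text \<open>The common squared norm of all P_j with j from 1 to N. The bound 8 pi is what the half
  disc estimate yields from |P_N / \<open>Phi N\<close>| \<le> 4 / |z| on large arcs.\<close>

definition gram_norm :: real where "gram_norm = (\<integral>x. (P N x)\<^sup>2 / Phi_sq N x \<partial>lborel)"

lemma gram_norm_bounds: "integrable lborel (\<lambda>x. (P N x)\<^sup>2 / Phi_sq N x)" "gram_norm \<le> 8 * pi"
proof -
  have "integral {-R..R} (\<lambda>x. (R\<^sup>2 - x\<^sup>2) * ((P N x)\<^sup>2 / Phi_sq N x)) \<le> R\<^sup>2 * (8 * pi)" if R: "4 * K + 4 \<le> R" for R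
  proof -
    have Rp: "0 < R" using R K_pos by linarith
    have "\<bar>integral {-R..R} (\<lambda>x. (R\<^sup>2 - x\<^sup>2) * Im (P N (of_real x) / Phi N (of_real x)))\<bar> \<le> 2 * pi * R\<^sup>2 * (R * (4 / R))"
      by (rule quotient_contour(2)[OF N Rp]) (use quotient_large(1) R N in auto)
    also have "(\<lambda>x. (R\<^sup>2 - x\<^sup>2) * Im (P N (of_real x) / Phi N (of_real x))) = (\<lambda>x. - ((R\<^sup>2 - x\<^sup>2) * ((P N x)\<^sup>2 / Phi_sq N x)))"
      by (simp add: quotient_Re_Im fun_eq_iff power2_eq_square)
    finally show ?thesis using Rp by (simp add: mult_ac)
  qed
  moreover have "continuous_on UNIV (\<lambda>x. (P N x)\<^sup>2 / Phi_sq N x)"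
    by (intro continuous_div_Phi_sq continuous_intros)
  moreover have "0 \<le> (P N x)\<^sup>2 / Phi_sq N x" for x using Phi_sq_pos[OF N, of x] by simp
  ultimately show "integrable lborel (\<lambda>x. (P N x)\<^sup>2 / Phi_sq N x)" "gram_norm \<le> 8 * pi"
    unfolding gram_norm_def using integrable_of_cesaro_bound by blast+
qed

lemma P_le_PN: "4 * K \<le> \<bar>x\<bar> \<Longrightarrow> 1 \<le> j \<Longrightarrow> j \<le> N \<Longrightarrow> \<bar>P j x\<bar> \<le> \<bar>P N x\<bar>"
proof -
  assume x: "4 * K \<le> \<bar>x\<bar>" and j: "1 \<le> j" "j \<le> N"
  show "\<bar>P j x\<bar> \<le> \<bar>P N x\<bar>"
  proof (cases "j = N")
    case False
    have "\<bar>P j x\<bar> \<le> 2 * K / \<bar>x\<bar> * \<bar>P N x\<bar>"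
      using P_ratio_large[of "of_real x" j N] x j False by (simp add: orth_poly_of_real)
    also have "\<dots> \<le> 1 * \<bar>P N x\<bar>"
      using x K_pos by (intro mult_right_mono) (auto simp: field_simps)
    finally show ?thesis by simp
  qed simp
qed

lemma integrable_PP_Phi:
  assumes "i \<le> N" "j \<le> N"
  shows "integrable lborel (\<lambda>x. P i x * P j x / Phi_sq N x)"
proof (cases "i = 0 \<or> j = 0")
  case True
  then show ?thesis by auto
next
  case False
  show ?thesis
  proof (rule integrable_continuous_tail[OF _ gram_norm_bounds(1), of _ "4 * K" 1])
    show "continuous_on UNIV (\<lambda>x. P i x * P j x / Phi_sq N x)" by (intro continuous_div_Phi_sq continuous_intros)
    fix x :: real assume x: "4 * K \<le> \<bar>x\<bar>"
    have "\<bar>P i x\<bar> * \<bar>P j x\<bar> \<le> \<bar>P N x\<bar> * \<bar>P N x\<bar>"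
      using P_le_PN[OF x] assms False by (intro mult_mono) auto
    then show "\<bar>P i x * P j x / Phi_sq N x\<bar> \<le> 1 * \<bar>(P N x)\<^sup>2 / Phi_sq N x\<bar>"
      using Phi_sq_pos[OF N, of x] by (simp add: abs_mult power2_eq_square divide_right_mono)
  qed simp
qed

text \<open>At infinity \<open>P (Suc N)\<close> costs a factor |x| relative to \<open>P N\<close>,
  and j < N gains one back; the product is again dominated by the square of
  \<open>P N\<close>.\<close>

lemma integrable_PP_Phi_Suc:
  assumes "1 \<le> j" "j < N"
  shows "integrable lborel (\<lambda>x. P (Suc N) x * P j x / Phi_sq N x)"
proof (rule integrable_continuous_tail[OF _ gram_norm_bounds(1), of _ "4 * K" "4 * K / a N"])
  show "continuous_on UNIV (\<lambda>x. P (Suc N) x * P j x / Phi_sq N x)" by (intro continuous_div_Phi_sq continuous_intros)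
  show "0 \<le> 4 * K / a N" using K_pos a_pos[OF N] by simp
  fix x :: real assume x: "4 * K \<le> \<bar>x\<bar>"
  have xp: "0 < \<bar>x\<bar>" using x K_pos by linarith
  have h1: "\<bar>P j x\<bar> \<le> 2 * K / \<bar>x\<bar> * \<bar>P N x\<bar>"
    using P_ratio_large[of "of_real x" j N] x assms by (simp add: orth_poly_of_real)
  have h2: "a N * \<bar>P (Suc N) x\<bar> \<le> 2 * \<bar>x\<bar> * \<bar>P N x\<bar>"
  proof -
    have nz: "P N (complex_of_real x) \<noteq> 0" using r_large[of "of_real x" N] x N by simp
    have "norm (r N (of_real x)) \<le> 2 * \<bar>x\<bar>" using r_large_le[of "of_real x" N] x N by simp
    then have "norm (r N (of_real x)) * norm (P N (complex_of_real x)) \<le> 2 * \<bar>x\<bar> * norm (P N (complex_of_real x))"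
      by (rule mult_right_mono) simp
    also have "norm (r N (of_real x)) * norm (P N (complex_of_real x)) = a N * norm (P (Suc N) (complex_of_real x))"
      using nz a_pos[OF N] by (simp add: orth_ratio_def norm_mult norm_divide del: orth_poly.simps)
    finally show ?thesis unfolding orth_poly_of_real by simp
  qed
  have "(a N * \<bar>P (Suc N) x\<bar>) * \<bar>P j x\<bar> \<le> (2 * \<bar>x\<bar> * \<bar>P N x\<bar>) * (2 * K / \<bar>x\<bar> * \<bar>P N x\<bar>)"
    by (rule mult_mono[OF h2 h1]) auto
  also have "\<dots> = 4 * K * (P N x)\<^sup>2" using xp by (simp add: power2_eq_square abs_mult[symmetric])
  finally have "\<bar>P (Suc N) x\<bar> * \<bar>P j x\<bar> \<le> 4 * K / a N * (P N x)\<^sup>2"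
    using a_pos[OF N] by (simp add: field_simps)
  then have "\<bar>P (Suc N) x\<bar> * \<bar>P j x\<bar> / Phi_sq N x \<le> 4 * K / a N * (P N x)\<^sup>2 / Phi_sq N x"
    using Phi_sq_pos[OF N, of x] by (intro divide_right_mono) auto
  then show "\<bar>P (Suc N) x * P j x / Phi_sq N x\<bar> \<le> 4 * K / a N * \<bar>(P N x)\<^sup>2 / Phi_sq N x\<bar>"
    using Phi_sq_pos[OF N, of x] by (simp add: abs_mult del: orth_poly.simps)
qed

definition gram :: "nat \<Rightarrow> nat \<Rightarrow> real" where
  "gram i j = (\<integral>x. P i x * P j x / Phi_sq N x \<partial>lborel)"

text \<open>On the real line \<open>P\<^sub>N / \<bar>\<Phi>\<^sub>N\<bar>\<^sup>2\<close> and \<open>a\<^sub>N P\<^sub>N\<^sub>+\<^sub>1 / \<bar>\<Phi>\<^sub>N\<bar>\<^sup>2\<close> are the negative imaginary part and the real part of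
  \<open>1 / \<Phi>\<^sub>N\<close>, which is holomorphic in the upper half plane.\<close>

lemma gram_top:
  assumes "1 \<le> j" "j < N" shows "gram N j = 0" "gram (Suc N) j = 0"
proof -
  have b: "norm (P j z / Phi N z) \<le> 8 * K / R\<^sup>2" if "4 * K + 4 \<le> R" "norm z = R" "0 \<le> Im z" for z R
    using quotient_large(2)[of z j] that assms by simp
  have Rp: "0 < R" if "4 * K + 4 \<le> R" for R using that K_pos by linarith
  have e: "2 * pi * R\<^sup>2 * (R * (8 * K / R\<^sup>2)) = R * (16 * pi * K)" if "4 * K + 4 \<le> R" for R
    using Rp[OF that] by simp
  have "(\<integral>x. - (P N x * P j x / Phi_sq N x) \<partial>lborel) = 0"
  proof (rule integral_zero_of_cesaro_bound)
    show "continuous_on UNIV (\<lambda>x. - (P N x * P j x / Phi_sq N x))"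
      by (intro continuous_on_minus continuous_div_Phi_sq continuous_intros)
    show "integrable lborel (\<lambda>x. - (P N x * P j x / Phi_sq N x))"
      using integrable_PP_Phi[of N j] assms by (intro integrable_minus) auto
    fix R assume R: "4 * K + 4 \<le> R"
    from quotient_contour(2)[OF assms(1) Rp[OF R] b[OF R]]
    show "\<bar>integral {-R..R} (\<lambda>x. (R\<^sup>2 - x\<^sup>2) * - (P N x * P j x / Phi_sq N x))\<bar> \<le> R * (16 * pi * K)"
      unfolding quotient_Re_Im e[OF R] .
  qed
  then show "gram N j = 0" by (simp add: gram_def)
  have "(\<integral>x. a N * P (Suc N) x * P j x / Phi_sq N x \<partial>lborel) = 0"
  proof (rule integral_zero_of_cesaro_bound)
    show "continuous_on UNIV (\<lambda>x. a N * P (Suc N) x * P j x / Phi_sq N x)"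
      by (intro continuous_div_Phi_sq continuous_intros)
    show "integrable lborel (\<lambda>x. a N * P (Suc N) x * P j x / Phi_sq N x)"
      using integrable_mult_right[OF integrable_PP_Phi_Suc[OF assms], of "a N"] by (simp add: mult.assoc del: orth_poly.simps)
    fix R assume R: "4 * K + 4 \<le> R"
    from quotient_contour(1)[OF assms(1) Rp[OF R] b[OF R]]
    show "\<bar>integral {-R..R} (\<lambda>x. (R\<^sup>2 - x\<^sup>2) * (a N * P (Suc N) x * P j x / Phi_sq N x))\<bar> \<le> R * (16 * pi * K)"
      unfolding quotient_Re_Im e[OF R] .
  qed
  moreover have "a N * P (Suc N) x * P j x / Phi_sq N x = a N * (P (Suc N) x * P j x / Phi_sq N x)" for x by simp
  ultimately have "a N * gram (Suc N) j = 0" unfolding gram_def by (simp only: integral_mult_right_zero)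
  then show "gram (Suc N) j = 0" using a_pos[OF N] by simp
qed

lemma gram_commute: "gram i j = gram j i" by (simp add: gram_def mult.commute)

lemma gram_0: "gram i 0 = 0" by (simp add: gram_def)

text \<open>Multiplication by x is symmetric for any measure, and both sides are the integral of x
  P_j P_i expanded by the recursion in one index or the other.\<close>

lemma gram_rec:
  assumes i: "1 \<le> i" "i < j" and j: "j \<le> N"
  shows "a j * gram (Suc j) i + b j * gram j i + a (j - 1) * gram (j - 1) i
       = a i * gram j (Suc i) + b i * gram j i + a (i - 1) * gram j (i - 1)"
proof -
  have int1: "integrable lborel (\<lambda>x. P (Suc j) x * P i x / Phi_sq N x)"
    using integrable_PP_Phi[of "Suc j" i] integrable_PP_Phi_Suc[of i] assms by (cases "j = N") (auto simp del: orth_poly.simps)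
  have int2: "integrable lborel (\<lambda>x. P k x * P l x / Phi_sq N x)" if "k \<le> N" "l \<le> N" for k l
    using integrable_PP_Phi that by blast
  have e: "a j * (P (Suc j) x * P i x / Phi_sq N x) + b j * (P j x * P i x / Phi_sq N x) + a (j - 1) * (P (j - 1) x * P i x / Phi_sq N x)
     = a i * (P j x * P (Suc i) x / Phi_sq N x) + b i * (P j x * P i x / Phi_sq N x) + a (i - 1) * (P j x * P (i - 1) x / Phi_sq N x)" for x
  proof -
    have "(a j * P (Suc j) x + b j * P j x + a (j - 1) * P (j - 1) x) * P i x
        = P j x * (a i * P (Suc i) x + b i * P i x + a (i - 1) * P (i - 1) x)"
    proof -
      have "a j * P (Suc j) x + b j * P j x + a (j - 1) * P (j - 1) x = x * P j x"
        "a i * P (Suc i) x + b i * P i x + a (i - 1) * P (i - 1) x = x * P i x"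
        using P_rec_real[of j x] P_rec_real[of i x] assms by (simp_all del: orth_poly.simps)
      then show ?thesis by (simp only: mult_ac)
    qed
    then have "(a j * P (Suc j) x + b j * P j x + a (j - 1) * P (j - 1) x) * P i x / Phi_sq N x
        = P j x * (a i * P (Suc i) x + b i * P i x + a (i - 1) * P (i - 1) x) / Phi_sq N x" by simp
    then show ?thesis by (simp add: distrib_left distrib_right add_divide_distrib mult_ac del: orth_poly.simps)
  qed
  define q where "q k l x = P k x * P l x / Phi_sq N x" for k l x
  have g: "gram k l = (\<integral>x. q k l x \<partial>lborel)" for k l by (simp add: gram_def q_def)
  have iq: "integrable lborel (q (Suc j) i)" "integrable lborel (q j i)" "integrable lborel (q (j - 1) i)"
    "integrable lborel (q j (Suc i))" "integrable lborel (q j (i - 1))"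
    unfolding q_def using int1 int2 assms by auto
  have "a j * gram (Suc j) i + b j * gram j i + a (j - 1) * gram (j - 1) i
     = (\<integral>x. a j * q (Suc j) i x + b j * q j i x + a (j - 1) * q (j - 1) i x \<partial>lborel)"
    unfolding g using iq by simp
  also have "\<dots> = a i * gram j (Suc i) + b i * gram j i + a (i - 1) * gram j (i - 1)"
    unfolding e[folded q_def] g using iq by simp
  finally show ?thesis .
qed

text \<open>Downward induction from the two top rows: \<open>gram_rec\<close> expresses row j - 1
  through rows j and j + 1. The factor a_(j-1) occurs on both sides for i = j - 1, so the diagonal
  value is the same in every row.\<close>

lemma gram_lower: "k < N \<Longrightarrow> (\<forall>i. 1 \<le> i \<and> i \<le> N - k \<longrightarrow> gram (N - k) i = (if i = N - k then gram_norm else 0))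
    \<and> (\<forall>i. 1 \<le> i \<and> i < N - k \<longrightarrow> gram (Suc (N - k)) i = 0)"
proof (induction k)
  case 0
  have "gram N N = gram_norm" by (simp add: gram_def gram_norm_def power2_eq_square)
  then show ?case using gram_top by auto
next
  case (Suc k)
  define j where "j = N - k"
  have j: "N - Suc k = j - 1" "Suc (j - 1) = j" "2 \<le> j" "j \<le> N" using Suc(2) by (auto simp: j_def)
  have IH1: "gram j i = (if i = j then gram_norm else 0)" if "1 \<le> i" "i \<le> j" for i
    using Suc that by (auto simp: j_def)
  have IH2: "gram (Suc j) i = 0" if "1 \<le> i" "i < j" for i using Suc that by (auto simp: j_def)
  have "gram (j - 1) i = (if i = j - 1 then gram_norm else 0)" if i: "1 \<le> i" "i \<le> j - 1" for i
  proof -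
    have ij: "i < j" using i j by simp
    have g0: "gram j (i - 1) = 0"
    proof (cases "i = 1")
      case False
      then have "1 \<le> i - 1" "i - 1 \<le> j" "i - 1 \<noteq> j" using i ij by linarith+
      then show ?thesis using IH1 by simp
    qed (simp add: gram_0)
    have "a (j - 1) * gram (j - 1) i = a i * gram j (Suc i)"
      using gram_rec[OF i(1) ij j(4)] IH2[OF i(1) ij] IH1[of i] i(1) ij g0 by simp
    also have "\<dots> = a (j - 1) * (if i = j - 1 then gram_norm else 0)"
      using IH1[of "Suc i"] ij j by auto
    finally have "a (j - 1) * gram (j - 1) i = a (j - 1) * (if i = j - 1 then gram_norm else 0)" .
    moreover have "a (j - 1) \<noteq> 0" using a_pos[of "j - 1"] i by simp
    ultimately show ?thesis by (simp only: mult_cancel_left) simp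
  qed
  moreover have "gram j i = 0" if "1 \<le> i" "i < j - 1" for i using IH1[of i] that by simp
  ultimately show ?case unfolding j by auto
qed

lemma gram_eq:
  assumes "1 \<le> i" "i \<le> N" "1 \<le> j" "j \<le> N"
  shows "gram i j = (if i = j then gram_norm else 0)"
proof -
  have *: "gram i j = (if i = j then gram_norm else 0)" if "1 \<le> j" "j \<le> i" "i \<le> N" for i j
    using gram_lower[of "N - i"] that by auto
  show ?thesis using *[of i j] *[of j i] assms gram_commute[of i j] by (cases "j \<le> i") auto
qed

text \<open>The Gram matrix is \<open>gram_norm\<close> times the identity, so sums of squared
  coefficients reappear. They are also the integrals of these squares against the spectral
  measure.\<close>

lemma quadrature:
  assumes "n \<le> N"
  shows "integrable lborel (\<lambda>x. (\<Sum>j=1..n. c j * P j x)\<^sup>2 / Phi_sq N x)"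
    "(\<integral>x. (\<Sum>j=1..n. c j * P j x)\<^sup>2 / Phi_sq N x \<partial>lborel) \<le> 8 * pi * (\<Sum>j=1..n. (c j)\<^sup>2)"
proof -
  define q where "q k l x = P k x * P l x / Phi_sq N x" for k l x
  have g: "gram k l = (\<integral>x. q k l x \<partial>lborel)" for k l by (simp add: gram_def q_def)
  have e: "(\<Sum>j=1..n. c j * P j x)\<^sup>2 / Phi_sq N x = (\<Sum>i=1..n. \<Sum>j=1..n. c i * c j * q i j x)" for x
    by (simp add: q_def power2_eq_square sum_product sum_divide_distrib mult_ac)
  have i: "integrable lborel (\<lambda>x. c i * c j * q i j x)" if "i \<in> {1..n}" "j \<in> {1..n}" for i j
    unfolding q_def using integrable_PP_Phi[of i j] that assms by (intro integrable_mult_right) auto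
  show "integrable lborel (\<lambda>x. (\<Sum>j=1..n. c j * P j x)\<^sup>2 / Phi_sq N x)"
    unfolding e by (intro Bochner_Integration.integrable_sum i)
  have "(\<integral>x. (\<Sum>j=1..n. c j * P j x)\<^sup>2 / Phi_sq N x \<partial>lborel)
      = (\<Sum>i=1..n. \<integral>x. (\<Sum>j=1..n. c i * c j * q i j x) \<partial>lborel)"
    unfolding e by (intro Bochner_Integration.integral_sum Bochner_Integration.integrable_sum i)
  also have "\<dots> = (\<Sum>i=1..n. \<Sum>j=1..n. \<integral>x. c i * c j * q i j x \<partial>lborel)"
    by (intro sum.cong refl Bochner_Integration.integral_sum i)
  also have "\<dots> = (\<Sum>i=1..n. \<Sum>j=1..n. c i * c j * gram i j)" by (simp add: g)
  also have "\<dots> = (\<Sum>i=1..n. \<Sum>j=1..n. if j = i then c i * c i * gram_norm else 0)"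
    using assms by (intro sum.cong refl) (auto simp: gram_eq)
  also have "\<dots> = gram_norm * (\<Sum>j=1..n. (c j)\<^sup>2)" by (simp add: power2_eq_square sum_distrib_left mult_ac)
  also have "\<dots> \<le> 8 * pi * (\<Sum>j=1..n. (c j)\<^sup>2)"
    using gram_norm_bounds(2) by (intro mult_right_mono sum_nonneg) auto
  finally show "(\<integral>x. (\<Sum>j=1..n. c j * P j x)\<^sup>2 / Phi_sq N x \<partial>lborel) \<le> 8 * pi * (\<Sum>j=1..n. (c j)\<^sup>2)" .
qed

end

end

subsection \<open>Perturbed recursions\<close>

lemma norm_Ln_minus_linear:
  fixes u :: complex
  assumes "norm u \<le> 1/2"
  shows "norm (Ln (1 + u) - u) \<le> 2 * (norm u)\<^sup>2"
proof -
  have "norm (Ln (1 + u) - u) \<le> norm u ^ 2 / (1 - norm u)"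
    using assms by (intro Ln_approx_linear) auto
  also have "\<dots> \<le> norm u ^ 2 / (1/2)" using assms by (intro divide_left_mono) auto
  finally show ?thesis by simp
qed

lemma sum_by_parts:
  fixes h k :: "nat \<Rightarrow> 'a::comm_ring"
  shows "(\<Sum>n<N. (h (Suc n) - h n) * k n) = h N * k N - h 0 * k 0 - (\<Sum>n<N. h (Suc n) * (k (Suc n) - k n))"
  by (induction N) (auto simp: algebra_simps)

lemma norm_quotient_diff_le:
  fixes X X' U U' :: complex
  assumes "u > 0" "u' > 0" "norm U \<ge> u" "norm U' \<ge> u'" "norm X' \<le> m"
  shows "norm (X / U - X' / U') \<le> norm (X - X') / u + m * norm (U' - U) / (u * u')"
proof -
  have nz: "U \<noteq> 0" "U' \<noteq> 0" using assms by auto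
  then have "X / U - X' / U' = (X - X') / U + X' * (U' - U) / (U * U')" by (simp add: field_simps)
  also have "norm \<dots> \<le> norm ((X - X') / U) + norm (X' * (U' - U) / (U * U'))" by (rule norm_triangle_ineq)
  also have "\<dots> \<le> norm (X - X') / u + m * norm (U' - U) / (u * u')"
    unfolding norm_divide norm_mult using assms order_trans[OF norm_ge_zero assms(5)]
    by (intro add_mono frac_le mult_mono mult_pos_pos) auto
  finally show ?thesis .
qed

text \<open>The recursion for ratios of consecutive solution values, with a slowly varying attracting fixed point
  \<open>lam n\<close> of multiplier \<open>(zet n)\<^sup>2\<close>. The coordinate \<open>g\<close> below sends \<open>lam n\<close> to \<open>0\<close> and \<open>zet n\<close> to
  \<open>\<infinity>\<close>; it contracts by \<open>1 - q\<close> in each step up to an error \<open>O(D n)\<close>. In \<open>Ln (F n)\<close> the terms of first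
  order in \<open>D n\<close> telescope, and the remaining ones are summable because \<open>D\<close> and \<open>g\<close> are square summable.\<close>

locale perturbed_recursion =
  fixes lam zet tau :: "nat \<Rightarrow> complex" and gam D :: "nat \<Rightarrow> real" and q c C S :: real
  assumes lam_zet: "lam n * zet n = 1"
    and rec: "tau (Suc n) = lam (Suc n) + zet (Suc n) - of_real (gam (Suc n) / gam n) / tau n"
    and tau_pos: "0 < Im (tau n)"
    and zet_im: "Im (zet n) \<le> - c"
    and lam_im: "0 \<le> Im (lam n)"
    and lam_le: "norm (lam n) \<le> C"
    and zet_le: "(norm (zet n))\<^sup>2 \<le> 1 - q"
    and dzet: "norm (zet (Suc n) - zet n) \<le> D n"
    and dlam: "norm (lam (Suc n) - lam n) \<le> D n"
    and gam: "\<bar>gam n - 1\<bar> \<le> D n" "\<bar>gam (Suc n) - 1\<bar> \<le> D n"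
    and D_le: "D n \<le> c / (16 * C)"
    and D_sum: "(\<Sum>n<N. (D n)\<^sup>2) \<le> S"
    and c: "0 < c" "c \<le> 1" and C: "1 \<le> C" and q: "0 < q" "q \<le> 1"
begin

definition bet :: "nat \<Rightarrow> real" where "bet n = gam (Suc n) / gam n"
definition g :: "nat \<Rightarrow> complex" where "g n = (tau n - lam n) / (tau n - zet n)"
definition F :: "nat \<Rightarrow> complex" where
  "F n = (tau n - of_real (bet n) * zet (Suc n)) / (tau n - zet n)"
text \<open>The value of 1 - \<open>F n\<close> when \<open>tau n\<close> sits at the fixed point
  \<open>lam n\<close>. It depends on the coefficients only, not on the solution, and is the part
  that can be summed by telescoping.\<close>

definition x :: "nat \<Rightarrow> complex" where
  "x n = (of_real (bet n) * zet (Suc n) - zet n) / (lam n - zet n)"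

lemma D_nonneg: "0 \<le> D n" using dzet[of n] norm_ge_zero order_trans by blast

text \<open>The bound c / (16 C) has three uses: 1/16 keeps \<open>gam\<close> and
  \<open>bet\<close> near 1, c/16 gives |\<open>F n\<close> - 1| \<le> 1/2, and the last form makes
  the relative increment of \<open>v\<close> small enough for the logarithm estimate.\<close>

lemma D_small: "D n \<le> 1/16" "D n \<le> c/16" "2 * D n * C / c \<le> 1/2"
proof -
  have "c / (16 * C) \<le> c / 16" using c C by (intro divide_left_mono) auto
  then show "D n \<le> c/16" using D_le[of n] by linarith
  then show "D n \<le> 1/16" using c by linarith
  show "2 * D n * C / c \<le> 1/2" using D_le[of n] c C by (simp add: field_simps)
qed

lemma S_nonneg: "0 \<le> S" using D_sum[of 0] by simp

lemma gam_bounds: "15/16 \<le> gam n" "gam n \<le> 17/16"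
  using gam(1)[of n] D_small(1)[of n] by linarith+

lemma bet_bound: "\<bar>bet n - 1\<bar> \<le> 4 * D n"
proof -
  have "bet n - 1 = (gam (Suc n) - gam n) / gam n"
    using gam_bounds[of n] by (simp add: bet_def field_simps)
  also have "\<bar>\<dots>\<bar> \<le> (2 * D n) / (1/2)"
    unfolding abs_divide using gam[of n] gam_bounds[of n] by (intro frac_le) (auto simp: D_nonneg)
  finally show ?thesis by simp
qed

lemma bet_range: "3/4 \<le> bet n" "bet n \<le> 5/4"
  using bet_bound[of n] D_small(1)[of n] by linarith+

lemma zet_norm: "norm (zet n) \<le> 1"
proof -
  have "(norm (zet n))\<^sup>2 \<le> 1\<^sup>2" using zet_le[of n] q by simp
  then show ?thesis by (rule power2_le_imp_le) simp
qed

lemma tau_zet: "c \<le> norm (tau n - zet n)" "tau n \<noteq> zet n"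
proof -
  have "c \<le> Im (tau n - zet n)" using tau_pos[of n] zet_im[of n] by simp
  then show "c \<le> norm (tau n - zet n)" using abs_Im_le_cmod[of "tau n - zet n"] by linarith
  then show "tau n \<noteq> zet n" using c by auto
qed

lemma tau_bet_zet: "c/2 \<le> norm (tau n - of_real (bet n) * zet (Suc n))"
proof -
  have "bet n * Im (zet (Suc n)) \<le> bet n * (- c)"
    using zet_im bet_range[of n] by (intro mult_left_mono) auto
  moreover have "bet n * c \<ge> 3/4 * c" using bet_range[of n] c by (intro mult_right_mono) auto
  moreover have "Im (tau n - of_real (bet n) * zet (Suc n)) = Im (tau n) - bet n * Im (zet (Suc n))"
    by simp
  ultimately have "c/2 \<le> Im (tau n - of_real (bet n) * zet (Suc n))"
    using tau_pos[of n] c by linarith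
  then show ?thesis using abs_Im_le_cmod[of "tau n - of_real (bet n) * zet (Suc n)"] by linarith
qed

lemma tau_nz: "tau n \<noteq> 0" using tau_pos[of n] by auto

lemma nz: "lam n \<noteq> 0" "zet n \<noteq> 0" using lam_zet[of n] by auto

lemma lam_minus_zet: "c \<le> norm (lam n - zet n)" "norm (lam n - zet n) \<le> 2 * C" "lam n \<noteq> zet n"
proof -
  have "c \<le> Im (lam n - zet n)" using lam_im[of n] zet_im[of n] by simp
  then show "c \<le> norm (lam n - zet n)" using abs_Im_le_cmod[of "lam n - zet n"] by linarith
  then show "lam n \<noteq> zet n" using c by auto
  show "norm (lam n - zet n) \<le> 2 * C"
    using norm_triangle_ineq4[of "lam n" "zet n"] lam_le[of n] zet_norm[of n] C by linarith
qed

lemma one_minus_g: "1 - g n = (lam n - zet n) / (tau n - zet n)"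
  using tau_zet(2)[of n] by (simp add: g_def field_simps)

text \<open>Because \<open>lam\<close> and \<open>zet\<close> are reciprocal, subtracting one root
  from the recursion leaves, for instance, lam - B / tau = lam (tau - B zet) / tau. These identities
  are exact.\<close>

lemma tau_zet_step:
  "tau (Suc n) - zet (Suc n) = lam (Suc n) * (tau n - of_real (bet n) * zet (Suc n)) / tau n"
  "tau (Suc n) - lam (Suc n) = zet (Suc n) * (tau n - of_real (bet n) * lam (Suc n)) / tau n"
proof -
  define B where "B = complex_of_real (bet n)"
  have b: "lam (Suc n) * (B * zet (Suc n)) = B" "zet (Suc n) * (B * lam (Suc n)) = B"
    using lam_zet[of "Suc n"] by (simp_all add: mult.left_commute[of _ B] mult.commute[of "zet (Suc n)"])
  have r: "tau (Suc n) = lam (Suc n) + zet (Suc n) - B / tau n" using rec[of n] by (simp add: B_def bet_def)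
  show "tau (Suc n) - zet (Suc n) = lam (Suc n) * (tau n - of_real (bet n) * zet (Suc n)) / tau n"
    "tau (Suc n) - lam (Suc n) = zet (Suc n) * (tau n - of_real (bet n) * lam (Suc n)) / tau n"
    unfolding B_def[symmetric] right_diff_distrib b r using tau_nz[of n]
    by (simp_all add: diff_divide_distrib)
qed

text \<open>In a product over n the differences \<open>tau\<close> - \<open>zet\<close> telescope.
  What remains of the product of the \<open>tau n\<close> is the product of the large roots times
  the product of the corrections \<open>F n\<close>.\<close>

lemma tau_eq: "tau n = lam (Suc n) * F n * (tau n - zet n) / (tau (Suc n) - zet (Suc n))"
proof -
  have "tau n - of_real (bet n) * zet (Suc n) \<noteq> 0" "tau n - zet n \<noteq> 0"
    using tau_bet_zet[of n] tau_zet(2)[of n] c by auto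
  then show ?thesis unfolding tau_zet_step(1) F_def using nz(1)[of "Suc n"] tau_nz[of n] by simp
qed

lemma g_bound: "norm (g n) \<le> 3 * C / c"
proof -
  have "norm (1 - g n) \<le> 2 * C / c"
    unfolding one_minus_g norm_divide using lam_minus_zet[of n] tau_zet[of n] c C by (intro frac_le) auto
  then have "norm (g n) \<le> 1 + 2 * C / c"
    using norm_triangle_ineq4[of 1 "1 - g n"] by simp
  also have "1 \<le> C / c" using c C by (simp add: field_simps)
  finally show ?thesis by (simp add: add_divide_distrib[symmetric])
qed

lemma bet_zet_diff: "norm (of_real (bet n) * zet (Suc n) - zet n) \<le> 5 * D n"
proof -
  have "of_real (bet n) * zet (Suc n) - zet n = of_real (bet n - 1) * zet (Suc n) + (zet (Suc n) - zet n)"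
    by (simp add: algebra_simps)
  also have "norm \<dots> \<le> \<bar>bet n - 1\<bar> * norm (zet (Suc n)) + norm (zet (Suc n) - zet n)"
    by (metis norm_mult norm_of_real norm_triangle_ineq)
  also have "\<dots> \<le> 4 * D n * 1 + D n"
    using bet_bound[of n] zet_norm[of "Suc n"] dzet[of n] D_nonneg[of n]
    by (intro add_mono mult_mono) auto
  finally show ?thesis by simp
qed

text \<open>With frozen coefficients the coordinate would be multiplied by zet^2 exactly. The
  auxiliary y is the coordinate of \<open>tau n\<close> with respect to the next roots; y and
  \<open>g n\<close> are compared through 1 - y and 1 - \<open>g n\<close>, whose denominators are
  bounded below by c/2 and c.\<close>

lemma g_step: "norm (g (Suc n)) \<le> (1 - q) * norm (g n) + 40 * C / c\<^sup>2 * D n"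
proof -
  define B where "B = complex_of_real (bet n)"
  have Bn: "norm B = bet n" using bet_range[of n] by (simp add: B_def)
  define y where "y = (tau n - B * lam (Suc n)) / (tau n - B * zet (Suc n))"
  have nzU: "tau n - B * zet (Suc n) \<noteq> 0" using tau_bet_zet[of n] c by (auto simp: B_def)
  have gy: "g (Suc n) = zet (Suc n) ^ 2 * y"
  proof -
    have "zet (Suc n) / lam (Suc n) = zet (Suc n) ^ 2"
      using lam_zet[of "Suc n"] nz[of "Suc n"] by (simp add: field_simps power2_eq_square)
    moreover have "g (Suc n) = zet (Suc n) / lam (Suc n) * y"
      unfolding g_def tau_zet_step y_def B_def[symmetric] using nzU tau_nz[of n] nz[of "Suc n"] by simp
    ultimately show ?thesis by simp
  qed
  have y1: "1 - y = B * (lam (Suc n) - zet (Suc n)) / (tau n - B * zet (Suc n))"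
    using nzU by (simp add: y_def field_simps)
  have d1: "norm ((lam n - zet n) - B * (lam (Suc n) - zet (Suc n))) \<le> 10 * C * D n"
  proof -
    have "(lam n - zet n) - B * (lam (Suc n) - zet (Suc n)) =
        - (lam (Suc n) - lam n) + (zet (Suc n) - zet n) - of_real (bet n - 1) * (lam (Suc n) - zet (Suc n))"
      by (simp add: B_def algebra_simps)
    also have "norm \<dots> \<le> norm (lam (Suc n) - lam n) + norm (zet (Suc n) - zet n)
         + \<bar>bet n - 1\<bar> * norm (lam (Suc n) - zet (Suc n))"
      by (rule order_trans[OF norm_triangle_ineq4]) (simp add: norm_mult del: of_real_diff,
        metis norm_minus_commute norm_triangle_ineq add.commute diff_conv_add_uminus norm_minus_cancel minus_diff_eq)
    also have "\<dots> \<le> D n + D n + 4 * D n * (2 * C)"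
      using dlam[of n] dzet[of n] bet_bound[of n] lam_minus_zet(2)[of "Suc n"] D_nonneg[of n]
      by (intro add_mono mult_mono) auto
    also have "\<dots> \<le> 10 * C * D n" using mult_right_mono[OF C D_nonneg[of n]] by (simp add: algebra_simps)
    finally show ?thesis .
  qed
  have "y - g n = (1 - g n) - (1 - y)" by simp
  also have "norm \<dots> \<le> norm ((lam n - zet n) - B * (lam (Suc n) - zet (Suc n))) / c
      + (3 * C) * norm ((tau n - B * zet (Suc n)) - (tau n - zet n)) / (c * (c/2))"
    unfolding one_minus_g y1
  proof (rule norm_quotient_diff_le)
    have "norm (B * (lam (Suc n) - zet (Suc n))) \<le> 5/4 * (2 * C)"
      unfolding norm_mult Bn using bet_range[of n] lam_minus_zet(2) by (intro mult_mono) auto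
    then show "norm (B * (lam (Suc n) - zet (Suc n))) \<le> 3 * C" using C by simp
  qed (use c tau_zet tau_bet_zet[of n] in \<open>auto simp: B_def\<close>)
  also have "\<dots> \<le> 10 * C * D n / c + (3 * C) * (5 * D n) / (c * (c/2))"
    using d1 bet_zet_diff[of n] c C
    by (intro add_mono divide_right_mono mult_left_mono) (auto simp: B_def norm_minus_commute)
  also have "10 * C * D n / c \<le> 10 * C * D n / c\<^sup>2"
    using c C D_nonneg[of n] by (intro divide_left_mono) (auto simp: power2_eq_square mult_le_one)
  finally have yg: "norm (y - g n) \<le> 40 * C / c\<^sup>2 * D n" by (simp add: field_simps power2_eq_square)
  have "norm y \<le> norm (g n) + norm (y - g n)" using norm_triangle_ineq[of "g n" "y - g n"] by simp
  then have ny: "norm y \<le> norm (g n) + 40 * C / c\<^sup>2 * D n" using yg by simp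
  have "norm (g (Suc n)) = (norm (zet (Suc n)))\<^sup>2 * norm y" by (simp add: gy norm_mult norm_power)
  also have "\<dots> \<le> (1 - q) * (norm (g n) + 40 * C / c\<^sup>2 * D n)"
    using zet_le[of "Suc n"] ny q by (intro mult_mono) auto
  also have "\<dots> \<le> (1 - q) * norm (g n) + 1 * (40 * C / c\<^sup>2 * D n)"
    unfolding distrib_left using q c C D_nonneg[of n] by (intro add_mono mult_right_mono) auto
  finally show ?thesis by simp
qed

text \<open>Completing the square: for 0 < q \<le> 1, ((1 - q) G + e)^2 falls short of (1 - q) G^2 +
  e^2 / q by (1 - q) q (G - e / q)^2. The loss 1 / q is what keeps the factor 1 - q in
  front.\<close>

lemma g_sq_step: "(norm (g (Suc n)))\<^sup>2 \<le> (1 - q) * (norm (g n))\<^sup>2 + (40 * C / c\<^sup>2 * D n)\<^sup>2 / q"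
proof -
  define e where "e = 40 * C / c\<^sup>2 * D n"
  have "(norm (g (Suc n)))\<^sup>2 \<le> ((1 - q) * norm (g n) + e)\<^sup>2"
    using g_step[of n] by (intro power_mono) (auto simp: e_def)
  also have "\<dots> = (1 - q) * (norm (g n))\<^sup>2 + e\<^sup>2 / q - (1 - q) * q * (norm (g n) - e / q)\<^sup>2"
    using q by (simp add: field_simps power2_eq_square)
  also have "\<dots> \<le> (1 - q) * (norm (g n))\<^sup>2 + e\<^sup>2 / q" using q by simp
  finally show ?thesis by (simp add: e_def)
qed

definition g_const :: real where "g_const = (3 * C / c)\<^sup>2 + (40 * C / c\<^sup>2)\<^sup>2 * S"

text \<open>Summing the squared step leaves q times the sum on one side and a bound of order 1 / q
  on the other.\<close>

lemma g_sum: "(\<Sum>n<N. (norm (g n))\<^sup>2) \<le> g_const / q\<^sup>2"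
proof -
  have "q * (\<Sum>n<N. (norm (g n))\<^sup>2) + (norm (g N))\<^sup>2
      \<le> (norm (g 0))\<^sup>2 + (\<Sum>n<N. (40 * C / c\<^sup>2 * D n)\<^sup>2 / q)"
  proof (induction N)
    case (Suc N)
    then show ?case using g_sq_step[of N] by (simp add: algebra_simps)
  qed simp
  also have "(\<Sum>n<N. (40 * C / c\<^sup>2 * D n)\<^sup>2 / q) = (40 * C / c\<^sup>2)\<^sup>2 * (\<Sum>n<N. (D n)\<^sup>2) / q"
    unfolding power_mult_distrib[of "40 * C / c\<^sup>2"] by (simp only: sum_distrib_left sum_divide_distrib)
  also have "\<dots> \<le> (40 * C / c\<^sup>2)\<^sup>2 * S / q"
    using D_sum q by (intro divide_right_mono mult_left_mono) auto
  also have "(norm (g 0))\<^sup>2 \<le> (3 * C / c)\<^sup>2" using g_bound by (intro power_mono) auto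
  also have "(3 * C / c)\<^sup>2 \<le> (3 * C / c)\<^sup>2 / q"
    unfolding pos_le_divide_eq[OF q(1)] using q by (intro mult_left_le) auto
  finally have "q * (\<Sum>n<N. (norm (g n))\<^sup>2) + (norm (g N))\<^sup>2 \<le> g_const / q"
    by (simp add: g_const_def add_divide_distrib)
  then have "q * (\<Sum>n<N. (norm (g n))\<^sup>2) \<le> g_const / q"
    using zero_le_power2[of "norm (g N)"] by linarith
  then show ?thesis using q by (simp add: field_simps power2_eq_square)
qed

lemma F_eq: "F n - 1 = - ((of_real (bet n) * zet (Suc n) - zet n) / (tau n - zet n))"
  unfolding F_def using tau_zet(2)[of n] by (simp add: field_simps)

lemma F_minus_one: "F n - 1 = - x n + x n * g n"
proof -
  have "- x n + x n * g n = - x n * (1 - g n)" by (simp add: algebra_simps)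
  also have "\<dots> = F n - 1"
    unfolding one_minus_g x_def F_eq using lam_minus_zet(3)[of n] by (simp add: minus_divide_left)
  finally show ?thesis by simp
qed

lemma F_near_one: "norm (F n - 1) \<le> 5 * D n / c" "norm (F n - 1) \<le> 1/2"
proof -
  have "norm (- ((of_real (bet n) * zet (Suc n) - zet n) / (tau n - zet n))) \<le> 5 * D n / c"
    unfolding norm_divide norm_minus_cancel using bet_zet_diff[of n] tau_zet[of n] c by (intro frac_le) (auto simp: D_nonneg)
  then show F: "norm (F n - 1) \<le> 5 * D n / c" by (simp only: F_eq)
  have "5 * D n / c \<le> 1/2" using D_small(2)[of n] c by (simp add: field_simps)
  then show "norm (F n - 1) \<le> 1/2" using F by linarith
qed

lemma F_nz: "F n \<noteq> 0" using F_near_one(2)[of n] by auto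

lemma F_Re_pos: "0 < Re (F n)"
  using F_near_one(2)[of n] abs_Re_le_cmod[of "F n - 1"] by simp

lemma x_bound: "norm (x n) \<le> 5 * D n / c"
  unfolding x_def norm_divide using bet_zet_diff[of n] lam_minus_zet[of n] c
  by (intro frac_le) (auto simp: D_nonneg)

text \<open>Apart from a quadratic error the only term besides -x is x g. It is split with weight q,
  since then D^2 / q and q |g|^2 both have sums of order 1 / q; an unweighted split would lose 1 /
  q^2.\<close>

lemma Ln_F_bound:
  "norm (Ln (F n) + x n) \<le> 50 * (D n)\<^sup>2 / c\<^sup>2 + 5 / (2 * c) * ((D n)\<^sup>2 / q + q * (norm (g n))\<^sup>2)"
proof -
  have "norm (Ln (F n) - (F n - 1)) \<le> 2 * (norm (F n - 1))\<^sup>2"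
    using norm_Ln_minus_linear[OF F_near_one(2)[of n]] by simp
  also have "\<dots> \<le> 2 * (5 * D n / c)\<^sup>2" using F_near_one(1) by (intro mult_left_mono power_mono) auto
  finally have 1: "norm (Ln (F n) - (F n - 1)) \<le> 50 * (D n)\<^sup>2 / c\<^sup>2" by (simp add: power_divide power_mult_distrib)
  have "norm (x n * g n) \<le> 5 * D n / c * norm (g n)"
    unfolding norm_mult using x_bound by (intro mult_right_mono) auto
  also have "\<dots> = 5 / (2 * c) * (2 * D n * norm (g n))" by simp
  also have "\<dots> \<le> 5 / (2 * c) * ((D n)\<^sup>2 / q + q * (norm (g n))\<^sup>2)"
  proof (intro mult_left_mono)
    have "0 \<le> q * (D n / q - norm (g n))\<^sup>2" using q by simp
    also have "\<dots> = (D n)\<^sup>2 / q + q * (norm (g n))\<^sup>2 - 2 * D n * norm (g n)"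
      using q by (simp add: power2_eq_square field_simps)
    finally show "2 * D n * norm (g n) \<le> (D n)\<^sup>2 / q + q * (norm (g n))\<^sup>2" by simp
  qed (use c in auto)
  finally have 2: "norm (x n * g n) \<le> 5 / (2 * c) * ((D n)\<^sup>2 / q + q * (norm (g n))\<^sup>2)" .
  have e: "Ln (F n) + x n = (Ln (F n) - (F n - 1)) + x n * g n" unfolding F_minus_one by simp
  show ?thesis unfolding e using norm_triangle_ineq[of "Ln (F n) - (F n - 1)" "x n * g n"] 1 2 by linarith
qed

section \<open>Telescoping of the first-order terms\<close>

definition k :: "nat \<Rightarrow> complex" where "k n = 1 / (lam n - zet n)"
definition h :: "nat \<Rightarrow> complex" where "h n = of_real (gam n - 1) * zet n"
definition v :: "nat \<Rightarrow> complex" where "v n = 1 - (zet n)\<^sup>2"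

lemma k_bound: "norm (k n) \<le> 1 / c"
  unfolding k_def norm_divide using lam_minus_zet[of n] c by (auto intro!: frac_le)

lemma k_diff: "norm (k (Suc n) - k n) \<le> 2 * D n / c\<^sup>2"
proof -
  have "norm (k (Suc n) - k n) \<le> norm ((1::complex) - 1) / c + 1 * norm ((lam n - zet n) - (lam (Suc n) - zet (Suc n))) / (c * c)"
    unfolding k_def by (rule norm_quotient_diff_le) (use c lam_minus_zet in auto)
  also have "norm ((lam n - zet n) - (lam (Suc n) - zet (Suc n))) \<le> 2 * D n"
  proof -
    have e: "(lam n - zet n) - (lam (Suc n) - zet (Suc n)) = (zet (Suc n) - zet n) - (lam (Suc n) - lam n)" by simp
    show ?thesis unfolding e using norm_triangle_ineq4[of "zet (Suc n) - zet n" "lam (Suc n) - lam n"] dzet[of n] dlam[of n] by linarith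
  qed
  finally show ?thesis using c by (simp add: divide_right_mono power2_eq_square)
qed

lemma h_bound: "norm (h n) \<le> D n" "norm (h (Suc n)) \<le> D n"
  unfolding h_def norm_mult norm_of_real
  using mult_mono[OF gam(1)[of n] zet_norm[of n]] mult_mono[OF gam(2)[of n] zet_norm[of "Suc n"]] D_nonneg[of n] by auto

text \<open>Summation by parts moves the difference from \<open>h\<close> to \<open>k\<close>, and
  each term becomes a product of two quantities of size D.\<close>

lemma h_sum: "norm (\<Sum>n<N. (h (Suc n) - h n) * k n) \<le> 2 / c + 2 * S / c\<^sup>2"
proof -
  have hk: "norm (h n * k n) \<le> 1 / c" for n
  proof -
    have "norm (h n * k n) \<le> 1 * (1 / c)"
      unfolding norm_mult using h_bound(1)[of n] k_bound[of n] D_small(1)[of n] by (intro mult_mono) auto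
    then show ?thesis by simp
  qed
  have "norm (\<Sum>n<N. h (Suc n) * (k (Suc n) - k n)) \<le> (\<Sum>n<N. 2 / c\<^sup>2 * (D n)\<^sup>2)"
  proof (rule sum_norm_le)
    fix n
    have "norm (h (Suc n) * (k (Suc n) - k n)) \<le> D n * (2 * D n / c\<^sup>2)"
      unfolding norm_mult using h_bound k_diff D_nonneg by (intro mult_mono) auto
    then show "norm (h (Suc n) * (k (Suc n) - k n)) \<le> 2 / c\<^sup>2 * (D n)\<^sup>2"
      by (simp add: power2_eq_square mult_ac)
  qed
  also have "\<dots> \<le> 2 / c\<^sup>2 * S" unfolding sum_distrib_left[symmetric] using D_sum by (intro mult_left_mono) auto
  finally have 1: "norm (\<Sum>n<N. h (Suc n) * (k (Suc n) - k n)) \<le> 2 / c\<^sup>2 * S" .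
  show ?thesis unfolding sum_by_parts
    using norm_triangle_ineq4[of "h N * k N - h 0 * k 0" "\<Sum>n<N. h (Suc n) * (k (Suc n) - k n)"]
      norm_triangle_ineq4[of "h N * k N" "h 0 * k 0"] hk[of N] hk[of 0] 1 by simp
qed

lemma v_bounds: "c / C \<le> norm (v n)" "norm (v n) \<le> 2" "0 < Re (v n)"
proof -
  have "v n = zet n * (lam n - zet n)" using lam_zet[of n] by (simp add: v_def algebra_simps power2_eq_square)
  moreover have "1 / C \<le> norm (zet n)"
  proof -
    have "norm (lam n) * norm (zet n) = 1" using lam_zet[of n] by (metis norm_mult norm_one)
    then have "1 \<le> C * norm (zet n)" using mult_right_mono[OF lam_le[of n] norm_ge_zero[of "zet n"]] by simp
    then show ?thesis using C by (simp add: field_simps)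
  qed
  ultimately have "norm (v n) \<ge> 1 / C * c"
    using mult_mono[of "1 / C" "norm (zet n)" c "norm (lam n - zet n)"] lam_minus_zet(1)[of n] c C
    by (simp add: norm_mult)
  then show "c / C \<le> norm (v n)" by simp
  show "norm (v n) \<le> 2"
    using norm_triangle_ineq4[of 1 "(zet n)\<^sup>2"] zet_le[of n] q by (simp add: v_def norm_power)
  show "0 < Re (v n)"
    using abs_Re_le_cmod[of "(zet n)\<^sup>2"] zet_le[of n] q by (simp add: v_def norm_power)
qed

lemma Ln_v_bound: "norm (Ln (v n)) \<le> C / c + 5"
proof -
  have vz: "v n \<noteq> 0" using v_bounds(3)[of n] by auto
  have "ln (norm (v n)) \<le> 1" using ln_le_minus_one[of "norm (v n)"] v_bounds(2)[of n] vz by simp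
  moreover have "- ln (norm (v n)) \<le> C / c"
  proof -
    have "- ln (norm (v n)) = ln (1 / norm (v n))" using vz by (simp add: ln_div)
    also have "\<dots> \<le> 1 / norm (v n)" using ln_le_minus_one[of "1 / norm (v n)"] vz by simp
    also have "\<dots> \<le> 1 / (c / C)" using v_bounds(1)[of n] c C vz by (intro divide_left_mono) auto
    finally show ?thesis by simp
  qed
  ultimately have "\<bar>Re (Ln (v n))\<bar> \<le> 1 + C / c" using vz c C
    by (smt (verit) Re_Ln divide_pos_pos)
  moreover have "\<bar>Im (Ln (v n))\<bar> \<le> 4"
    using Re_Ln_pos_lt_imp[OF v_bounds(3)[of n]] pi_less_4 by linarith
  ultimately show ?thesis using cmod_le[of "Ln (v n)"] by linarith
qed

text \<open>Since k = zet / (1 - zet^2), the sum is a Riemann sum for a differential with primitive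
  -(1/2) log v. The increments of Ln v telescope exactly, and the discretisation error is quadratic
  in D.\<close>

lemma zet_sum: "norm (\<Sum>n<N. (zet (Suc n) - zet n) * k n) \<le> S * C / c + 4 * S * C\<^sup>2 / c\<^sup>2 + (C / c + 5)"
proof -
  define u where "u n = (v (Suc n) - v n) / v n" for n
  have vz: "v n \<noteq> 0" for n using v_bounds(3)[of n] by auto
  \<comment> \<open>All \<open>v n\<close> lie in the right half plane, so their arguments are below
    pi/2 in absolute value and the principal logarithm of a quotient is the difference of the
    logarithms.\<close>
  have Lnv: "Ln (1 + u n) = Ln (v (Suc n)) - Ln (v n)" for n
  proof -
    have e: "v (Suc n) = v n * (1 + u n)" using vz by (simp add: u_def field_simps)
    have "1 + u n = v (Suc n) * inverse (v n)" using vz by (simp add: u_def field_simps)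
    also have "Ln \<dots> = Ln (v (Suc n)) + Ln (inverse (v n))"
    proof (rule Ln_times_simple)
      have i: "Ln (inverse (v n)) = - Ln (v n)"
        using v_bounds(3)[of n] by (intro Ln_inverse) (auto simp: complex_nonpos_Reals_iff)
      show "- pi < Im (Ln (v (Suc n))) + Im (Ln (inverse (v n)))"
        "Im (Ln (v (Suc n))) + Im (Ln (inverse (v n))) \<le> pi"
        using Re_Ln_pos_lt_imp[OF v_bounds(3)[of n]] Re_Ln_pos_lt_imp[OF v_bounds(3)[of "Suc n"]]
        by (auto simp: i abs_less_iff)
    qed (use vz in auto)
    also have "Ln (inverse (v n)) = - Ln (v n)"
      using v_bounds(3)[of n] by (intro Ln_inverse) (auto simp: complex_nonpos_Reals_iff)
    finally show ?thesis by simp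
  qed
  have vd: "norm (v (Suc n) - v n) \<le> 2 * D n" for n
  proof -
    have "v (Suc n) - v n = - ((zet (Suc n) - zet n) * (zet (Suc n) + zet n))"
      by (simp add: v_def algebra_simps power2_eq_square)
    also have "norm \<dots> \<le> D n * 2"
      unfolding norm_minus_cancel norm_mult
      using dzet[of n] norm_triangle_ineq[of "zet (Suc n)" "zet n"] zet_norm[of n] zet_norm[of "Suc n"] D_nonneg[of n]
      by (intro mult_mono) auto
    finally show ?thesis by simp
  qed
  have ub: "norm (u n) \<le> 2 * D n * C / c" for n
  proof -
    have "norm (u n) \<le> (2 * D n) / (c / C)"
      unfolding u_def norm_divide using vd v_bounds(1) c C by (intro frac_le) (auto simp: D_nonneg)
    then show ?thesis by simp
  qed
  have e: "(zet (Suc n) - zet n) * k n = - (1/2) * u n - (1/2) * ((zet (Suc n) - zet n)\<^sup>2 / v n)" for n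
  proof -
    have kv: "k n = zet n / v n"
    proof -
      have "v n = zet n * (lam n - zet n)" using lam_zet[of n] by (simp add: v_def algebra_simps power2_eq_square)
      then show ?thesis using nz(2)[of n] by (simp add: k_def)
    qed
    have "(zet (Suc n) - zet n) * zet n = - (1/2) * (v (Suc n) - v n) - (1/2) * (zet (Suc n) - zet n)\<^sup>2"
      by (simp add: v_def power2_eq_square algebra_simps)
    then have "(zet (Suc n) - zet n) * zet n / v n
        = (- (1/2) * (v (Suc n) - v n) - (1/2) * (zet (Suc n) - zet n)\<^sup>2) / v n" by (rule arg_cong)
    moreover have "(- (1/2) * X - (1/2) * Y) / w = - (1/2) * (X / w) - (1/2) * (Y / w)" for X Y w :: complex
      by (simp add: diff_divide_distrib)
    ultimately show ?thesis unfolding kv u_def by (simp only: times_divide_eq_right)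
  qed
  have t: "norm ((zet (Suc n) - zet n) * k n + (1/2) * (Ln (v (Suc n)) - Ln (v n)))
      \<le> (C / c + 4 * C\<^sup>2 / c\<^sup>2) * (D n)\<^sup>2" for n
  proof -
    have "(zet (Suc n) - zet n) * k n + (1/2) * (Ln (v (Suc n)) - Ln (v n)) =
        (1/2) * (Ln (1 + u n) - u n) - (1/2) * ((zet (Suc n) - zet n)\<^sup>2 / v n)"
      unfolding e Lnv by (simp add: algebra_simps)
    also have "norm \<dots> \<le> norm ((1/2) * (Ln (1 + u n) - u n)) + norm ((1/2) * ((zet (Suc n) - zet n)\<^sup>2 / v n))"
      by (rule norm_triangle_ineq4)
    also have "\<dots> = (1/2) * norm (Ln (1 + u n) - u n) + (1/2) * ((norm (zet (Suc n) - zet n))\<^sup>2 / norm (v n))"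
      by (simp add: norm_mult norm_divide norm_power)
    also have "\<dots> \<le> (1/2) * (2 * (2 * D n * C / c)\<^sup>2) + (1/2) * ((D n)\<^sup>2 / (c / C))"
    proof (intro add_mono mult_left_mono frac_le power_mono)
      have "norm (Ln (1 + u n) - u n) \<le> 2 * (norm (u n))\<^sup>2"
        using ub[of n] D_small(3)[of n] by (intro norm_Ln_minus_linear) linarith
      also have "\<dots> \<le> 2 * (2 * D n * C / c)\<^sup>2" using ub[of n] by (intro mult_left_mono power_mono) auto
      finally show "norm (Ln (1 + u n) - u n) \<le> 2 * (2 * D n * C / c)\<^sup>2" .
    qed (use dzet v_bounds c C in auto)
    also have "\<dots> = 4 * C\<^sup>2 / c\<^sup>2 * (D n)\<^sup>2 + (1/2) * (C / c * (D n)\<^sup>2)"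
      by (simp add: power_mult_distrib power_divide mult_ac)
    also have "\<dots> \<le> (C / c + 4 * C\<^sup>2 / c\<^sup>2) * (D n)\<^sup>2"
    proof -
      have "0 \<le> C / c * (D n)\<^sup>2" using c C by simp
      then show ?thesis unfolding distrib_right by linarith
    qed
    finally show ?thesis .
  qed
  define T where "T = (\<Sum>n<N. (zet (Suc n) - zet n) * k n + (1/2) * (Ln (v (Suc n)) - Ln (v n)))"
  have "norm T \<le> (\<Sum>n<N. (C / c + 4 * C\<^sup>2 / c\<^sup>2) * (D n)\<^sup>2)" unfolding T_def by (rule sum_norm_le) (rule t)
  also have "\<dots> \<le> (C / c + 4 * C\<^sup>2 / c\<^sup>2) * S"
    unfolding sum_distrib_left[symmetric] using D_sum c C by (intro mult_left_mono) auto
  finally have T: "norm T \<le> (C / c + 4 * C\<^sup>2 / c\<^sup>2) * S" .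
  have "(\<Sum>n<N. (zet (Suc n) - zet n) * k n) = T - (1/2) * (\<Sum>n<N. Ln (v (Suc n)) - Ln (v n))"
    by (simp add: T_def sum.distrib sum_distrib_left)
  also have "(\<Sum>n<N. Ln (v (Suc n)) - Ln (v n)) = Ln (v N) - Ln (v 0)"
    by (rule sum_lessThan_telescope)
  finally have "(\<Sum>n<N. (zet (Suc n) - zet n) * k n) = T - (1/2) * (Ln (v N) - Ln (v 0))" .
  also have "norm \<dots> \<le> norm T + (1/2) * (norm (Ln (v N)) + norm (Ln (v 0)))"
  proof -
    define Y where "Y = Ln (v N) - Ln (v 0)"
    have 1: "norm (T - (1/2) * Y) \<le> norm T + norm ((1/2) * Y)" by (rule norm_triangle_ineq4)
    have 2: "norm ((1/2) * Y) = (1/2) * norm Y" by (simp add: norm_mult)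
    have 3: "norm Y \<le> norm (Ln (v N)) + norm (Ln (v 0))" unfolding Y_def by (rule norm_triangle_ineq4)
    show ?thesis unfolding Y_def[symmetric] using 1 3 unfolding 2 by argo
  qed
  also have "\<dots> \<le> (C / c + 4 * C\<^sup>2 / c\<^sup>2) * S + (C / c + 5)"
  proof (intro add_mono T)
    show "(1/2) * (norm (Ln (v N)) + norm (Ln (v 0))) \<le> C / c + 5"
      using Ln_v_bound[of N] Ln_v_bound[of 0] by argo
  qed
  finally show ?thesis by (simp add: algebra_simps)
qed

text \<open>Apart from the factor 1 / gam, the numerator of \<open>x\<close> is the increment of gam
  zet = zet + h. Replacing that factor by 1 costs one more factor D.\<close>

lemma x_split: "norm (x n - ((zet (Suc n) - zet n) * k n + (h (Suc n) - h n) * k n)) \<le> 20 / c * (D n)\<^sup>2"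
proof -
  have gz: "gam n \<noteq> 0" using gam_bounds[of n] by auto
  have e: "of_real (bet n) * zet (Suc n) - zet n = (of_real (gam (Suc n)) * zet (Suc n) - of_real (gam n) * zet n) / of_real (gam n)"
    using gz by (simp add: bet_def field_simps)
  have "(zet (Suc n) - zet n) * k n + (h (Suc n) - h n) * k n
      = (of_real (gam (Suc n)) * zet (Suc n) - of_real (gam n) * zet n) * k n"
    by (simp add: h_def algebra_simps)
  also have "\<dots> = of_real (gam n) * (of_real (bet n) * zet (Suc n) - zet n) * k n"
    unfolding e using gz by simp
  finally have "x n - ((zet (Suc n) - zet n) * k n + (h (Suc n) - h n) * k n)
      = of_real (1 - gam n) * (of_real (bet n) * zet (Suc n) - zet n) * k n"
    by (simp add: x_def k_def algebra_simps diff_divide_distrib)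
  also have "norm \<dots> \<le> D n * (5 * D n) * (1 / c)"
    unfolding norm_mult norm_of_real using gam(1)[of n] bet_zet_diff[of n] k_bound[of n] D_nonneg[of n]
    by (intro mult_mono) (auto simp: abs_minus_commute)
  also have "\<dots> \<le> 20 / c * (D n)\<^sup>2" using c by (simp add: power2_eq_square divide_right_mono)
  finally show ?thesis .
qed

lemma x_sum: "norm (\<Sum>n<N. x n) \<le> 20 / c * S + (S * C / c + 4 * S * C\<^sup>2 / c\<^sup>2 + (C / c + 5)) + (2 / c + 2 * S / c\<^sup>2)"
proof -
  define T where "T = (\<Sum>n<N. x n - ((zet (Suc n) - zet n) * k n + (h (Suc n) - h n) * k n))"
  have "norm T \<le> (\<Sum>n<N. 20 / c * (D n)\<^sup>2)" unfolding T_def by (rule sum_norm_le) (rule x_split)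
  also have "\<dots> \<le> 20 / c * S"
    unfolding sum_distrib_left[symmetric] using D_sum c by (intro mult_left_mono) auto
  finally have T: "norm T \<le> 20 / c * S" .
  have "(\<Sum>n<N. x n) = T + (\<Sum>n<N. (zet (Suc n) - zet n) * k n) + (\<Sum>n<N. (h (Suc n) - h n) * k n)"
    by (simp add: T_def sum.distrib sum_subtractf)
  then show ?thesis
    using norm_triangle_ineq[of "T + (\<Sum>n<N. (zet (Suc n) - zet n) * k n)" "\<Sum>n<N. (h (Suc n) - h n) * k n"]
      norm_triangle_ineq[of T "\<Sum>n<N. (zet (Suc n) - zet n) * k n"] T zet_sum[of N] h_sum[of N] by simp
qed

definition Ln_F_const :: real where
  "Ln_F_const = 50 * S / c\<^sup>2 + 5 / (2 * c) * (S + g_const)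
     + (20 / c * S + (S * C / c + 4 * S * C\<^sup>2 / c\<^sup>2 + (C / c + 5)) + (2 / c + 2 * S / c\<^sup>2))"

lemma Ln_F_sum: "norm (\<Sum>n<N. Ln (F n)) \<le> Ln_F_const / q"
proof -
  let ?A = "50 * S / c\<^sup>2" and ?B = "20 / c * S + (S * C / c + 4 * S * C\<^sup>2 / c\<^sup>2 + (C / c + 5)) + (2 / c + 2 * S / c\<^sup>2)"
  have "norm (\<Sum>n<N. Ln (F n) + x n) \<le>
      (\<Sum>n<N. 50 * (D n)\<^sup>2 / c\<^sup>2 + 5 / (2 * c) * ((D n)\<^sup>2 / q + q * (norm (g n))\<^sup>2))"
    by (rule sum_norm_le) (rule Ln_F_bound)
  also have "\<dots> = 50 / c\<^sup>2 * (\<Sum>n<N. (D n)\<^sup>2) + 5 / (2 * c) * (1 / q * (\<Sum>n<N. (D n)\<^sup>2) + q * (\<Sum>n<N. (norm (g n))\<^sup>2))"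
  proof -
    have "50 * (D n)\<^sup>2 / c\<^sup>2 + 5 / (2 * c) * ((D n)\<^sup>2 / q + q * (norm (g n))\<^sup>2)
        = 50 / c\<^sup>2 * (D n)\<^sup>2 + (5 / (2 * c) * (1 / q) * (D n)\<^sup>2 + 5 / (2 * c) * q * (norm (g n))\<^sup>2)" for n
      by (simp add: algebra_simps)
    then show ?thesis
      by (simp only: sum.distrib sum_distrib_left[symmetric]) (simp only: distrib_left mult.assoc)
  qed
  also have "\<dots> \<le> 50 / c\<^sup>2 * S + 5 / (2 * c) * (1 / q * S + q * (g_const / q\<^sup>2))"
    using D_sum[of N] g_sum[of N] c q by (intro add_mono mult_left_mono) auto
  also have "\<dots> = ?A + 5 / (2 * c) * (S + g_const) / q" using q c by (simp add: field_simps power2_eq_square)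
  finally have 1: "norm (\<Sum>n<N. Ln (F n) + x n) \<le> ?A + 5 / (2 * c) * (S + g_const) / q" .
  have "(\<Sum>n<N. Ln (F n)) = (\<Sum>n<N. Ln (F n) + x n) - (\<Sum>n<N. x n)" by (simp add: sum.distrib)
  then have "norm (\<Sum>n<N. Ln (F n)) \<le> ?A + ?B + 5 / (2 * c) * (S + g_const) / q"
    using norm_triangle_ineq4[of "\<Sum>n<N. Ln (F n) + x n" "\<Sum>n<N. x n"] 1 x_sum[of N] by simp
  also have "?A + ?B \<le> (?A + ?B) / q"
  proof -
    have "0 \<le> ?A + ?B" using c C S_nonneg by (intro add_nonneg_nonneg) auto
    then show ?thesis using q by (simp add: pos_le_divide_eq mult_left_le)
  qed
  finally show ?thesis by (simp add: Ln_F_const_def add_divide_distrib)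
qed

end

subsection \<open>Comparison with the free solution\<close>

text \<open>Re (1 - w^2) = 1 - (Re w)^2 + (Im w)^2, so a bound on Re w alone keeps 1 - w^2 in the
  right half plane, away from the cut of \<open>csqrt\<close>, at any height.\<close>

lemma csqrt_facts:
  fixes w :: complex
  assumes "\<bar>Re w\<bar> \<le> 1 - \<eta>" "0 < \<eta>" "\<eta> \<le> 1"
  shows "\<eta> \<le> Re (1 - w\<^sup>2)" "\<eta> \<le> Re (csqrt (1 - w\<^sup>2))" "norm (csqrt (1 - w\<^sup>2)) \<le> 1 + norm w"
proof -
  have "(Re w)\<^sup>2 \<le> (1 - \<eta>)\<^sup>2" using assms by (intro power2_le_iff_abs_le[THEN iffD2]) auto
  also have "\<dots> \<le> 1 - \<eta>" using assms by (simp add: power2_eq_square mult_left_le)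
  finally show 1: "\<eta> \<le> Re (1 - w\<^sup>2)" by (simp add: power2_eq_square) (smt (verit) zero_le_square)
  have "\<eta>\<^sup>2 \<le> \<eta>" using assms by (simp add: power2_eq_square mult_left_le)
  also have "\<dots> \<le> (norm (1 - w\<^sup>2) + Re (1 - w\<^sup>2)) / 2"
  proof -
    have "\<eta> \<le> (q + p) / 2" if "\<eta> \<le> p" "p \<le> q" for p q :: real using that by (simp add: field_simps)
    from this[OF 1 complex_Re_le_cmod] show ?thesis .
  qed
  finally have "\<eta> \<le> sqrt ((norm (1 - w\<^sup>2) + Re (1 - w\<^sup>2)) / 2)" by (rule real_le_rsqrt)
  then show "\<eta> \<le> Re (csqrt (1 - w\<^sup>2))" by simp
  have "norm (1 - w\<^sup>2) \<le> 1 + (norm w)\<^sup>2" using norm_triangle_ineq4[of 1 "w\<^sup>2"] by (simp add: norm_power)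
  also have "\<dots> \<le> (1 + norm w)\<^sup>2" by (simp add: power2_sum)
  finally have "sqrt (norm (1 - w\<^sup>2)) \<le> 1 + norm w" by (intro real_le_lsqrt) auto
  then show "norm (csqrt (1 - w\<^sup>2)) \<le> 1 + norm w" by simp
qed

text \<open>A solution of lambda + 1 / lambda = 2 w. Taking the root of 1 - w^2 instead of w^2 - 1
  makes the branch holomorphic across the real interval |w| < 1, and the factor i puts this root in
  the upper half plane when Im w \<ge> 0.\<close>

definition outer_root :: "complex \<Rightarrow> complex" where "outer_root w = w + \<i> * csqrt (1 - w\<^sup>2)"
definition inner_root :: "complex \<Rightarrow> complex" where "inner_root w = w - \<i> * csqrt (1 - w\<^sup>2)"

lemma outer_inner_mult: "outer_root w * inner_root w = 1" and outer_inner_add: "outer_root w + inner_root w = 2 * w"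
proof -
  have "outer_root w * inner_root w = w\<^sup>2 + (csqrt (1 - w\<^sup>2))\<^sup>2" by (simp add: outer_root_def inner_root_def algebra_simps power2_eq_square)
  then show "outer_root w * inner_root w = 1" by simp
qed (simp add: outer_root_def inner_root_def)

lemma norm_outer_root_real:
  assumes "Im w = 0" "\<bar>Re w\<bar> \<le> 1" shows "norm (outer_root w) = 1"
proof -
  have w: "w = of_real (Re w)" using assms by (simp add: complex_eq_iff)
  have "(Re w)\<^sup>2 \<le> 1" using assms abs_square_le_1 by blast
  then have "csqrt (1 - w\<^sup>2) = of_real (sqrt (1 - (Re w)\<^sup>2))"
  proof -
    have e: "1 - w\<^sup>2 = of_real (1 - (Re w)\<^sup>2)" using w by (metis of_real_1 of_real_diff of_real_power)
    show ?thesis unfolding e using \<open>(Re w)\<^sup>2 \<le> 1\<close> by (subst csqrt_of_real_nonneg) auto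
  qed
  then have "(norm (outer_root w))\<^sup>2 = (Re w)\<^sup>2 + (sqrt (1 - (Re w)\<^sup>2))\<^sup>2"
    using assms by (simp add: outer_root_def cmod_power2)
  also have "\<dots> = 1" using \<open>(Re w)\<^sup>2 \<le> 1\<close> by simp
  finally show ?thesis by (simp add: power2_eq_1_iff) (smt (verit) norm_ge_zero)
qed

context
  fixes w :: complex and \<eta> B :: real
  assumes w: "\<bar>Re w\<bar> \<le> 1 - \<eta>" "0 \<le> Im w" and \<eta>: "0 < \<eta>" "\<eta> \<le> 1" and B: "norm w \<le> B"
begin

lemma outer_root_norm: "norm (outer_root w) \<le> 2 * B + 1"
  using norm_triangle_ineq[of w "\<i> * csqrt (1 - w\<^sup>2)"] csqrt_facts(3)[OF w(1) \<eta>] B by (simp add: outer_root_def norm_mult)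

lemma outer_root_Im: "\<eta> \<le> Im (outer_root w)" using csqrt_facts(2)[OF w(1) \<eta>] w(2) by (simp add: outer_root_def)

lemma outer_root_pos: "0 < norm (outer_root w)" using outer_root_Im \<eta> by auto

lemma inner_root_eq: "inner_root w = cnj (outer_root w) / of_real ((norm (outer_root w))\<^sup>2)"
proof -
  have "outer_root w * (cnj (outer_root w) / of_real ((norm (outer_root w))\<^sup>2)) = 1"
    using outer_root_pos by (simp add: complex_norm_square[symmetric] del: of_real_power) 
  then show ?thesis using outer_inner_mult[of w] outer_root_pos by (metis mult_left_cancel norm_zero less_irrefl)
qed

lemma inner_root_Im: "Im (inner_root w) \<le> - (\<eta> / (2 * B + 1)\<^sup>2)"
proof -
  have "\<eta> / (2 * B + 1)\<^sup>2 \<le> Im (outer_root w) / (norm (outer_root w))\<^sup>2"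
    using outer_root_Im outer_root_norm outer_root_pos \<eta> by (intro frac_le power_mono) auto
  then show ?thesis by (simp add: inner_root_eq Im_divide_of_real del: of_real_power)
qed

text \<open>Taking imaginary parts in lambda + 1 / lambda = 2 w gives 2 Im w = Im lambda (1 - |1 /
  lambda|^2). Thus the contraction rate is linear in Im w, and a larger gap is not to be had near
  the axis.\<close>

lemma inner_root_norm: "(norm (inner_root w))\<^sup>2 \<le> 1 - 2 * Im w / (2 * B + 1)"
proof -
  have n: "norm (inner_root w) = 1 / norm (outer_root w)"
    using outer_inner_mult[of w] outer_root_pos by (metis mult.commute nonzero_eq_divide_eq norm_mult norm_one less_irrefl)
  have "2 * Im w = Im (outer_root w) + Im (inner_root w)"
  proof -
    have "Im (outer_root w + inner_root w) = Im (2 * w)" by (simp only: outer_inner_add)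
    then show ?thesis by simp
  qed
  also have "Im (inner_root w) = - (Im (outer_root w) * (norm (inner_root w))\<^sup>2)"
    unfolding n by (simp add: inner_root_eq Im_divide_of_real power_divide del: of_real_power)
  finally have e: "2 * Im w = Im (outer_root w) * (1 - (norm (inner_root w))\<^sup>2)" by (simp add: algebra_simps)
  have p: "0 < Im (outer_root w)" "Im (outer_root w) \<le> 2 * B + 1" using outer_root_Im \<eta> abs_Im_le_cmod[of "outer_root w"] outer_root_norm by linarith+
  have "0 \<le> 1 - (norm (inner_root w))\<^sup>2" using e w(2) p(1) by (metis mult_nonneg_nonneg zero_le_mult_iff zero_le_numeral not_le)
  then have "2 * Im w \<le> (2 * B + 1) * (1 - (norm (inner_root w))\<^sup>2)" unfolding e using p by (intro mult_right_mono) auto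
  moreover have "0 < 2 * B + 1" using p by linarith
  ultimately show ?thesis by (simp add: field_simps)
qed

end

text \<open>The difference of two square roots is the difference of the radicands over the sum of
  the roots, and the real part of that sum is at least 2 \<eta>.\<close>

lemma roots_lipschitz:
  assumes w: "\<bar>Re w\<bar> \<le> 1 - \<eta>" and v: "\<bar>Re v\<bar> \<le> 1 - \<eta>" and \<eta>: "0 < \<eta>" "\<eta> \<le> 1" and B: "norm w \<le> B" "norm v \<le> B"
  shows "norm (outer_root w - outer_root v) \<le> (1 + B / \<eta>) * norm (w - v)" "norm (inner_root w - inner_root v) \<le> (1 + B / \<eta>) * norm (w - v)"
proof -
  define s t where "s = csqrt (1 - w\<^sup>2)" and "t = csqrt (1 - v\<^sup>2)"
  have "2 * \<eta> \<le> Re (s + t)" using csqrt_facts(2)[OF w \<eta>] csqrt_facts(2)[OF v \<eta>] by (simp add: s_def t_def del: csqrt.simps)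
  then have st: "2 * \<eta> \<le> norm (s + t)" using complex_Re_le_cmod[of "s + t"] by linarith
  have "s\<^sup>2 - t\<^sup>2 = v\<^sup>2 - w\<^sup>2" by (simp add: s_def t_def)
  then have "(s - t) * (s + t) = - ((w - v) * (w + v))" by (simp add: algebra_simps power2_eq_square)
  then have "norm (s - t) * norm (s + t) = norm (w - v) * norm (w + v)" by (metis norm_minus_cancel norm_mult)
  moreover have "norm (s - t) * (2 * \<eta>) \<le> norm (s - t) * norm (s + t)" using st by (intro mult_left_mono) auto
  moreover have "norm (w - v) * norm (w + v) \<le> norm (w - v) * (2 * B)"
    using norm_triangle_ineq[of w v] B by (intro mult_left_mono) auto
  ultimately have "norm (s - t) * \<eta> \<le> norm (w - v) * B" by linarith
  then have d: "norm (s - t) \<le> B / \<eta> * norm (w - v)" using \<eta> by (simp add: field_simps)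
  have "outer_root w - outer_root v = (w - v) + \<i> * (s - t)" "inner_root w - inner_root v = (w - v) - \<i> * (s - t)"
    by (simp_all add: outer_root_def inner_root_def s_def t_def algebra_simps)
  then have "norm (outer_root w - outer_root v) \<le> norm (w - v) + norm (s - t)" "norm (inner_root w - inner_root v) \<le> norm (w - v) + norm (s - t)"
    using norm_triangle_ineq[of "w - v" "\<i> * (s - t)"] norm_triangle_ineq4[of "w - v" "\<i> * (s - t)"] by (simp_all add: norm_mult)
  then show "norm (outer_root w - outer_root v) \<le> (1 + B / \<eta>) * norm (w - v)" "norm (inner_root w - inner_root v) \<le> (1 + B / \<eta>) * norm (w - v)"
    using d by (simp_all add: distrib_right)
qed

text \<open>Crude on purpose: ln t \<le> t - 1, applied to the modulus and to its inverse, turns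
  polynomial control in y into a bound of order 1 / y, and the argument is below 4 \<le> 4 Y /
  y.\<close>

lemma norm_Ln_upper:
  assumes v: "0 < Im v" and y: "0 < y" "y \<le> Y" and k: "0 < k" "k * y \<le> norm v" and Q: "norm v \<le> Q / y"
  shows "norm (Ln v) \<le> (Q + 1 / k + 4 * Y) / y"
proof -
  have vz: "0 < norm v" using v by auto
  then have Q0: "0 < Q" using Q y by (metis less_le_trans zero_less_divide_iff not_less_iff_gr_or_eq)
  have "ln (norm v) \<le> Q / y" using ln_le_minus_one[OF vz] Q by linarith
  moreover have "- ln (norm v) \<le> 1 / k / y"
  proof -
    have "- ln (norm v) = ln (1 / norm v)" using vz by (simp add: ln_div)
    also have "\<dots> \<le> 1 / norm v" using ln_le_minus_one[of "1 / norm v"] vz by simp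
    also have "\<dots> \<le> 1 / (k * y)" using k y vz by (intro divide_left_mono) auto
    finally show ?thesis by simp
  qed
  moreover have "0 \<le> Q / y" "0 \<le> 1 / k / y" using Q0 y k by auto
  moreover have "\<bar>Re (Ln v)\<bar> = \<bar>ln (norm v)\<bar>" using vz by simp
  ultimately have "\<bar>Re (Ln v)\<bar> \<le> Q / y + 1 / k / y" by linarith
  moreover have "\<bar>Im (Ln v)\<bar> \<le> 4 * Y / y"
  proof -
    have "\<bar>Im (Ln v)\<bar> \<le> 4" using Im_Ln_pos_lt_imp[OF v] pi_less_4 by linarith
    also have "4 \<le> 4 * Y / y" using y by (simp add: field_simps)
    finally show ?thesis .
  qed
  ultimately show ?thesis using cmod_le[of "Ln v"] by (simp add: add_divide_distrib)
qed

section \<open>Uniform constants and the normalised recursion on a strip\<close>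

locale wkb_domain = jacobi_coeffs +
  fixes x0 R \<eta> :: real
  assumes R: "0 < R" and \<eta>: "0 < \<eta>" "\<eta> \<le> 1"
begin

definition Z :: real where "Z = \<bar>x0\<bar> + 2 * R + 1"
definition B :: real where "B = (Z + K) / c0 + 1"
definition C :: real where "C = 2 * B + 1"
definition c :: real where "c = \<eta> / C\<^sup>2"
text \<open>Lipschitz constant of the roots times that of \<open>w\<close> in the increments of the
  coefficients; the last 1 / c0 covers the deviation of \<open>sqrt_ratio\<close> from 1.\<close>

definition L :: real where "L = (1 + B / \<eta>) * (1 / c0 + (Z + K) * K / c0 ^ 3) + 1 / c0"
text \<open>The geometric mean matters: normalising by \<open>a n\<close> alone would leave first-order terms in the
  variation of \<open>a\<close> that do not telescope.\<close>

definition alpha :: "nat \<Rightarrow> real" where "alpha n = sqrt (a n * a (n - 1))"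
definition w :: "nat \<Rightarrow> complex \<Rightarrow> complex" where "w n z = (z - of_real (b n)) / of_real (2 * alpha n)"
definition step_size :: "nat \<Rightarrow> real" where "step_size n = \<bar>a (Suc n) - a n\<bar> + \<bar>b (Suc n) - b n\<bar>"
text \<open>The quotient of \<open>alpha n\<close> by \<open>a n\<close>, which converts the
  normalised ratio back into P_(n+1) / P_n.\<close>

definition sqrt_ratio :: "nat \<Rightarrow> real" where "sqrt_ratio n = sqrt (a (n - 1) / a n)"
text \<open>The height R + 1 accommodates half discs of radius R lifted by at most 1.\<close>

definition strip :: "complex set" where "strip = {z. \<bar>Re z - x0\<bar> \<le> R \<and> 0 \<le> Im z \<and> Im z \<le> R + 1}"

lemma const_pos: "0 < Z" "1 \<le> B" "1 \<le> C" "0 < c" "c \<le> 1" "0 < L" "0 \<le> 1 + B / \<eta>"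
proof -
  show Z: "0 < Z" using R by (simp add: Z_def)
  show B: "1 \<le> B" using Z K_pos c0 by (simp add: B_def)
  show C: "1 \<le> C" using B by (simp add: C_def)
  show "0 < c" using C \<eta> by (simp add: c_def)
  have "1 \<le> C\<^sup>2" using C by (simp add: one_le_power)
  then have "\<eta> \<le> C\<^sup>2" "0 < C\<^sup>2" using \<eta> by linarith+
  then show "c \<le> 1" by (simp add: c_def)
  have 1: "0 \<le> B / \<eta>" using B \<eta> by simp
  then show "0 \<le> 1 + B / \<eta>" by simp
  show "0 < L" unfolding L_def using 1 Z K_pos c0 by (intro add_nonneg_pos mult_nonneg_nonneg add_nonneg_nonneg) auto
qed

lemma alpha_bounds:
  assumes "2 \<le> n" shows "c0 \<le> alpha n" "alpha n \<le> K" "0 < alpha n" "(alpha n)\<^sup>2 = a n * a (n - 1)"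
proof -
  have n: "1 \<le> n" "1 \<le> n - 1" using assms by linarith+
  have l: "c0 * c0 \<le> a n * a (n - 1)" using a_ge[OF n(1)] a_ge[OF n(2)] c0 by (intro mult_mono) auto
  have u: "a n * a (n - 1) \<le> K * K" using a_le[OF n(1)] a_le[OF n(2)] a_pos[OF n(1)] a_pos[OF n(2)] K_pos by (intro mult_mono) auto
  show 1: "c0 \<le> alpha n" unfolding alpha_def using l by (intro real_le_rsqrt) (simp add: power2_eq_square)
  show "alpha n \<le> K" unfolding alpha_def using u K_pos by (intro real_le_lsqrt) (auto simp: power2_eq_square)
  show "0 < alpha n" using 1 c0 by linarith
  show "(alpha n)\<^sup>2 = a n * a (n - 1)" unfolding alpha_def using a_pos[OF n(1)] a_pos[OF n(2)] by (intro real_sqrt_pow2) auto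
qed

lemma strip_norm: "z \<in> strip \<Longrightarrow> norm z \<le> Z"
  using cmod_le[of z] by (auto simp: strip_def Z_def abs_le_iff)

lemma zb_norm: "z \<in> strip \<Longrightarrow> 1 \<le> n \<Longrightarrow> norm (z - of_real (b n)) \<le> Z + K"
  using norm_triangle_ineq4[of z "of_real (b n)"] strip_norm[of z] b_le[of n] by simp

lemma w_norm:
  assumes "z \<in> strip" "2 \<le> n" shows "norm (w n z) \<le> B"
proof -
  have "norm (w n z) \<le> (Z + K) / c0"
    unfolding w_def norm_divide using zb_norm[OF assms(1), of n] alpha_bounds[OF assms(2)] assms(2) c0 const_pos K_pos by (intro frac_le) auto
  then show ?thesis by (simp add: B_def)
qed

lemma w_Im: "z \<in> strip \<Longrightarrow> 2 \<le> n \<Longrightarrow> Im z / (2 * K) \<le> Im (w n z)"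
  unfolding w_def using alpha_bounds[of n] c0 by (auto simp: Im_divide_of_real strip_def intro!: divide_left_mono simp del: of_real_mult)

text \<open>The squares of consecutive \<open>alpha\<close> differ by a_n (a_(n+1) - a_(n-1)). So
  two increments enter, which is why the later error bounds contain a sum of two step sizes.\<close>

lemma alpha_diff:
  assumes "2 \<le> n" shows "\<bar>alpha (Suc n) - alpha n\<bar> \<le> K / c0 * (step_size (n - 1) + step_size n)"
proof -
  have n: "1 \<le> n" "1 \<le> n - 1" "Suc (n - 1) = n" using assms by linarith+
  note A = alpha_bounds[OF assms] and A' = alpha_bounds[of "Suc n"]
  have "(alpha (Suc n) - alpha n) * (alpha (Suc n) + alpha n) = a n * (a (Suc n) - a (n - 1))"
    using A(4) A'(4) assms by (simp add: algebra_simps power2_eq_square)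
  moreover have "\<bar>a (Suc n) - a (n - 1)\<bar> \<le> step_size (n - 1) + step_size n" using n(3) by (simp add: step_size_def)
  then have "\<bar>a n * (a (Suc n) - a (n - 1))\<bar> \<le> K * (step_size (n - 1) + step_size n)"
    unfolding abs_mult using a_le[OF n(1)] a_pos[OF n(1)] by (intro mult_mono) (auto simp: step_size_def)
  moreover have "\<bar>alpha (Suc n) - alpha n\<bar> * c0 \<le> \<bar>(alpha (Suc n) - alpha n) * (alpha (Suc n) + alpha n)\<bar>"
    unfolding abs_mult using A A' assms c0 by (intro mult_left_mono) auto
  ultimately have "\<bar>alpha (Suc n) - alpha n\<bar> * c0 \<le> K * (step_size (n - 1) + step_size n)" by linarith
  then show ?thesis using c0 by (simp add: field_simps)
qed

lemma step_size_nonneg: "0 \<le> step_size n" by (simp add: step_size_def)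

lemma w_diff:
  assumes "z \<in> strip" "2 \<le> n"
  shows "norm (w (Suc n) z - w n z) \<le> (1 / c0 + (Z + K) * K / c0 ^ 3) * (step_size (n - 1) + step_size n)"
proof -
  note A = alpha_bounds[OF assms(2)] and A' = alpha_bounds[of "Suc n"]
  have A'': "0 < alpha (Suc n)" "c0 \<le> alpha (Suc n)" using A' assms by auto
  have e: "w (Suc n) z - w n z = - of_real ((b (Suc n) - b n) / (2 * alpha (Suc n)))
      - (z - of_real (b n)) * of_real ((alpha (Suc n) - alpha n) / (2 * alpha n * alpha (Suc n)))"
    unfolding w_def using A A'' by (simp add: field_simps)
  have "\<bar>(b (Suc n) - b n) / (2 * alpha (Suc n))\<bar> \<le> (step_size (n - 1) + step_size n) / c0"
    unfolding abs_divide using A'' c0 step_size_nonneg[of "n - 1"] by (intro frac_le) (auto simp: step_size_def)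
  moreover have "norm ((z - of_real (b n)) * of_real ((alpha (Suc n) - alpha n) / (2 * alpha n * alpha (Suc n))))
      \<le> (Z + K) * ((K / c0 * (step_size (n - 1) + step_size n)) / (c0 * c0))"
    unfolding norm_mult norm_of_real
  proof (intro mult_mono)
    show "\<bar>(alpha (Suc n) - alpha n) / (2 * alpha n * alpha (Suc n))\<bar> \<le> (K / c0 * (step_size (n - 1) + step_size n)) / (c0 * c0)"
      unfolding abs_divide
    proof (intro frac_le alpha_diff assms)
      have "c0 * c0 \<le> alpha n * alpha (Suc n)" using A A'' c0 by (intro mult_mono) auto
      moreover have "\<bar>2 * alpha n * alpha (Suc n)\<bar> = 2 * (alpha n * alpha (Suc n))" using A A'' by (simp add: abs_mult)
      moreover have "0 \<le> c0 * c0" by simp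
      ultimately show "c0 * c0 \<le> \<bar>2 * alpha n * alpha (Suc n)\<bar>" by linarith
    qed (use c0 K_pos step_size_nonneg in auto)
  qed (use zb_norm[OF assms(1), of n] assms const_pos K_pos in auto)
  ultimately have "norm (w (Suc n) z - w n z) \<le> (step_size (n - 1) + step_size n) / c0 + (Z + K) * ((K / c0 * (step_size (n - 1) + step_size n)) / (c0 * c0))"
    unfolding e by (intro order_trans[OF norm_triangle_ineq4] add_mono) (auto simp only: norm_minus_cancel norm_of_real)
  also have "\<dots> = (1 / c0 + (Z + K) * K / c0 ^ 3) * (step_size (n - 1) + step_size n)"
    using c0 by (simp add: field_simps power3_eq_cube)
  finally show ?thesis .
qed

lemma sqrt_ratio_bound:
  assumes "2 \<le> n" shows "\<bar>sqrt_ratio n - 1\<bar> \<le> step_size (n - 1) / c0" "0 < sqrt_ratio n"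
proof -
  have n: "1 \<le> n" "1 \<le> n - 1" "Suc (n - 1) = n" using assms by linarith+
  note p = a_pos[OF n(1)] a_pos[OF n(2)]
  show g: "0 < sqrt_ratio n" using p by (simp add: sqrt_ratio_def)
  have "(sqrt_ratio n)\<^sup>2 = a (n - 1) / a n" unfolding sqrt_ratio_def using p by (intro real_sqrt_pow2) simp
  then have "(sqrt_ratio n - 1) * (sqrt_ratio n + 1) = (a (n - 1) - a n) / a n"
    using p by (simp add: algebra_simps power2_eq_square diff_divide_distrib)
  then have "\<bar>sqrt_ratio n - 1\<bar> * (sqrt_ratio n + 1) = \<bar>a (n - 1) - a n\<bar> / a n"
    using g p by (metis abs_divide abs_mult abs_of_pos add_pos_pos zero_less_one)
  also have "\<dots> \<le> step_size (n - 1) / c0"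
    using a_ge[OF n(1)] c0 n(3) by (intro frac_le) (auto simp: step_size_def abs_minus_commute)
  finally have A: "\<bar>sqrt_ratio n - 1\<bar> * (sqrt_ratio n + 1) \<le> step_size (n - 1) / c0" .
  have B: "\<bar>sqrt_ratio n - 1\<bar> * 1 \<le> \<bar>sqrt_ratio n - 1\<bar> * (sqrt_ratio n + 1)" using g by (intro mult_left_mono) auto
  show "\<bar>sqrt_ratio n - 1\<bar> \<le> step_size (n - 1) / c0" using order_trans[OF B A] by simp
qed

definition scaled_ratio :: "nat \<Rightarrow> complex \<Rightarrow> complex" where "scaled_ratio n z = r n z / of_real (alpha n)"

text \<open>The coefficient a_n^2 / (alpha_n alpha_(n+1)) is itself a quotient of consecutive terms
  of \<open>sqrt_ratio\<close>. This is the form of \<open>gam\<close> in the perturbed recursion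
  and the reason its first-order effect can be summed by parts.\<close>

lemma scaled_ratio_rec:
  assumes z: "0 < Im z" and n: "2 \<le> n"
  shows "scaled_ratio (Suc n) z = 2 * w (Suc n) z - of_real (sqrt_ratio (Suc n) / sqrt_ratio n) / scaled_ratio n z"
proof -
  have n': "1 \<le> n" "1 \<le> n - 1" using n by linarith+
  note p = a_pos[OF n'(1)] a_pos[OF n'(2)] a_pos[of "Suc n"]
  have A: "0 < alpha n" "0 < alpha (Suc n)" using alpha_bounds n by auto
  have rz: "r n z \<noteq> 0" using r_im[OF z n'(1)] z by auto
  have gg: "sqrt_ratio (Suc n) / sqrt_ratio n = (a n)\<^sup>2 / (alpha n * alpha (Suc n))"
  proof -
    have "sqrt_ratio (Suc n) * alpha (Suc n) = sqrt ((a n)\<^sup>2)"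
      using p by (simp add: sqrt_ratio_def alpha_def real_sqrt_mult[symmetric] power2_eq_square)
    moreover have "sqrt_ratio n * a n = sqrt (a (n - 1) / a n) * sqrt ((a n)\<^sup>2)" using p by (simp add: sqrt_ratio_def)
    then have "sqrt_ratio n * a n = alpha n"
      unfolding alpha_def real_sqrt_mult[symmetric] using p by (simp add: power2_eq_square mult.commute)
    ultimately show ?thesis using A p sqrt_ratio_bound(2)[OF n] by (simp add: field_simps power2_eq_square)
  qed
  show ?thesis
    unfolding scaled_ratio_def r_Suc[OF n'(1) P_nz[OF z n'(1)] P_nz[OF z, of "Suc n", simplified]] w_def gg
    using A rz by (simp add: field_simps)
qed

lemma P_step_scaled_ratio:
  assumes z: "0 < Im z" and n: "2 \<le> n"
  shows "P (Suc n) z = of_real (sqrt_ratio n) * scaled_ratio n z * P n z"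
proof -
  have n': "1 \<le> n" "1 \<le> n - 1" using n by linarith+
  note p = a_pos[OF n'(1)] a_pos[OF n'(2)]
  have "sqrt_ratio n * a n = sqrt (a (n - 1) / a n) * sqrt ((a n)\<^sup>2)" using p by (simp add: sqrt_ratio_def)
  then have "sqrt_ratio n * a n = alpha n"
    unfolding alpha_def real_sqrt_mult[symmetric] using p by (simp add: power2_eq_square mult.commute)
  then have "complex_of_real (sqrt_ratio n) * of_real (a n) = of_real (alpha n)" by (metis of_real_mult)
  then show ?thesis
    using P_nz[OF z n'(1)] alpha_bounds(3)[OF n] by (simp add: scaled_ratio_def orth_ratio_def field_simps del: orth_poly.simps)
qed

end

section \<open>A holomorphic logarithm of the quotient and its mean on the real interval\<close>

locale wkb = wkb_domain +
  fixes m :: nat and S0 :: real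
  assumes m: "2 \<le> m"
    and inside: "\<And>n x. m \<le> n \<Longrightarrow> \<bar>x - x0\<bar> \<le> R \<Longrightarrow> \<bar>x - b n\<bar> \<le> 2 * (1 - \<eta>) * alpha n"
    and sumd: "\<And>N. (\<Sum>k<N. (L * (step_size (m + k - 1) + step_size (m + k)))\<^sup>2) \<le> S0"
    and small: "\<And>n. m \<le> n \<Longrightarrow> L * (step_size (n - 1) + step_size n) \<le> c / (16 * C)"
begin

abbreviation lam :: "nat \<Rightarrow> complex \<Rightarrow> complex" where "lam n z \<equiv> outer_root (w n z)"
abbreviation zet :: "nat \<Rightarrow> complex \<Rightarrow> complex" where "zet n z \<equiv> inner_root (w n z)"

lemma w_Re:
  assumes "z \<in> strip" "m \<le> n" shows "\<bar>Re (w n z)\<bar> \<le> 1 - \<eta>"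
proof -
  have A: "0 < alpha n" using alpha_bounds[of n] assms m by simp
  have "Re (w n z) = (Re z - b n) / (2 * alpha n)" by (simp add: w_def Re_divide_of_real del: of_real_mult)
  moreover have "\<bar>Re z - b n\<bar> \<le> 2 * (1 - \<eta>) * alpha n" using inside[OF assms(2)] assms(1) by (simp add: strip_def)
  then have "\<bar>Re z - b n\<bar> / (2 * alpha n) \<le> 2 * (1 - \<eta>) * alpha n / (2 * alpha n)"
    using A by (intro divide_right_mono) auto
  ultimately show ?thesis using A by (simp add: abs_divide)
qed

lemma w_Im_nonneg: "z \<in> strip \<Longrightarrow> m \<le> n \<Longrightarrow> 0 \<le> Im (w n z)"
  using w_Im[of z n] m K_pos by (auto simp: strip_def intro: order_trans[rotated])

text \<open>Lower bound for 1 - |zet|^2: the height of \<open>w n z\<close> is at least Im z / (2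
  K), and \<open>inner_root_norm\<close> multiplies it by 2 / C.\<close>

definition gap :: "complex \<Rightarrow> real" where "gap z = Im z / (K * C)"

lemma perturbed:
  assumes z: "z \<in> strip" "0 < Im z"
  shows "perturbed_recursion (\<lambda>k. lam (m + k) z) (\<lambda>k. zet (m + k) z) (\<lambda>k. scaled_ratio (m + k) z) (\<lambda>k. sqrt_ratio (m + k))
     (\<lambda>k. L * (step_size (m + k - 1) + step_size (m + k))) (gap z) c C S0"
proof -
  have mk: "m \<le> m + k" "2 \<le> m + k" "1 \<le> m + k" for k using m by auto
  have qz: "0 < gap z" using z K_pos const_pos by (simp add: gap_def)
  have zz: "(norm (zet (m + k) z))\<^sup>2 \<le> 1 - gap z" for k
  proof -
    have "gap z \<le> 2 * Im (w (m + k) z) / (2 * B + 1)"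
      using w_Im[OF z(1) mk(2)[of k]] const_pos K_pos unfolding gap_def C_def[symmetric]
      by (simp add: field_simps)
    then show ?thesis
      using inner_root_norm[OF w_Re[OF z(1) mk(1)] w_Im_nonneg[OF z(1) mk(1)] \<eta> w_norm[OF z(1) mk(2)], of k] by linarith
  qed
  have lip: "(1 + B / \<eta>) * norm (w (Suc (m + k)) z - w (m + k) z) \<le> L * (step_size (m + k - 1) + step_size (m + k))" for k
  proof -
    have "(1 + B / \<eta>) * norm (w (Suc (m + k)) z - w (m + k) z)
        \<le> (1 + B / \<eta>) * ((1 / c0 + (Z + K) * K / c0 ^ 3) * (step_size (m + k - 1) + step_size (m + k)))"
      using w_diff[OF z(1) mk(2)] const_pos by (intro mult_left_mono) auto
    also have "\<dots> \<le> L * (step_size (m + k - 1) + step_size (m + k))"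
    proof -
      have "(1 + B / \<eta>) * (1 / c0 + (Z + K) * K / c0 ^ 3) \<le> L" using c0 by (simp add: L_def)
      then show ?thesis unfolding mult.assoc[symmetric] by (rule mult_right_mono) (simp add: step_size_nonneg)
    qed
    finally show ?thesis .
  qed
  have gL: "step_size j / c0 \<le> L * (step_size (m + k - 1) + step_size (m + k))" if "j = m + k - 1 \<or> j = m + k" for j k
  proof -
    have "1 / c0 \<le> L" unfolding L_def using const_pos c0 K_pos by simp
    then have "1 / c0 * step_size j \<le> L * (step_size (m + k - 1) + step_size (m + k))"
      using that step_size_nonneg[of "m + k - 1"] step_size_nonneg[of "m + k"] const_pos by (intro mult_mono) auto
    then show ?thesis by simp
  qed
  show ?thesis
  proof unfold_locales
    fix k
    show "lam (m + k) z * zet (m + k) z = 1" by (rule outer_inner_mult)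
    show "scaled_ratio (m + Suc k) z = lam (m + Suc k) z + zet (m + Suc k) z - of_real (sqrt_ratio (m + Suc k) / sqrt_ratio (m + k)) / scaled_ratio (m + k) z"
      using scaled_ratio_rec[OF z(2) mk(2)] by (simp add: outer_inner_add)
    show "0 < Im (scaled_ratio (m + k) z)"
      using less_le_trans[OF z(2) r_im[OF z(2) mk(3)]] alpha_bounds(3)[OF mk(2)] by (simp add: scaled_ratio_def Im_divide_of_real)
    show "Im (zet (m + k) z) \<le> - c"
      using inner_root_Im[OF w_Re[OF z(1) mk(1)] w_Im_nonneg[OF z(1) mk(1)] \<eta> w_norm[OF z(1) mk(2)]] by (simp add: c_def C_def)
    show "0 \<le> Im (lam (m + k) z)"
      using outer_root_Im[OF w_Re[OF z(1) mk(1)] w_Im_nonneg[OF z(1) mk(1)] \<eta> w_norm[OF z(1) mk(2)], of k] \<eta> by linarith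
    show "norm (lam (m + k) z) \<le> C"
      using outer_root_norm[OF w_Re[OF z(1) mk(1)] w_Im_nonneg[OF z(1) mk(1)] \<eta> w_norm[OF z(1) mk(2)]] by (simp add: C_def)
    show "(norm (zet (m + k) z))\<^sup>2 \<le> 1 - gap z" by (rule zz)
    show "norm (zet (m + Suc k) z - zet (m + k) z) \<le> L * (step_size (m + k - 1) + step_size (m + k))"
      using roots_lipschitz(2)[OF w_Re[OF z(1), of "Suc (m + k)"] w_Re[OF z(1) mk(1)] \<eta> w_norm[OF z(1), of "Suc (m + k)"] w_norm[OF z(1) mk(2)]] lip m
      by (auto intro: order_trans)
    show "norm (lam (m + Suc k) z - lam (m + k) z) \<le> L * (step_size (m + k - 1) + step_size (m + k))"
      using roots_lipschitz(1)[OF w_Re[OF z(1), of "Suc (m + k)"] w_Re[OF z(1) mk(1)] \<eta> w_norm[OF z(1), of "Suc (m + k)"] w_norm[OF z(1) mk(2)]] lip m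
      by (auto intro: order_trans)
    show "\<bar>sqrt_ratio (m + k) - 1\<bar> \<le> L * (step_size (m + k - 1) + step_size (m + k))"
      using sqrt_ratio_bound(1)[OF mk(2)] gL[of "m + k - 1" k] by (auto intro: order_trans)
    show "\<bar>sqrt_ratio (m + Suc k) - 1\<bar> \<le> L * (step_size (m + k - 1) + step_size (m + k))"
      using sqrt_ratio_bound(1)[of "m + Suc k"] gL[of "m + k" k] m by (auto intro: order_trans)
    show "L * (step_size (m + k - 1) + step_size (m + k)) \<le> c / (16 * C)" using small mk(1) by simp
    show "(\<Sum>n<k. (L * (step_size (m + n - 1) + step_size (m + n)))\<^sup>2) \<le> S0" by (rule sumd)
    show "0 < c" "c \<le> 1" "1 \<le> C" using const_pos by auto
    show "0 < gap z" by (rule qz)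
    show "gap z \<le> 1" using zz[of 0] zero_le_power2[of "norm (zet (m + 0) z)"] by linarith
  qed
qed

definition step_factor :: "nat \<Rightarrow> complex \<Rightarrow> complex" where
  "step_factor k z = (scaled_ratio (m + k) z - of_real (sqrt_ratio (m + Suc k) / sqrt_ratio (m + k)) * zet (m + Suc k) z) / (scaled_ratio (m + k) z - zet (m + k) z)"

definition log_const :: real where "log_const = perturbed_recursion.Ln_F_const c C S0 * (K * C)"

lemma step_factor_facts:
  assumes z: "z \<in> strip" "0 < Im z"
  shows "step_factor k z \<noteq> 0" "0 < Re (step_factor k z)" "norm (\<Sum>k<M. Ln (step_factor k z)) \<le> log_const / Im z"
    "scaled_ratio (m + k) z = lam (m + Suc k) z * step_factor k z * (scaled_ratio (m + k) z - zet (m + k) z) / (scaled_ratio (m + Suc k) z - zet (m + Suc k) z)"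
    "c \<le> Im (scaled_ratio (m + k) z - zet (m + k) z)" "norm (zet (m + k) z) \<le> 1"
proof -
  interpret p: perturbed_recursion "\<lambda>k. lam (m + k) z" "\<lambda>k. zet (m + k) z" "\<lambda>k. scaled_ratio (m + k) z" "\<lambda>k. sqrt_ratio (m + k)"
     "\<lambda>k. L * (step_size (m + k - 1) + step_size (m + k))" "gap z" c C S0 by (rule perturbed[OF z])
  have F: "p.F k = step_factor k z" for k by (simp add: p.F_def p.bet_def step_factor_def)
  show "step_factor k z \<noteq> 0" "0 < Re (step_factor k z)" using p.F_nz p.F_Re_pos by (simp_all add: F)
  show "norm (\<Sum>k<M. Ln (step_factor k z)) \<le> log_const / Im z"
    using p.Ln_F_sum[of M] by (simp add: F log_const_def gap_def)
  show "scaled_ratio (m + k) z = lam (m + Suc k) z * step_factor k z * (scaled_ratio (m + k) z - zet (m + k) z) / (scaled_ratio (m + Suc k) z - zet (m + Suc k) z)"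
    using p.tau_eq[of k] by (simp add: F)
  show "c \<le> Im (scaled_ratio (m + k) z - zet (m + k) z)" using p.tau_pos[of k] p.zet_im[of k] by simp
  show "norm (zet (m + k) z) \<le> 1" by (rule p.zet_norm)
qed

text \<open>A sum of principal logarithms, not the logarithm of a product: the summands have
  arguments in the upper or right half plane and are holomorphic, whereas the argument of the
  product may wind as M grows. The first sum is the initial segment of indices below m, where the
  coefficients are not controlled.\<close>

definition log_quotient :: "nat \<Rightarrow> complex \<Rightarrow> complex" where
  "log_quotient M z = (\<Sum>n=1..<m. Ln (r n z)) + (\<Sum>k<M. Ln (step_factor k z)) + Ln (scaled_ratio m z - zet m z)
     - Ln (scaled_ratio (m + M) z - zet (m + M) z) + Ln (r (m + M) z + \<i>)"

definition scale :: "nat \<Rightarrow> real" where "scale M = (\<Prod>k<M. sqrt_ratio (m + k)) / (\<Prod>n=1..<m. a n)"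

lemma scale_pos: "0 < scale M"
  unfolding scale_def using sqrt_ratio_bound(2) a_pos m by (intro divide_pos_pos prod_pos) auto

text \<open>The product of the \<open>sqrt_ratio\<close> telescopes to the root of a single quotient
  of two coefficients, so it stays between fixed bounds for all M.\<close>

lemma scale_ln_bound: "\<exists>A. \<forall>M. \<bar>ln (scale M)\<bar> \<le> A"
proof -
  define p where "p = (\<Prod>n=1..<m. a n)"
  have p: "0 < p" unfolding p_def using a_pos by (intro prod_pos) auto
  have g: "(\<Prod>k<M. sqrt_ratio (m + k)) = sqrt (a (m - 1) / a (m + M - 1))" for M
  proof (induction M)
    case 0
    have "1 \<le> m - 1" using m by linarith
    then show ?case using a_pos[of "m - 1"] by simp
  next
    case (Suc M)
    have "1 \<le> m + M - 1" using m by linarith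
    then have "0 < a (m + M - 1)" by (rule a_pos)
    then have "sqrt (a (m - 1) / a (m + M - 1)) * sqrt_ratio (m + M) = sqrt (a (m - 1) / a (m + Suc M - 1))"
      unfolding sqrt_ratio_def real_sqrt_mult[symmetric] by simp
    then show ?case unfolding prod.lessThan_Suc Suc .
  qed
  have "\<bar>ln (scale M)\<bar> \<le> K / c0 + \<bar>ln p\<bar>" for M
  proof -
    let ?x = "a (m - 1)" and ?y = "a (m + M - 1)"
    have i: "1 \<le> m - 1" "1 \<le> m + M - 1" using m by linarith+
    have xy: "0 < ?x" "0 < ?y" "?x \<le> K" "?y \<le> K" "c0 \<le> ?x" "c0 \<le> ?y"
      using a_pos[OF i(1)] a_pos[OF i(2)] a_le[OF i(1)] a_le[OF i(2)] a_ge[OF i(1)] a_ge[OF i(2)] by auto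
    have "ln (scale M) = ln (?x / ?y) / 2 - ln p"
      unfolding scale_def g p_def[symmetric] using xy p by (simp add: ln_div ln_sqrt)
    moreover have "ln (?x / ?y) \<le> K / c0"
    proof -
      have "ln (?x / ?y) \<le> ?x / ?y" using ln_le_minus_one[of "?x / ?y"] xy by simp
      also have "\<dots> \<le> K / c0" using xy c0 by (intro frac_le) auto
      finally show ?thesis .
    qed
    moreover have "ln (?y / ?x) \<le> K / c0"
    proof -
      have "ln (?y / ?x) \<le> ?y / ?x" using ln_le_minus_one[of "?y / ?x"] xy by simp
      also have "\<dots> \<le> K / c0" using xy c0 by (intro frac_le) auto
      finally show ?thesis .
    qed
    moreover have "ln (?y / ?x) = - ln (?x / ?y)" using xy by (simp add: ln_div)
    moreover have "0 \<le> K / c0" using K_pos c0 by simp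
    ultimately show ?thesis by linarith
  qed
  then show ?thesis by blast
qed

text \<open>The ratios below m build \<open>P m\<close>; from there each step contributes a root, a
  correction and a telescoping difference by \<open>tau_eq\<close>. The last factor r + i turns the
  polynomial into \<open>Phi\<close>.\<close>

lemma exp_log_quotient:
  assumes z: "z \<in> strip" "0 < Im z"
  shows "Phi (m + M) z = exp (log_quotient M z) * of_real (scale M) * (\<Prod>k<M. lam (m + Suc k) z)"
proof -
  have Pm: "P (Suc n) z * (\<Prod>i=1..<Suc n. of_real (a i)) = (\<Prod>i=1..<Suc n. r i z)" for n
  proof (induction n)
    case (Suc n)
    have "P (Suc (Suc n)) z * of_real (a (Suc n)) = r (Suc n) z * P (Suc n) z"
      using P_nz[OF z(2), of "Suc n"] by (simp add: orth_ratio_def del: orth_poly.simps)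
    note st = this
    define A where "A = (\<Prod>i=1..<Suc n. complex_of_real (a i))"
    have "P (Suc (Suc n)) z * (\<Prod>i=1..<Suc (Suc n). of_real (a i)) = P (Suc (Suc n)) z * of_real (a (Suc n)) * A"
      by (simp add: A_def mult_ac del: orth_poly.simps)
    also have "\<dots> = r (Suc n) z * (P (Suc n) z * A)" unfolding st by (simp only: mult.assoc)
    also have "\<dots> = (\<Prod>i=1..<Suc (Suc n). r i z)" unfolding A_def Suc by (simp add: mult.commute)
    finally show ?case .
  qed simp
  have Pm': "P m z * of_real (\<Prod>i=1..<m. a i) = (\<Prod>i=1..<m. r i z)"
    using Pm[of "m - 1"] m by simp
  have PM: "P (m + M) z = P m z * of_real (\<Prod>k<M. sqrt_ratio (m + k)) * (\<Prod>k<M. scaled_ratio (m + k) z)"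
  proof (induction M)
    case (Suc M)
    show ?case using P_step_scaled_ratio[OF z(2), of "m + M"] m Suc by (simp add: mult_ac del: orth_poly.simps)
  qed simp
  have nzt: "scaled_ratio (m + k) z - zet (m + k) z \<noteq> 0" for k
    using step_factor_facts(5)[OF z, of k] const_pos by (metis less_le_trans less_irrefl zero_complex.sel(2))
  have T: "(\<Prod>k<M. scaled_ratio (m + k) z) = (\<Prod>k<M. lam (m + Suc k) z) * (\<Prod>k<M. step_factor k z)
      * (scaled_ratio m z - zet m z) / (scaled_ratio (m + M) z - zet (m + M) z)"
  proof (induction M)
    case 0
    then show ?case using nzt[of 0] by simp
  next
    case (Suc M)
    have "(l * f * y / u) * t = (l * l') * (f * f') * y / u'" if "t = l' * f' * u / u'" "u \<noteq> 0"
      for l f y u t l' f' u' :: complex using that by simp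
    from this[OF step_factor_facts(4)[OF z, of M] nzt[of M]] show ?case unfolding prod.lessThan_Suc Suc by simp
  qed
  have ez: "exp (Ln (r n z)) = r n z" if "1 \<le> n" for n
    using r_norm_ge[OF z(2) that] z(2) by (intro exp_Ln) auto
  have ri: "r (m + M) z + \<i> \<noteq> 0"
    using r_im[OF z(2), of "m + M"] m z(2) by (metis One_nat_def add.commute add_pos_pos complex.sel(2) imaginary_unit.sel(2) le_add1 less_irrefl less_le_trans order_trans plus_complex.sel(2) zero_complex.sel(2) zero_less_one one_le_numeral)
  have eP: "(\<Prod>n=1..<m. exp (Ln (r n z))) = (\<Prod>n=1..<m. r n z)" by (intro prod.cong) (auto simp: ez)
  have eF: "(\<Prod>k<M. exp (Ln (step_factor k z))) = (\<Prod>k<M. step_factor k z)" using step_factor_facts(1)[OF z] by simp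
  have "exp (log_quotient M z) = (\<Prod>n=1..<m. exp (Ln (r n z))) * (\<Prod>k<M. exp (Ln (step_factor k z))) * exp (Ln (scaled_ratio m z - zet m z))
     / exp (Ln (scaled_ratio (m + M) z - zet (m + M) z)) * exp (Ln (r (m + M) z + \<i>))"
    by (simp only: log_quotient_def exp_add exp_diff exp_sum finite_atLeastLessThan finite_lessThan)
  also have "\<dots> = (\<Prod>n=1..<m. r n z) * (\<Prod>k<M. step_factor k z) * (scaled_ratio m z - zet m z)
     / (scaled_ratio (m + M) z - zet (m + M) z) * (r (m + M) z + \<i>)"
    unfolding eP eF using nzt[of 0] nzt[of M] ri by simp
  finally have "exp (log_quotient M z) * of_real (scale M) * (\<Prod>k<M. lam (m + Suc k) z) =
     ((\<Prod>n=1..<m. r n z) / of_real (\<Prod>n=1..<m. a n)) * of_real (\<Prod>k<M. sqrt_ratio (m + k)) * (\<Prod>k<M. scaled_ratio (m + k) z) * (r (m + M) z + \<i>)"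
    unfolding T scale_def by (simp add: mult_ac)
  also have "(\<Prod>n=1..<m. r n z) / of_real (\<Prod>n=1..<m. a n) = P m z"
  proof -
    have "(\<Prod>n=1..<m. a n) \<noteq> 0" using a_pos by (simp add: less_imp_neq[symmetric])
    then have "complex_of_real (\<Prod>n=1..<m. a n) \<noteq> 0" by (simp only: of_real_eq_0_iff not_False_eq_True)
    then show ?thesis unfolding Pm'[symmetric] by (rule nonzero_mult_div_cancel_right)
  qed
  also have "P m z * of_real (\<Prod>k<M. sqrt_ratio (m + k)) * (\<Prod>k<M. scaled_ratio (m + k) z) * (r (m + M) z + \<i>) = Phi (m + M) z"
    using Phi_eq[of "m + M" z] P_nz[OF z(2), of "m + M"] m unfolding PM by simp
  finally show ?thesis ..
qed

lemma Re_log_quotient: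
  assumes z: "z \<in> strip" "0 < Im z"
  shows "Re (log_quotient M z) = ln (norm (Phi (m + M) z)) - (\<Sum>k<M. ln (norm (lam (m + Suc k) z))) - ln (scale M)"
proof -
  have l: "0 < norm (lam (m + Suc k) z)" for k using outer_inner_mult[of "w (m + Suc k) z"] by auto
  have "norm (Phi (m + M) z) = exp (Re (log_quotient M z)) * scale M * (\<Prod>k<M. norm (lam (m + Suc k) z))"
    using scale_pos[of M] by (simp add: exp_log_quotient[OF z] norm_mult prod_norm)
  then show ?thesis
    using l scale_pos[of M] by (simp add: ln_mult prod_pos ln_prod)
qed

text \<open>The sum over k carries the estimate for the perturbed recursion; each of the finitely
  many other logarithms has an argument of modulus between multiples of Im z and of 1 / Im z. The
  constant is uniform in M.\<close>

lemma log_quotient_bound: "\<exists>A. \<forall>M z. z \<in> strip \<longrightarrow> 0 < Im z \<longrightarrow> norm (log_quotient M z) \<le> A / Im z"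
proof -
  define Y where "Y = R + 1"
  define Q where "Q = (Z + K) * Y + K\<^sup>2"
  define A1 A2 A3 where "A1 = Q + 1 / 1 + 4 * Y" and "A2 = (Q / c0 + Y) + 1 / (c / Y) + 4 * Y" and "A3 = (Q + Y) + 1 / (1 / Y) + 4 * Y"
  have Y: "0 < Y" using R by (simp add: Y_def)
  have "norm (log_quotient M z) \<le> (real m * A1 + log_const + A2 + A2 + A3) / Im z" if z: "z \<in> strip" "0 < Im z" for M z
  proof -
    have y: "0 < Im z" "Im z \<le> Y" using z by (auto simp: strip_def Y_def)
    have rQ: "norm (r n z) \<le> Q / Im z" if "1 \<le> n" for n
    proof -
      have "norm (r n z) \<le> Z + K + K\<^sup>2 / Im z" using r_norm_le[OF z(2) that] strip_norm[OF z(1)] by linarith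
      also have "Z + K \<le> (Z + K) * Y / Im z" using y const_pos K_pos by (simp add: pos_le_divide_eq)
      finally show ?thesis by (simp add: Q_def add_divide_distrib)
    qed
    have Yy: "t \<le> t * Y / Im z" if "0 \<le> t" for t using y that by (simp add: pos_le_divide_eq mult_left_mono)
    have 1: "norm (Ln (r n z)) \<le> A1 / Im z" if "1 \<le> n" for n
      unfolding A1_def using r_norm_ge[OF z(2) that] r_im[OF z(2) that] y rQ[OF that]
      by (intro norm_Ln_upper) auto
    have 2: "norm (Ln (scaled_ratio (m + k) z - zet (m + k) z)) \<le> A2 / Im z" for k
      unfolding A2_def
    proof (rule norm_Ln_upper[OF _ y])
      have mk: "2 \<le> m + k" "1 \<le> m + k" using m by auto
      have cI: "c \<le> Im (scaled_ratio (m + k) z - zet (m + k) z)" by (rule step_factor_facts(5)[OF z])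
      then show "0 < Im (scaled_ratio (m + k) z - zet (m + k) z)" using const_pos by linarith
      show "0 < c / Y" using const_pos Y by simp
      have "c / Y * Im z \<le> c" using y Y const_pos by (simp add: pos_divide_le_eq)
      then show "c / Y * Im z \<le> norm (scaled_ratio (m + k) z - zet (m + k) z)"
        using cI abs_Im_le_cmod[of "scaled_ratio (m + k) z - zet (m + k) z"] by linarith
      have "norm (scaled_ratio (m + k) z) \<le> (Q / Im z) / c0"
        unfolding scaled_ratio_def norm_divide using rQ[OF mk(2)] order_trans[OF norm_ge_zero rQ[OF mk(2)]] alpha_bounds[OF mk(1)] c0 by (intro frac_le) auto
      then have "norm (scaled_ratio (m + k) z - zet (m + k) z) \<le> Q / c0 / Im z + 1"
        using norm_triangle_ineq4[of "scaled_ratio (m + k) z" "zet (m + k) z"] step_factor_facts(6)[OF z, of k] by (simp add: mult.commute)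
      then show "norm (scaled_ratio (m + k) z - zet (m + k) z) \<le> (Q / c0 + Y) / Im z" using Yy[of 1] by (simp add: add_divide_distrib)
    qed
    have 3: "norm (Ln (r (m + M) z + \<i>)) \<le> A3 / Im z"
      unfolding A3_def
    proof (rule norm_Ln_upper[OF _ y])
      have mk: "1 \<le> m + M" using m by auto
      have I: "1 \<le> Im (r (m + M) z + \<i>)" using r_im[OF z(2) mk] y by simp
      then show "0 < Im (r (m + M) z + \<i>)" by linarith
      show "0 < 1 / Y" using Y by simp
      have "1 / Y * Im z \<le> 1" using y Y by (simp add: pos_divide_le_eq)
      then show "1 / Y * Im z \<le> norm (r (m + M) z + \<i>)" using I abs_Im_le_cmod[of "r (m + M) z + \<i>"] by linarith
      show "norm (r (m + M) z + \<i>) \<le> (Q + Y) / Im z"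
        using norm_triangle_ineq[of "r (m + M) z" \<i>] rQ[OF mk] Yy[of 1] by (simp add: add_divide_distrib)
    qed
    have A1: "0 \<le> A1 / Im z" using 1[of 1] norm_ge_zero order_trans by blast
    have "norm (\<Sum>n=1..<m. Ln (r n z)) \<le> (\<Sum>n=1..<m. A1 / Im z)" by (rule sum_norm_le) (use 1 in auto)
    also have "\<dots> = real (m - 1) * (A1 / Im z)" by simp
    also have "\<dots> \<le> real m * (A1 / Im z)" using A1 by (intro mult_right_mono) auto
    finally have s: "norm (\<Sum>n=1..<m. Ln (r n z)) \<le> real m * (A1 / Im z)" .
    have tri: "norm (e1 + e2 + e3 - e4 + e5) \<le> norm e1 + norm e2 + norm e3 + norm e4 + norm e5" for e1 e2 e3 e4 e5 :: complex
      by (intro order_trans[OF norm_triangle_ineq] order_trans[OF norm_triangle_ineq4] add_mono order_refl)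
    have "norm (log_quotient M z) \<le> real m * (A1 / Im z) + log_const / Im z + A2 / Im z + A2 / Im z + A3 / Im z"
      unfolding log_quotient_def using s step_factor_facts(3)[OF z, where M = M] 2[of 0] 2[of M] 3
      by (intro order_trans[OF tri] add_mono) auto
    then show ?thesis by (simp add: add_divide_distrib)
  qed
  then show ?thesis by blast
qed

lemma w_slit:
  assumes "z \<in> strip" "m \<le> n" shows "1 - (w n z)\<^sup>2 \<notin> \<real>\<^sub>\<le>\<^sub>0"
proof
  assume "1 - (w n z)\<^sup>2 \<in> \<real>\<^sub>\<le>\<^sub>0"
  then have "Re (1 - (w n z)\<^sup>2) \<le> 0" by (simp only: complex_nonpos_Reals_iff)
  then show False using csqrt_facts(1)[OF w_Re[OF assms] \<eta>] \<eta> by linarith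
qed

lemma holomorphic_w: "2 \<le> n \<Longrightarrow> (\<lambda>z. w n z) holomorphic_on S"
  unfolding w_def using alpha_bounds[of n] by (intro holomorphic_intros) auto

lemma holomorphic_csqrt_w: "m \<le> n \<Longrightarrow> S \<subseteq> strip \<Longrightarrow> (\<lambda>z. csqrt (1 - (w n z)\<^sup>2)) holomorphic_on S"
  using w_slit m by (intro holomorphic_intros holomorphic_w) auto

lemma holomorphic_log_quotient: "log_quotient M holomorphic_on {z\<in>strip. 0 < Im z}"
proof -
  let ?S = "{z\<in>strip. 0 < Im z}"
  have hr: "(\<lambda>z. r n z) holomorphic_on ?S" if "1 \<le> n" for n
    unfolding orth_ratio_def using P_nz that by (intro holomorphic_intros) auto
  have ht: "(\<lambda>z. scaled_ratio (m + k) z) holomorphic_on ?S" for k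
    unfolding scaled_ratio_def using alpha_bounds[of "m + k"] m by (intro holomorphic_intros hr) auto
  have hz: "(\<lambda>z. zet (m + k) z) holomorphic_on ?S" for k
    unfolding inner_root_def using m by (intro holomorphic_intros holomorphic_csqrt_w holomorphic_w) auto
  have nzt: "scaled_ratio (m + k) z - zet (m + k) z \<noteq> 0" if "z \<in> ?S" for k z
    using step_factor_facts(5)[of z k] that const_pos by auto
  have hF: "(\<lambda>z. step_factor k z) holomorphic_on ?S" for k
    unfolding step_factor_def using ht[of k] hz[of k] hz[of "Suc k"] nzt by (intro holomorphic_intros) auto
  have slit: "v \<notin> \<real>\<^sub>\<le>\<^sub>0" if "0 < Im v" for v using that by (auto simp: complex_nonpos_Reals_iff)
  have i1: "0 < Im (r n z)" if "z \<in> ?S" "1 \<le> n" for n z using r_im[of z n] that by auto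
  have i2: "0 < Im (scaled_ratio (m + k) z - zet (m + k) z)" if "z \<in> ?S" for k z
    using step_factor_facts(5)[of z k] that const_pos by auto
  have i3: "0 < Im (r (m + M) z + \<i>)" if "z \<in> ?S" for z using i1[OF that, of "m + M"] m by simp
  have i4: "step_factor k z \<notin> \<real>\<^sub>\<le>\<^sub>0" if "z \<in> ?S" for k z using step_factor_facts(2)[of z k] that by (auto simp: complex_nonpos_Reals_iff)
  show ?thesis unfolding log_quotient_def
    using m i1 i2[of _ 0] i2[of _ M] i3 i4 hr ht[of 0] hz[of 0]
    by (intro holomorphic_intros hr ht hz hF) (auto intro!: slit)
qed

lemma shift_strip: "z \<in> upper_half_disc R \<Longrightarrow> 0 \<le> e \<Longrightarrow> e \<le> 1 \<Longrightarrow> z + Complex x0 e \<in> strip"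
  using abs_Re_le_cmod[of z] abs_Im_le_cmod[of z] by (auto simp: upper_half_disc_def strip_def)

text \<open>Lifting by e brings the closed half disc into the open upper half plane, and Im z times
  A / (Im z + e) is at most A, so the bound does not see e.\<close>

lemma log_quotient_integral:
  assumes A: "\<And>z. z \<in> strip \<Longrightarrow> 0 < Im z \<Longrightarrow> norm (log_quotient M z) \<le> A / Im z" and e: "0 < e" "e \<le> 1"
  shows "\<bar>integral {-R..R} (\<lambda>x. (R\<^sup>2 - x\<^sup>2) * Re (log_quotient M (of_real x + Complex x0 e)))\<bar> \<le> 2 * pi * R\<^sup>2 * A"
proof -
  let ?G = "\<lambda>z. log_quotient M (z + Complex x0 e)"
  have hol: "?G holomorphic_on upper_half_disc R"
    using e shift_strip
    by (intro holomorphic_on_compose_gen[OF _ holomorphic_log_quotient, unfolded o_def] holomorphic_intros) (auto simp: upper_half_disc_def)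
  have sub: "{z. 0 < Im z} \<inter> ball 0 R \<subseteq> upper_half_disc R" by (auto simp: upper_half_disc_def)
  have A0: "0 \<le> A"
  proof -
    have "Complex x0 1 \<in> strip" using R by (simp add: strip_def)
    from order_trans[OF norm_ge_zero A[OF this]] show ?thesis by simp
  qed
  have b: "Im z * norm (?G z) \<le> A" if z: "norm z = R" "0 \<le> Im z" for z
  proof -
    have "z + Complex x0 e \<in> strip" using z e by (intro shift_strip) (auto simp: upper_half_disc_def)
    then have "norm (?G z) \<le> A / (Im z + e)" using A[of "z + Complex x0 e"] z e by simp
    then have "Im z * norm (?G z) \<le> Im z * (A / (Im z + e))" using z by (intro mult_left_mono)
    also have "\<dots> = A * (Im z / (Im z + e))" by simp
    also have "\<dots> \<le> A * 1" using A0 z e by (intro mult_left_mono) auto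
    finally show ?thesis by simp
  qed
  note hd = half_disc_mean_bound[OF R holomorphic_on_imp_continuous_on[OF hol] holomorphic_on_subset[OF hol sub] b]
  let ?I = "integral {-R..R} (\<lambda>x. of_real (R\<^sup>2 - x\<^sup>2) * ?G (of_real x))"
  have split: "Re (of_real s * v) = s * Re v" for s v by simp
  have "integral {-R..R} (\<lambda>x. (R\<^sup>2 - x\<^sup>2) * Re (?G (of_real x))) = Re ?I"
    using has_integral_Re[OF hd(1)] unfolding split by (rule integral_unique)
  then show ?thesis using abs_Re_le_cmod[of ?I] hd(2) by simp
qed

text \<open>The real part of \<open>log_quotient\<close> plus ln (\<open>scale M\<close>), written
  so that it remains defined and continuous at height e = 0, where the ratios \<open>r n\<close> may
  have poles.\<close>

definition log_modulus :: "nat \<Rightarrow> real \<Rightarrow> real \<Rightarrow> real" where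
  "log_modulus M e x = ln (norm (Phi (m + M) (of_real x + Complex x0 e))) - (\<Sum>k<M. ln (norm (lam (m + Suc k) (of_real x + Complex x0 e))))"

lemma continuous_log_modulus: "continuous_on ({0..1} \<times> {-R..R}) (\<lambda>(e, x). log_modulus M e x)"
proof -
  let ?S = "{0..1} \<times> {-R..R}"
  let ?z = "\<lambda>p :: real \<times> real. of_real (snd p) + Complex x0 (fst p)"
  have z_eq: "?z = (\<lambda>p. of_real (snd p) + (of_real x0 + \<i> * of_real (fst p)))"
    by (auto simp: complex_eq_iff)
  have cz: "continuous_on ?S ?z"
    unfolding z_eq by (intro continuous_intros)
  have z_strip: "?z p \<in> strip" if "p \<in> ?S" for p
    using that by (auto simp: strip_def)
  have cl: "continuous_on ?S (\<lambda>p. lam n (?z p))" if n: "m \<le> n" for n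
  proof -
    have cw: "continuous_on ?S (\<lambda>p. w n (?z p))"
      unfolding w_def using alpha_bounds[of n] m n by (intro continuous_intros cz) auto
    have "continuous_on ?S (\<lambda>p. csqrt (1 - (w n (?z p))\<^sup>2))"
      by (rule continuous_on_compose2[OF holomorphic_on_imp_continuous_on[OF holomorphic_on_csqrt]])
         (use w_slit[OF z_strip n] in \<open>auto intro!: continuous_intros cw\<close>)
    then show ?thesis unfolding outer_root_def by (intro continuous_intros cw)
  qed
  have "continuous_on ?S (\<lambda>p. log_modulus M (fst p) (snd p))"
    unfolding log_modulus_def
  proof (intro continuous_intros cz cl)
    show "\<forall>p\<in>?S. norm (Phi (m + M) (?z p)) \<noteq> 0"
    proof
      fix p :: "real \<times> real" assume "p \<in> ?S"
      then have "0 \<le> Im (?z p)" by auto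
      then show "norm (Phi (m + M) (?z p)) \<noteq> 0" using Phi_nz[of "?z p" "m + M"] m by simp
    qed
    show "\<forall>p\<in>?S. norm (lam (m + Suc i) (?z p)) \<noteq> 0" for i
      using outer_inner_mult by (metis mult_zero_left norm_eq_zero zero_neq_one)
  qed auto
  then show ?thesis by (simp add: case_prod_unfold)
qed

lemma Phi_log_bound:
  "\<exists>A. \<forall>N\<ge>m. integral {-R..R} (\<lambda>x. (R\<^sup>2 - x\<^sup>2) * ln (Phi_sq N (x0 + x))) \<le> A"
proof -
  obtain A where A: "\<And>M z. z \<in> strip \<Longrightarrow> 0 < Im z \<Longrightarrow> norm (log_quotient M z) \<le> A / Im z" using log_quotient_bound by blast
  obtain B where B: "\<And>M. \<bar>ln (scale M)\<bar> \<le> B" using scale_ln_bound by blast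
  have W: "0 \<le> R\<^sup>2 - x\<^sup>2" "R\<^sup>2 - x\<^sup>2 \<le> R\<^sup>2" if "x \<in> {-R..R}" for x
    using that R abs_le_square_iff[of x R] by (auto simp: abs_le_iff)
  define J where "J M e = integral (cbox (-R) R) (\<lambda>x. (R\<^sup>2 - x\<^sup>2) * log_modulus M e x)" for M e
  have Jc: "continuous_on {0..1} (J M)" for M
    unfolding J_def
  proof (rule integral_continuous_on_param)
    have "continuous_on ({0..1} \<times> {-R..R}) (\<lambda>p. (R\<^sup>2 - (snd p)\<^sup>2) * (case p of (e, x) \<Rightarrow> log_modulus M e x))"
      by (intro continuous_intros continuous_log_modulus)
    then show "continuous_on ({0..1} \<times> cbox (-R) R) (\<lambda>(e, x). (R\<^sup>2 - x\<^sup>2) * log_modulus M e x)"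
      by (simp add: case_prod_unfold)
  qed
  have Jb: "J M e \<le> 2 * pi * R\<^sup>2 * A + 2 * R * (R\<^sup>2 * B)" if e: "0 < e" "e \<le> 1" for M e
  proof -
    have eq: "(R\<^sup>2 - x\<^sup>2) * log_modulus M e x = (R\<^sup>2 - x\<^sup>2) * Re (log_quotient M (of_real x + Complex x0 e)) + (R\<^sup>2 - x\<^sup>2) * ln (scale M)" if x: "x \<in> {-R..R}" for x
    proof -
      have "of_real x + Complex x0 e \<in> strip" using x e by (intro shift_strip) (auto simp: upper_half_disc_def)
      then show ?thesis using e by (simp add: Re_log_quotient log_modulus_def algebra_simps)
    qed
    have i1: "(\<lambda>x. (R\<^sup>2 - x\<^sup>2) * Re (log_quotient M (of_real x + Complex x0 e))) integrable_on {-R..R}"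
    proof (intro integrable_continuous_real continuous_intros)
      have "log_quotient M holomorphic_on {z\<in>strip. 0 < Im z}" by (rule holomorphic_log_quotient)
      show "continuous_on {-R..R} (\<lambda>x. log_quotient M (of_real x + Complex x0 e))"
        by (rule continuous_on_compose2[OF holomorphic_on_imp_continuous_on[OF \<open>log_quotient M holomorphic_on _\<close>]])
           (use e in \<open>auto intro!: continuous_intros shift_strip simp: upper_half_disc_def\<close>)
    qed
    have i2: "(\<lambda>x. (R\<^sup>2 - x\<^sup>2) * ln (scale M)) integrable_on {-R..R}"
      by (intro integrable_continuous_real continuous_intros)
    have "J M e = integral {-R..R} (\<lambda>x. (R\<^sup>2 - x\<^sup>2) * Re (log_quotient M (of_real x + Complex x0 e)) + (R\<^sup>2 - x\<^sup>2) * ln (scale M))"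
      unfolding J_def cbox_interval using eq by (intro Henstock_Kurzweil_Integration.integral_cong) auto
    also have "\<dots> = integral {-R..R} (\<lambda>x. (R\<^sup>2 - x\<^sup>2) * Re (log_quotient M (of_real x + Complex x0 e))) + integral {-R..R} (\<lambda>x. (R\<^sup>2 - x\<^sup>2) * ln (scale M))"
      by (rule Henstock_Kurzweil_Integration.integral_add[OF i1 i2])
    also have "integral {-R..R} (\<lambda>x. (R\<^sup>2 - x\<^sup>2) * ln (scale M)) \<le> integral {-R..R} (\<lambda>x. R\<^sup>2 * B)"
    proof (rule integral_le[OF i2])
      fix x assume x: "x \<in> {-R..R}"
      have "(R\<^sup>2 - x\<^sup>2) * ln (scale M) \<le> (R\<^sup>2 - x\<^sup>2) * B" using W[OF x] B[of M] by (intro mult_left_mono) auto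
      also have "\<dots> \<le> R\<^sup>2 * B" using W[OF x] B[of M] by (intro mult_right_mono) auto
      finally show "(R\<^sup>2 - x\<^sup>2) * ln (scale M) \<le> R\<^sup>2 * B" .
    qed auto
    also have "integral {-R..R} (\<lambda>x. R\<^sup>2 * B) = 2 * R * (R\<^sup>2 * B)" using R by (simp add: algebra_simps)
    finally show ?thesis using log_quotient_integral[OF A e, of M] by linarith
  qed
  \<comment> \<open>Integrals over the segment depend continuously on the height down to 0, and the
    bounds for e > 0 are uniform.\<close>
  have J0: "J M 0 \<le> 2 * pi * R\<^sup>2 * A + 2 * R * (R\<^sup>2 * B)" for M
  proof (rule LIMSEQ_le_const2)
    have "(\<lambda>k. 1 / real (Suc k)) \<longlonglongrightarrow> 0" by (intro LIMSEQ_Suc lim_const_over_n)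
    from continuous_on_tendsto_compose[OF Jc this]
    show "(\<lambda>k. J M (1 / real (Suc k))) \<longlonglongrightarrow> J M 0" by auto
    show "\<exists>N. \<forall>n\<ge>N. J M (1 / real (Suc n)) \<le> 2 * pi * R\<^sup>2 * A + 2 * R * (R\<^sup>2 * B)" using Jb by auto
  qed
  have "integral {-R..R} (\<lambda>x. (R\<^sup>2 - x\<^sup>2) * ln (Phi_sq (m + M) (x0 + x))) = 2 * J M 0" for M
  proof -
    have "(R\<^sup>2 - x\<^sup>2) * ln (Phi_sq (m + M) (x0 + x)) = 2 * ((R\<^sup>2 - x\<^sup>2) * log_modulus M 0 x)" if x: "x \<in> {-R..R}" for x
    proof -
      have z: "complex_of_real x + Complex x0 0 = of_real (x0 + x)" by (simp add: complex_eq_iff)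
      have z_strip: "complex_of_real (x0 + x) \<in> strip" using x R by (auto simp: strip_def)
      have l: "norm (lam n (of_real (x0 + x))) = 1" if "m \<le> n" for n
      proof (rule norm_outer_root_real)
        show "Im (w n (of_real (x0 + x))) = 0" by (simp add: w_def Im_divide_of_real del: of_real_mult)
        show "\<bar>Re (w n (of_real (x0 + x)))\<bar> \<le> 1" using w_Re[OF z_strip that] \<eta> by linarith
      qed
      have p: "0 < norm (Phi (m + M) (of_real (x0 + x)))" using Phi_nz[of "of_real (x0 + x)" "m + M"] m by simp
      have "log_modulus M 0 x = ln (norm (Phi (m + M) (of_real (x0 + x))))" unfolding log_modulus_def z by (simp add: l del: of_real_add)
      moreover have "ln (Phi_sq (m + M) (x0 + x)) = 2 * ln (norm (Phi (m + M) (of_real (x0 + x))))"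
        using p by (simp add: norm_Phi_of_real[symmetric] ln_realpow del: of_real_add)
      ultimately show ?thesis by simp
    qed
    then have "integral {-R..R} (\<lambda>x. (R\<^sup>2 - x\<^sup>2) * ln (Phi_sq (m + M) (x0 + x))) = integral {-R..R} (\<lambda>x. 2 * ((R\<^sup>2 - x\<^sup>2) * log_modulus M 0 x))"
      by (intro Henstock_Kurzweil_Integration.integral_cong) auto
    then show ?thesis by (simp add: J_def)
  qed
  note eq = this
  have "integral {-R..R} (\<lambda>x. (R\<^sup>2 - x\<^sup>2) * ln (Phi_sq N (x0 + x))) \<le> 2 * (2 * pi * R\<^sup>2 * A + 2 * R * (R\<^sup>2 * B))" if mN: "m \<le> N" for N
  proof -
    obtain M where N: "N = m + M" using le_Suc_ex[OF mN] by blast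
    show ?thesis unfolding N eq by (rule mult_left_mono[OF J0]) simp
  qed
  then show ?thesis by blast
qed

end

subsection \<open>Approximation by continuous functions\<close>

lemma integrable_finite_bounded:
  fixes g :: "real \<Rightarrow> real"
  assumes "sets M = sets borel" "finite_measure M" "g \<in> borel_measurable borel" "\<And>x. \<bar>g x\<bar> \<le> B"
  shows "integrable M g"
proof -
  interpret finite_measure M by fact
  show ?thesis
    by (rule integrable_const_bound[of _ B]) (use assms in \<open>auto simp: measurable_cong_sets[OF assms(1) refl]\<close>)
qed

text \<open>For an indicator, regularity gives a compact set inside and an open set outside whose
  measures differ by less than 2 d, and a Urysohn function between them errs only on their
  difference. Sums and dominated limits follow by integrable induction.\<close>

lemma L1_dense_continuous:
  fixes M :: "real measure" and f :: "real \<Rightarrow> real"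
  assumes sets: "sets M = sets borel" and fin: "finite_measure M" and f: "integrable M f"
  shows "\<forall>e>0. \<exists>g. continuous_on UNIV g \<and> integrable M g \<and> (\<integral>x. \<bar>f x - g x\<bar> \<partial>M) < e"
  using f
proof (induction rule: integrable_induct)
  case (base A c)
  interpret finite_measure M by fact
  have sp: "space M = UNIV" using sets_eq_imp_space_eq[OF sets] by simp
  show ?case
  proof (intro allI impI)
    fix e :: real assume e: "0 < e"
    define d where "d = e / (2 * (\<bar>c\<bar> + 1))"
    have d: "0 < d" using e by (simp add: d_def)
    have A: "A \<in> sets borel" using base sets by simp
    have reg: "emeasure M (space M) \<noteq> \<infinity>" by simp
    have eA: "emeasure M A = ennreal (measure M A)" by (simp add: emeasure_eq_measure)
    have "\<exists>C. C \<subseteq> A \<and> compact C \<and> measure M A - d < measure M C"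
    proof (cases "measure M A - d < 0")
      case True
      then show ?thesis by (intro exI[of _ "{}"]) auto
    next
      case False
      have "ennreal (measure M A - d) < emeasure M A" unfolding eA using False d by (simp add: ennreal_lessI)
      then obtain C where "C \<subseteq> A" "compact C" "ennreal (measure M A - d) < emeasure M C"
        unfolding inner_regular[OF sets reg A] less_SUP_iff by auto
      then show ?thesis using False by (auto simp: emeasure_eq_measure ennreal_less_iff)
    qed
    then obtain C where C: "C \<subseteq> A" "compact C" "measure M A - d < measure M C" by blast
    have "emeasure M A < ennreal (measure M A + d)" unfolding eA using d by (simp add: ennreal_lessI)
    then obtain U where "A \<subseteq> U" "open U" "emeasure M U < ennreal (measure M A + d)"
      unfolding outer_regular[OF sets reg A] INF_less_iff by auto
    then have U: "A \<subseteq> U" "open U" "measure M U < measure M A + d" by (auto simp: emeasure_eq_measure ennreal_less_iff)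
    obtain g :: "real \<Rightarrow> real" where g: "continuous_on UNIV g" "\<And>x. g x \<in> closed_segment 1 0" "\<And>x. g x = 1 \<longleftrightarrow> x \<in> C" "\<And>x. g x = 0 \<longleftrightarrow> x \<in> - U"
      by (rule Urysohn_strong[of C "- U" "1::real" 0]) (use C U compact_imp_closed in auto)
    have g01: "0 \<le> g x" "g x \<le> 1" for x using g(2)[of x] by (auto simp: closed_segment_eq_real_ivl)
    have gm: "g \<in> borel_measurable borel" using g(1) by (rule borel_measurable_continuous_onI)
    have gabs: "\<bar>g x\<bar> \<le> 1" for x using g01[of x] by linarith
    have gi: "integrable M g" by (rule integrable_finite_bounded[OF sets fin gm gabs])
    have meas: "C \<in> sets M" "U \<in> sets M" "A \<in> sets M" using C U A sets borel_compact[OF C(2)] by auto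
    have "(\<integral>x. \<bar>indicator A x *\<^sub>R c - c * g x\<bar> \<partial>M) \<le> (\<integral>x. \<bar>c\<bar> * indicator (U - C) x \<partial>M)"
    proof (rule integral_mono)
      show "integrable M (\<lambda>x. \<bar>indicat_real A x *\<^sub>R c - c * g x\<bar>)"
        using gi meas by (intro integrable_abs Bochner_Integration.integrable_diff integrable_scaleR_left integrable_mult_right)
          (auto simp: integrable_indicator_iff emeasure_eq_measure)
      show "integrable M (\<lambda>x. \<bar>c\<bar> * indicator (U - C) x)"
        using meas by (intro integrable_mult_right) (auto simp: integrable_indicator_iff emeasure_eq_measure)
      fix x
      have "indicator A x - g x = 0" if "x \<notin> U - C"
        using that g(3)[of x] g(4)[of x] C(1) U(1) by (cases "x \<in> C") (auto simp: indicator_def)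
      moreover have "\<bar>indicator A x - g x\<bar> \<le> 1" using g01[of x] by (auto simp: indicator_def)
      moreover have "indicat_real A x *\<^sub>R c - c * g x = c * (indicator A x - g x)" by (simp add: algebra_simps)
      ultimately show "\<bar>indicat_real A x *\<^sub>R c - c * g x\<bar> \<le> \<bar>c\<bar> * indicator (U - C) x"
        by (cases "x \<in> U - C") (auto simp: abs_mult mult_left_le)
    qed
    also have "\<dots> = \<bar>c\<bar> * measure M (U - C)" using meas by simp
    also have "measure M (U - C) = measure M U - measure M C" using C U meas by (intro finite_measure_Diff) auto
    also have "\<bar>c\<bar> * (measure M U - measure M C) \<le> \<bar>c\<bar> * (2 * d)" using C(3) U(3) by (intro mult_left_mono) auto
    also have "\<dots> < e" using e by (simp add: d_def field_simps)
    finally show "\<exists>g. continuous_on UNIV g \<and> integrable M g \<and> (\<integral>x. \<bar>indicator A x *\<^sub>R c - g x\<bar> \<partial>M) < e"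
      using g(1) gi by (intro exI[of _ "\<lambda>x. c * g x"]) (auto intro!: continuous_intros)
  qed
next
  case (add f g)
  show ?case
  proof (intro allI impI)
    fix e :: real assume e: "0 < e"
    then obtain f' g' where f': "continuous_on UNIV f'" "integrable M f'" "(\<integral>x. \<bar>f x - f' x\<bar> \<partial>M) < e / 2"
      and g': "continuous_on UNIV g'" "integrable M g'" "(\<integral>x. \<bar>g x - g' x\<bar> \<partial>M) < e / 2"
      using add.IH by (meson half_gt_zero)
    have "(\<integral>x. \<bar>f x + g x - (f' x + g' x)\<bar> \<partial>M) \<le> (\<integral>x. \<bar>f x - f' x\<bar> + \<bar>g x - g' x\<bar> \<partial>M)"
      using add f' g' by (intro integral_mono) auto
    also have "\<dots> = (\<integral>x. \<bar>f x - f' x\<bar> \<partial>M) + (\<integral>x. \<bar>g x - g' x\<bar> \<partial>M)" using add f' g' by simp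
    also have "\<dots> < e" using f' g' by simp
    finally show "\<exists>h. continuous_on UNIV h \<and> integrable M h \<and> (\<integral>x. \<bar>f x + g x - h x\<bar> \<partial>M) < e"
      using f' g' by (intro exI[of _ "\<lambda>x. f' x + g' x"]) (auto intro!: continuous_intros)
  qed
next
  case (lim f s)
  show ?case
  proof (intro allI impI)
    fix e :: real assume e: "0 < e"
    have "(\<lambda>i. \<integral>x. \<bar>f x - s i x\<bar> \<partial>M) \<longlonglongrightarrow> (\<integral>x. 0 \<partial>M)"
    proof (rule integral_dominated_convergence[where w = "\<lambda>x. 3 * \<bar>f x\<bar>"])
      show "AE x in M. (\<lambda>i. \<bar>f x - s i x\<bar>) \<longlonglongrightarrow> 0"
      proof (intro AE_I2)
        fix x assume "x \<in> space M"
        then have "(\<lambda>i. \<bar>f x - s i x\<bar>) \<longlonglongrightarrow> \<bar>f x - f x\<bar>" by (intro tendsto_intros lim.hyps(2))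
        then show "(\<lambda>i. \<bar>f x - s i x\<bar>) \<longlonglongrightarrow> 0" by simp
      qed
      show "AE x in M. norm \<bar>f x - s i x\<bar> \<le> 3 * \<bar>f x\<bar>" for i
      proof (intro AE_I2)
        fix x assume "x \<in> space M"
        from lim.hyps(3)[OF this, of i] show "norm \<bar>f x - s i x\<bar> \<le> 3 * \<bar>f x\<bar>" by simp
      qed
    qed (use lim in auto)
    then have "eventually (\<lambda>i. (\<integral>x. \<bar>f x - s i x\<bar> \<partial>M) < e / 2) sequentially"
      using e by (intro order_tendstoD(2)) auto
    then obtain i where i: "(\<integral>x. \<bar>f x - s i x\<bar> \<partial>M) < e / 2" by (auto simp: eventually_sequentially)
    obtain g where g: "continuous_on UNIV g" "integrable M g" "(\<integral>x. \<bar>s i x - g x\<bar> \<partial>M) < e / 2"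
      using lim.IH[of i] e by (meson half_gt_zero)
    have "(\<integral>x. \<bar>f x - g x\<bar> \<partial>M) \<le> (\<integral>x. \<bar>f x - s i x\<bar> + \<bar>s i x - g x\<bar> \<partial>M)"
      using lim.hyps(1,4) g by (intro integral_mono) auto
    also have "\<dots> = (\<integral>x. \<bar>f x - s i x\<bar> \<partial>M) + (\<integral>x. \<bar>s i x - g x\<bar> \<partial>M)" using lim.hyps(1,4) g by simp
    also have "\<dots> < e" using i g by simp
    finally show "\<exists>g. continuous_on UNIV g \<and> integrable M g \<and> (\<integral>x. \<bar>f x - g x\<bar> \<partial>M) < e" using g by blast
  qed
qed

text \<open>Adding Lebesgue measure on \<open>I\<close> to M makes one approximation good for both
  measures at once; \<mu> may be singular, so neither of the two controls the other.\<close>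

definition add_lebesgue :: "real measure \<Rightarrow> real set \<Rightarrow> real measure" where
  "add_lebesgue M I = measure_of UNIV (sets borel) (\<lambda>A. emeasure M A + emeasure lborel (A \<inter> I))"

lemma sets_add_lebesgue [simp, measurable_cong]: "sets (add_lebesgue M I) = sets borel"
  by (simp add: add_lebesgue_def sets_measure_of_conv) (metis sets.sigma_sets_eq space_borel)

lemma emeasure_add_lebesgue:
  assumes sets: "sets M = sets borel" and I: "I \<in> sets borel" and A: "A \<in> sets borel"
  shows "emeasure (add_lebesgue M I) A = emeasure M A + emeasure lborel (A \<inter> I)"
  unfolding add_lebesgue_def
proof (rule emeasure_measure_of_sigma[OF _ _ _ A])
  show "sigma_algebra UNIV (sets borel)" using sets.sigma_algebra_axioms[of borel] by simp
  show "positive (sets borel) (\<lambda>A. emeasure M A + emeasure lborel (A \<inter> I))" by (simp add: positive_def)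
  show "countably_additive (sets borel) (\<lambda>A. emeasure M A + emeasure lborel (A \<inter> I))"
  proof (rule countably_additiveI)
    fix X :: "nat \<Rightarrow> real set" assume X: "range X \<subseteq> sets borel" "disjoint_family X" "\<Union>(range X) \<in> sets borel"
    have "(\<Sum>i. emeasure M (X i) + emeasure lborel (X i \<inter> I)) = (\<Sum>i. emeasure M (X i)) + (\<Sum>i. emeasure lborel (X i \<inter> I))"
      by (rule suminf_add[symmetric]) auto
    also have "(\<Sum>i. emeasure M (X i)) = emeasure M (\<Union>(range X))"
      using X sets by (intro suminf_emeasure) auto
    also have "(\<Sum>i. emeasure lborel (X i \<inter> I)) = emeasure lborel (\<Union>i. X i \<inter> I)"
      using X I by (intro suminf_emeasure) (auto simp: disjoint_family_on_def)
    also have "(\<Union>i. X i \<inter> I) = \<Union>(range X) \<inter> I" by auto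
    finally show "(\<Sum>i. emeasure M (X i) + emeasure lborel (X i \<inter> I)) = emeasure M (\<Union>(range X)) + emeasure lborel (\<Union>(range X) \<inter> I)" .
  qed
qed

lemma L1_approx_pair:
  fixes M :: "real measure" and k :: "real \<Rightarrow> real"
  assumes sets: "sets M = sets borel" and fin: "finite_measure M" and I: "I \<in> sets borel" "emeasure lborel I < \<infinity>"
    and k: "k \<in> borel_measurable borel" "\<And>x. 1 \<le> k x" "\<And>x. k x \<le> B" and e: "0 < e"
  shows "\<exists>g. continuous_on UNIV g \<and> (\<forall>x. 1 \<le> g x \<and> g x \<le> B) \<and>
     (\<integral>x. \<bar>k x - g x\<bar> \<partial>M) \<le> e \<and> (LINT x:I|lborel. \<bar>k x - g x\<bar>) \<le> e"
proof -
  define N where "N = add_lebesgue M I"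
  have sN: "sets N = sets borel" by (simp add: N_def)
  have eN: "emeasure N A = emeasure M A + emeasure lborel (A \<inter> I)" if "A \<in> sets borel" for A
    unfolding N_def using emeasure_add_lebesgue[OF sets I(1) that] .
  interpret M: finite_measure M by fact
  have spN: "space N = UNIV" using sets_eq_imp_space_eq[OF sN] by simp
  have finN: "finite_measure N"
    using eN[of UNIV] I(2) M.emeasure_finite[of UNIV] by (intro finite_measureI) (simp add: spN less_top)
  have kb: "\<bar>k x\<bar> \<le> B" for x using k(2)[of x] k(3)[of x] by linarith
  have "integrable N k" by (rule integrable_finite_bounded[OF sN finN k(1) kb])
  from L1_dense_continuous[OF sN finN this] e
  obtain g0 where g0: "continuous_on UNIV g0" "integrable N g0" "(\<integral>x. \<bar>k x - g0 x\<bar> \<partial>N) < e" by blast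
  \<comment> \<open>Clipping to [1, B], where k already takes its values, can only decrease the
    distance to k.\<close>
  define g where "g x = max 1 (min B (g0 x))" for x
  have B1: "1 \<le> B" using k(2)[of 0] k(3)[of 0] by linarith
  have gc: "continuous_on UNIV g" unfolding g_def by (intro continuous_intros g0)
  have gb: "1 \<le> g x" "g x \<le> B" for x using B1 by (auto simp: g_def)
  have gm: "g \<in> borel_measurable borel" using gc by (rule borel_measurable_continuous_onI)
  have dm: "(\<lambda>x. \<bar>k x - g x\<bar>) \<in> borel_measurable borel" using k(1) gm by measurable
  have db: "\<bar>\<bar>k x - g x\<bar>\<bar> \<le> 2 * B" for x using k(2)[of x] k(3)[of x] gb[of x] by linarith
  have "\<bar>k x - g x\<bar> \<le> \<bar>k x - g0 x\<bar>" for x using k(2)[of x] k(3)[of x] by (auto simp: g_def)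
  then have "(\<integral>x. \<bar>k x - g x\<bar> \<partial>N) \<le> (\<integral>x. \<bar>k x - g0 x\<bar> \<partial>N)"
    using \<open>integrable N k\<close> g0(2) integrable_finite_bounded[OF sN finN dm db] by (intro integral_mono) auto
  then have le: "(\<integral>x. \<bar>k x - g x\<bar> \<partial>N) \<le> e" using g0(3) by linarith
  have nnN: "(\<integral>\<^sup>+x. ennreal \<bar>k x - g x\<bar> \<partial>N) \<le> ennreal e"
    using le integrable_finite_bounded[OF sN finN dm db] by (subst nn_integral_eq_integral) (auto intro: ennreal_leI)
  have "M \<le> N" using sets sN eN by (subst le_measure) auto
  then have "(\<integral>\<^sup>+x. ennreal \<bar>k x - g x\<bar> \<partial>M) \<le> ennreal e"
    using nn_integral_mono_measure[of M N] sets sN nnN by (metis order_trans)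
  then have 1: "(\<integral>x. \<bar>k x - g x\<bar> \<partial>M) \<le> e"
    using integrable_finite_bounded[OF sets fin dm db] e by (subst (asm) nn_integral_eq_integral) auto
  have "density lborel (indicator I) \<le> N"
  proof (subst le_measure)
    show "sets (density lborel (indicator I)) = sets N" using sN by simp
    show "\<forall>A\<in>sets (density lborel (indicator I)). emeasure (density lborel (indicator I)) A \<le> emeasure N A"
      using I eN by (auto simp: emeasure_density nn_integral_indicator indicator_inter_arith[symmetric] Int_commute)
  qed
  then have "(\<integral>\<^sup>+x. ennreal \<bar>k x - g x\<bar> \<partial>density lborel (indicator I)) \<le> ennreal e"
    using nn_integral_mono_measure[of "density lborel (indicator I)" N] sN nnN by (metis order_trans sets_density sets_lborel)
  then have "(\<integral>\<^sup>+x. indicator I x * ennreal \<bar>k x - g x\<bar> \<partial>lborel) \<le> ennreal e"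
    using I dm by (subst (asm) nn_integral_density) auto
  then have nI: "(\<integral>\<^sup>+x. ennreal (indicator I x *\<^sub>R \<bar>k x - g x\<bar>) \<partial>lborel) \<le> ennreal e"
    by (simp add: ennreal_mult' ennreal_indicator)
  have "integrable lborel (\<lambda>x. indicat_real I x *\<^sub>R \<bar>k x - g x\<bar>)"
    using nI dm I by (intro integrableI_bounded) (auto simp: order.strict_trans1 ennreal_less_top)
  then have 2: "(LINT x:I|lborel. \<bar>k x - g x\<bar>) \<le> e"
    unfolding set_lebesgue_integral_def using nI e by (subst (asm) nn_integral_eq_integral) auto
  show ?thesis using gc gb 1 2 by blast
qed

subsection \<open>Lower bounds for the entropy\<close>

lemma ln_diff_le: "1 \<le> x \<Longrightarrow> 1 \<le> y \<Longrightarrow> \<bar>ln x - ln y\<bar> \<le> \<bar>x - y\<bar>" for x y :: real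
proof -
  have "ln x - ln y \<le> \<bar>x - y\<bar>" if "1 \<le> x" "1 \<le> y" for x y :: real
  proof -
    have "ln x - ln y = ln (x / y)" using that by (simp add: ln_div)
    also have "\<dots> \<le> x / y - 1" using that by (intro ln_le_minus_one) auto
    also have "\<dots> = (x - y) / y" using that by (simp add: field_simps)
    also have "\<dots> \<le> \<bar>x - y\<bar> / 1" using that by (intro frac_le) auto
    finally show ?thesis by simp
  qed
  from this[of x y] this[of y x] show "1 \<le> x \<Longrightarrow> 1 \<le> y \<Longrightarrow> \<bar>ln x - ln y\<bar> \<le> \<bar>x - y\<bar>" by linarith
qed

lemma real_Weierstrass_poly:
  fixes f :: "real \<Rightarrow> real"
  assumes "compact S" "continuous_on S f" "0 < e"
  obtains p where "\<And>x. x \<in> S \<Longrightarrow> \<bar>f x - poly p x\<bar> < e"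
proof -
  obtain g where g: "real_polynomial_function g" "\<And>x. x \<in> S \<Longrightarrow> \<bar>f x - g x\<bar> < e"
    using Stone_Weierstrass_real_polynomial_function[OF assms] by blast
  obtain c n where "g = (\<lambda>x. \<Sum>i\<le>n. c i * x ^ i)" using g(1) real_polynomial_function_iff_sum by blast
  then have "g x = poly (\<Sum>i\<le>n. monom (c i) i) x" for x by (simp add: poly_sum poly_monom)
  then show ?thesis using g(2) that by metis
qed

section \<open>The entropy inequality for squares of polynomials, continuous functions, bounded
  measurable functions and finally truncations of 1/f\<close>

context jacobi_measure
begin

lemma quadrature_poly:
  obtains n where "\<And>N. 1 \<le> N \<Longrightarrow> n \<le> N \<Longrightarrow>
     integrable lborel (\<lambda>x. (poly p x)\<^sup>2 / Phi_sq N x) \<and>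
     (\<integral>x. (poly p x)\<^sup>2 / Phi_sq N x \<partial>lborel) \<le> 8 * pi * (\<integral>x. (poly p x)\<^sup>2 \<partial>\<mu>)"
proof -
  obtain n c where p: "\<And>x. poly p x = (\<Sum>j=1..n. c j * P j x)"
    using in_span_poly[of p] unfolding in_span_def by blast
  show ?thesis
  proof (rule that[of n], unfold p integral_square_span)
    fix N assume "1 \<le> N" "n \<le> N"
    then show "integrable lborel (\<lambda>x. (\<Sum>j=1..n. c j * P j x)\<^sup>2 / Phi_sq N x) \<and>
        (\<integral>x. (\<Sum>j=1..n. c j * P j x)\<^sup>2 / Phi_sq N x \<partial>lborel) \<le> 8 * pi * (\<Sum>j=1..n. (c j)\<^sup>2)"
      using quadrature by blast
  qed
qed

lemma integrable_poly_sq: "integrable \<mu> (\<lambda>x. (poly p x)\<^sup>2)"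
proof -
  have "(\<lambda>x. (poly p x)\<^sup>2) = poly (p * p)" by (simp add: fun_eq_iff power2_eq_square)
  then show ?thesis using integrable_poly by metis
qed

definition mass_total :: real where "mass_total = measure \<mu> UNIV"

context
  fixes x0 R A :: real and m :: nat
  assumes R: "0 < R" and m: "1 \<le> m"
    and A: "\<And>N. m \<le> N \<Longrightarrow> integral {-R..R} (\<lambda>x. (R\<^sup>2 - x\<^sup>2) * ln (Phi_sq N (x0 + x))) \<le> A"
begin

abbreviation window :: "real set" where "window \<equiv> {x0 - R..x0 + R}"
abbreviation W :: "real \<Rightarrow> real" where "W x \<equiv> R\<^sup>2 - (x - x0)\<^sup>2"

lemma W_bounds: "x \<in> window \<Longrightarrow> 0 \<le> W x" "W x \<le> R\<^sup>2"
proof -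
  show "W x \<le> R\<^sup>2" by simp
  assume "x \<in> window"
  then have "\<bar>x - x0\<bar> \<le> \<bar>R\<bar>" by (auto simp: abs_le_iff)
  then show "0 \<le> W x" by (simp add: abs_le_square_iff)
qed

lemma log_Phi_bound:
  assumes N: "m \<le> N"
  shows "(LINT x:window|lborel. W x * ln (Phi_sq N x)) \<le> A" "set_integrable lborel window (\<lambda>x. W x * ln (Phi_sq N x))"
proof -
  have N1: "1 \<le> N" using N m by simp
  have c: "continuous_on S (\<lambda>x. W x * ln (Phi_sq N x))" for S
    using Phi_sq_pos[OF N1] by (intro continuous_intros) (auto simp: less_imp_neq[symmetric])
  show i: "set_integrable lborel window (\<lambda>x. W x * ln (Phi_sq N x))" by (rule borel_integrable_atLeastAtMost'[OF c])
  have "(LINT x:window|lborel. W x * ln (Phi_sq N x)) = integral window (\<lambda>x. W x * ln (Phi_sq N x))"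
    by (rule set_borel_integral_eq_integral(2)[OF i])
  also have "\<dots> = integral {-R..R} ((\<lambda>x. W x * ln (Phi_sq N x)) \<circ> ((+) x0))"
    unfolding integral_shift_Icc_real by (simp add: add.commute)
  also have "\<dots> = integral {-R..R} (\<lambda>x. (R\<^sup>2 - x\<^sup>2) * ln (Phi_sq N (x0 + x)))" by (simp add: o_def)
  finally show "(LINT x:window|lborel. W x * ln (Phi_sq N x)) \<le> A" using A[OF N] by simp
qed

text \<open>Apply ln h \<le> h to h = (p^2 + e^2) / |Phi_N|^2. The constant e^2 keeps the logarithm
  finite at zeros of p, and it is the square of the constant polynomial e, so the quadrature bound
  covers it too. The index N is chosen after p, and for this the bound \<open>A\<close> has to be
  uniform in N.\<close>

lemma poly_log_bound:
  assumes e: "0 < e"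
  shows "(LINT x:window|lborel. W x * ln ((poly p x)\<^sup>2 + e\<^sup>2)) \<le> R\<^sup>2 * (8 * pi) * ((\<integral>x. (poly p x)\<^sup>2 \<partial>\<mu>) + e\<^sup>2 * mass_total) + A"
proof -
  obtain n1 where n1: "\<And>N. 1 \<le> N \<Longrightarrow> n1 \<le> N \<Longrightarrow> integrable lborel (\<lambda>x. (poly p x)\<^sup>2 / Phi_sq N x) \<and>
     (\<integral>x. (poly p x)\<^sup>2 / Phi_sq N x \<partial>lborel) \<le> 8 * pi * (\<integral>x. (poly p x)\<^sup>2 \<partial>\<mu>)" using quadrature_poly[of p] by blast
  obtain n2 where n2: "\<And>N. 1 \<le> N \<Longrightarrow> n2 \<le> N \<Longrightarrow> integrable lborel (\<lambda>x. (poly [:e:] x)\<^sup>2 / Phi_sq N x) \<and>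
     (\<integral>x. (poly [:e:] x)\<^sup>2 / Phi_sq N x \<partial>lborel) \<le> 8 * pi * (\<integral>x. (poly [:e:] x)\<^sup>2 \<partial>\<mu>)" using quadrature_poly[of "[:e:]"] by blast
  define N where "N = max m (max n1 n2)"
  have N: "m \<le> N" "1 \<le> N" "n1 \<le> N" "n2 \<le> N" using m by (auto simp: N_def)
  define h where "h x = ((poly p x)\<^sup>2 + e\<^sup>2) / Phi_sq N x" for x
  have hi: "integrable lborel h" unfolding h_def add_divide_distrib using n1[OF N(2,3)] n2[OF N(2,4)] by simp
  have hb: "(\<integral>x. h x \<partial>lborel) \<le> 8 * pi * ((\<integral>x. (poly p x)\<^sup>2 \<partial>\<mu>) + e\<^sup>2 * mass_total)"
  proof -
    have eq: "(\<integral>x. h x \<partial>lborel) = (\<integral>x. (poly p x)\<^sup>2 / Phi_sq N x \<partial>lborel) + (\<integral>x. (poly [:e:] x)\<^sup>2 / Phi_sq N x \<partial>lborel)"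
      unfolding h_def add_divide_distrib using n1[OF N(2,3)] n2[OF N(2,4)] by simp
    have t: "(\<integral>x. (poly [:e:] x)\<^sup>2 \<partial>\<mu>) = e\<^sup>2 * mass_total" by (simp add: mass_total_def mult.commute)
    show ?thesis
      unfolding eq distrib_left using conjunct2[OF n1[OF N(2,3)]] conjunct2[OF n2[OF N(2,4)]] unfolding t
      by (rule add_mono)
  qed
  have h0: "0 \<le> h x" for x using Phi_sq_pos[OF N(2), of x] by (simp add: h_def)
  have ep: "0 < (poly p x)\<^sup>2 + e\<^sup>2" for x using e by (simp add: add_nonneg_pos)
  have cl: "continuous_on S (\<lambda>x. W x * ln ((poly p x)\<^sup>2 + e\<^sup>2))" for S
    using ep by (intro continuous_intros) (auto simp: less_imp_neq[symmetric])
  have il: "set_integrable lborel window (\<lambda>x. W x * ln ((poly p x)\<^sup>2 + e\<^sup>2))" by (rule borel_integrable_atLeastAtMost'[OF cl])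
  have "(LINT x:window|lborel. W x * ln ((poly p x)\<^sup>2 + e\<^sup>2)) \<le> (\<integral>x. R\<^sup>2 * h x + indicator window x *\<^sub>R (W x * ln (Phi_sq N x)) \<partial>lborel)"
    unfolding set_lebesgue_integral_def
  proof (rule integral_mono)
    show "integrable lborel (\<lambda>x. indicat_real window x *\<^sub>R (W x * ln ((poly p x)\<^sup>2 + e\<^sup>2)))" using il by (simp add: set_integrable_def)
    show "integrable lborel (\<lambda>x. R\<^sup>2 * h x + indicat_real window x *\<^sub>R (W x * ln (Phi_sq N x)))"
      using hi log_Phi_bound(2)[OF N(1)] by (simp add: set_integrable_def)
    fix x
    show "indicat_real window x *\<^sub>R (W x * ln ((poly p x)\<^sup>2 + e\<^sup>2)) \<le> R\<^sup>2 * h x + indicat_real window x *\<^sub>R (W x * ln (Phi_sq N x))"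
    proof (cases "x \<in> window")
      case True
      have Pp: "0 < Phi_sq N x" by (rule Phi_sq_pos[OF N(2)])
      have hp: "0 < h x" unfolding h_def using ep Pp by (rule divide_pos_pos)
      have "ln ((poly p x)\<^sup>2 + e\<^sup>2) = ln (h x) + ln (Phi_sq N x)"
      proof -
        have "(poly p x)\<^sup>2 + e\<^sup>2 = h x * Phi_sq N x" using Pp by (simp add: h_def)
        then show ?thesis using hp Pp by (simp add: ln_mult)
      qed
      moreover have "ln (h x) \<le> h x" using ln_le_minus_one[OF hp] by linarith
      ultimately have "W x * ln ((poly p x)\<^sup>2 + e\<^sup>2) \<le> W x * (h x + ln (Phi_sq N x))"
        using W_bounds(1)[OF True] by (intro mult_left_mono) auto
      also have "\<dots> \<le> R\<^sup>2 * h x + W x * ln (Phi_sq N x)"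
        using W_bounds(2)[of x] h0[of x] by (simp only: distrib_left) (intro add_right_mono mult_right_mono, auto)
      finally show ?thesis using True by simp
    next
      case False
      then show ?thesis using h0[of x] by simp
    qed
  qed
  also have "\<dots> = R\<^sup>2 * (\<integral>x. h x \<partial>lborel) + (LINT x:window|lborel. W x * ln (Phi_sq N x))"
    using hi log_Phi_bound(2)[OF N(1)] by (simp add: set_integrable_def set_lebesgue_integral_def)
  also have "\<dots> \<le> R\<^sup>2 * (8 * pi * ((\<integral>x. (poly p x)\<^sup>2 \<partial>\<mu>) + e\<^sup>2 * mass_total)) + A"
    using hb log_Phi_bound(1)[OF N(1)] by (intro add_mono mult_left_mono) auto
  finally show ?thesis by (simp add: mult.assoc)
qed

definition w_total :: real where "w_total = (LINT x:window|lborel. W x)"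

lemma W_integrable: "set_integrable lborel window W"
  by (intro borel_integrable_atLeastAtMost' continuous_intros)

text \<open>The square root of k is approximated because \<open>poly_log_bound\<close> takes
  squares. As that root is at least 1, an additive error t is a relative one, so p^2 lies between (1
  - t)^2 k and (1 + t)^2 k; then t tends to 0.\<close>

lemma continuous_log_bound:
  assumes k: "continuous_on UNIV k" "\<And>x. 1 \<le> k x" "\<And>x. k x \<le> B"
  shows "(LINT x:window|lborel. W x * ln (k x)) \<le> R\<^sup>2 * (8 * pi) * (\<integral>x. k x \<partial>\<mu>) + A"
proof -
  \<comment> \<open>The interval has to contain the window, where logarithms are compared, and a set
    carrying \<mu>, where integrals are compared.\<close>
  define T where "T = max (3 * K + 1) (\<bar>x0\<bar> + R)"
  have IT: "window \<subseteq> {-T..T}" by (auto simp: T_def)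
  have kb: "\<bar>k x\<bar> \<le> B" for x using k(2)[of x] k(3)[of x] by linarith
  have km: "k \<in> borel_measurable borel" using k(1) by (rule borel_measurable_continuous_onI)
  have ki: "integrable \<mu> k" by (rule integrable_finite_bounded[OF sets_mu finite_measure_mu km kb])
  have lk: "set_integrable lborel window (\<lambda>x. W x * ln (k x))"
  proof (intro borel_integrable_atLeastAtMost' continuous_intros continuous_on_subset[OF k(1)])
    show "\<forall>x\<in>window. k x \<noteq> 0"
    proof
      fix x show "k x \<noteq> 0" using k(2)[of x] by linarith
    qed
  qed auto
  let ?rhs = "\<lambda>t. R\<^sup>2 * (8 * pi) * ((1 + t)\<^sup>2 * (\<integral>x. k x \<partial>\<mu>) + t\<^sup>2 * mass_total) + A - 2 * ln (1 - t) * w_total"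
  have le: "(LINT x:window|lborel. W x * ln (k x)) \<le> ?rhs t" if t: "0 < t" "t < 1" for t
  proof -
    have sk: "continuous_on {-T..T} (\<lambda>x. sqrt (k x))" by (intro continuous_intros continuous_on_subset[OF k(1)]) auto
    obtain p where p: "\<And>x. x \<in> {-T..T} \<Longrightarrow> \<bar>sqrt (k x) - poly p x\<bar> < t"
      using real_Weierstrass_poly[OF compact_Icc sk t(1)] by blast
    have pb: "(1 - t)\<^sup>2 * k x \<le> (poly p x)\<^sup>2" "(poly p x)\<^sup>2 \<le> (1 + t)\<^sup>2 * k x" if x: "x \<in> {-T..T}" for x
    proof -
      have s1: "1 \<le> sqrt (k x)" using k(2) by simp
      have ts: "t \<le> t * sqrt (k x)" using s1 t by simp
      have "(1 - t) * sqrt (k x) \<le> poly p x" "poly p x \<le> (1 + t) * sqrt (k x)"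
      proof -
        have "sqrt (k x) - t * sqrt (k x) \<le> poly p x" "poly p x \<le> sqrt (k x) + t * sqrt (k x)"
          using p[OF x] ts by linarith+
        then show "(1 - t) * sqrt (k x) \<le> poly p x" "poly p x \<le> (1 + t) * sqrt (k x)"
          by (simp_all only: left_diff_distrib distrib_right mult_1_left)
      qed
      moreover have "0 \<le> (1 - t) * sqrt (k x)" using t s1 by simp
      ultimately have "((1 - t) * sqrt (k x))\<^sup>2 \<le> (poly p x)\<^sup>2" "(poly p x)\<^sup>2 \<le> ((1 + t) * sqrt (k x))\<^sup>2"
        by (intro power_mono; linarith)+
      moreover have "(sqrt (k x))\<^sup>2 = k x" using k(2)[of x] by (intro real_sqrt_pow2) linarith
      ultimately show "(1 - t)\<^sup>2 * k x \<le> (poly p x)\<^sup>2" "(poly p x)\<^sup>2 \<le> (1 + t)\<^sup>2 * k x" by (simp_all add: power_mult_distrib)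
    qed
    have ep: "0 < (poly p x)\<^sup>2 + t\<^sup>2" for x using t by (simp add: add_nonneg_pos)
    have cl: "continuous_on S (\<lambda>x. W x * ln ((poly p x)\<^sup>2 + t\<^sup>2))" for S
      using ep by (intro continuous_intros) (auto simp: less_imp_neq[symmetric])
    have il: "set_integrable lborel window (\<lambda>x. W x * ln ((poly p x)\<^sup>2 + t\<^sup>2))" by (rule borel_integrable_atLeastAtMost'[OF cl])
    have "(LINT x:window|lborel. W x * ln (k x)) \<le> (LINT x:window|lborel. W x * ln ((poly p x)\<^sup>2 + t\<^sup>2) - 2 * ln (1 - t) * W x)"
    proof (rule set_integral_mono[OF lk])
      show "set_integrable lborel window (\<lambda>x. W x * ln ((poly p x)\<^sup>2 + t\<^sup>2) - 2 * ln (1 - t) * W x)"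
        by (intro set_integral_diff(1) il set_integrable_mult_right W_integrable)
      fix x assume x: "x \<in> window"
      have kp: "0 < k x" using k(2)[of x] by linarith
      have "x \<in> {-T..T}" using x IT by blast
      then have "(1 - t)\<^sup>2 * k x \<le> (poly p x)\<^sup>2 + t\<^sup>2" using pb(1)[of x] zero_le_power2[of t] by linarith
      then have "ln ((1 - t)\<^sup>2 * k x) \<le> ln ((poly p x)\<^sup>2 + t\<^sup>2)" using t kp by (intro ln_mono) auto
      moreover have "ln ((1 - t)\<^sup>2 * k x) = 2 * ln (1 - t) + ln (k x)" using t kp by (simp add: ln_mult ln_realpow)
      ultimately have "ln (k x) \<le> ln ((poly p x)\<^sup>2 + t\<^sup>2) - 2 * ln (1 - t)" by linarith
      then have "W x * ln (k x) \<le> W x * (ln ((poly p x)\<^sup>2 + t\<^sup>2) - 2 * ln (1 - t))"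
        by (rule mult_left_mono) (rule W_bounds(1)[OF x])
      then show "W x * ln (k x) \<le> W x * ln ((poly p x)\<^sup>2 + t\<^sup>2) - 2 * ln (1 - t) * W x"
        by (simp only: right_diff_distrib mult_ac)
    qed
    also have "\<dots> = (LINT x:window|lborel. W x * ln ((poly p x)\<^sup>2 + t\<^sup>2)) - 2 * ln (1 - t) * w_total"
      unfolding w_total_def by (subst set_integral_diff(2)[OF il set_integrable_mult_right]) (auto intro: W_integrable)
    also have "(LINT x:window|lborel. W x * ln ((poly p x)\<^sup>2 + t\<^sup>2)) \<le> R\<^sup>2 * (8 * pi) * ((\<integral>x. (poly p x)\<^sup>2 \<partial>\<mu>) + t\<^sup>2 * mass_total) + A"
      by (rule poly_log_bound[OF t(1)])
    also have "(\<integral>x. (poly p x)\<^sup>2 \<partial>\<mu>) \<le> (\<integral>x. (1 + t)\<^sup>2 * k x \<partial>\<mu>)"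
    proof (rule integral_mono_AE[OF integrable_poly_sq])
      show "integrable \<mu> (\<lambda>x. (1 + t)\<^sup>2 * k x)" using ki by simp
      show "AE x in \<mu>. (poly p x)\<^sup>2 \<le> (1 + t)\<^sup>2 * k x"
        using AE_support by eventually_elim (rule pb(2), auto simp: T_def abs_less_iff)
    qed
    finally show ?thesis by (simp add: mult_left_mono)
  qed
  have "?rhs \<midarrow>0\<rightarrow> R\<^sup>2 * (8 * pi) * ((1 + 0)\<^sup>2 * (\<integral>x. k x \<partial>\<mu>) + 0\<^sup>2 * mass_total) + A - 2 * ln (1 - 0) * w_total"
    by (intro tendsto_intros) auto
  then have "(?rhs \<longlongrightarrow> R\<^sup>2 * (8 * pi) * (\<integral>x. k x \<partial>\<mu>) + A) (at_right 0)"
    by (simp add: filterlim_at_split)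
  moreover have "eventually (\<lambda>t. (LINT x:window|lborel. W x * ln (k x)) \<le> ?rhs t) (at_right 0)"
    unfolding eventually_at_right_field using le by (intro exI[of _ 1]) auto
  ultimately show ?thesis by (intro tendsto_lowerbound) auto
qed

text \<open>On [1, B] the logarithm is 1-Lipschitz, so closeness in L1 of the window controls the
  left side and closeness in L1 of \<mu> the right side.\<close>

lemma measurable_log_bound:
  assumes k: "k \<in> borel_measurable borel" "\<And>x. 1 \<le> k x" "\<And>x. k x \<le> B"
  shows "(LINT x:window|lborel. W x * ln (k x)) \<le> R\<^sup>2 * (8 * pi) * (\<integral>x. k x \<partial>\<mu>) + A"
proof (rule field_le_epsilon)
  fix d :: real assume d: "0 < d"
  define C where "C = R\<^sup>2 + R\<^sup>2 * (8 * pi) + 1"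
  have C: "0 < C" using R by (simp add: C_def add_nonneg_pos)
  define e where "e = d / C"
  have e: "0 < e" using d C by (simp add: e_def)
  have fI: "emeasure lborel window < \<infinity>" using R by (simp add: ennreal_less_top)
  obtain g where g: "continuous_on UNIV g" "\<And>x. 1 \<le> g x" "\<And>x. g x \<le> B"
      "(\<integral>x. \<bar>k x - g x\<bar> \<partial>\<mu>) \<le> e" "(LINT x:window|lborel. \<bar>k x - g x\<bar>) \<le> e"
    using L1_approx_pair[OF sets_mu finite_measure_mu _ fI k e] by auto
  have gm: "g \<in> borel_measurable borel" using g(1) by (rule borel_measurable_continuous_onI)
  have kb: "\<bar>k x\<bar> \<le> B" "\<bar>g x\<bar> \<le> B" for x using k(2)[of x] k(3)[of x] g(2)[of x] g(3)[of x] by linarith+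
  have sI: "set_integrable lborel window f" if "f \<in> borel_measurable borel" "\<And>x. x \<in> window \<Longrightarrow> \<bar>f x\<bar> \<le> D" for f :: "real \<Rightarrow> real" and D
  proof -
    have "integrable lborel (\<lambda>x. indicator window x *\<^sub>R D)" using fI by simp
    then show ?thesis unfolding set_integrable_def
    proof (rule Bochner_Integration.integrable_bound)
      show "(\<lambda>x. indicator window x *\<^sub>R f x) \<in> borel_measurable lborel" using that(1) by measurable
      show "AE x in lborel. norm (indicator window x *\<^sub>R f x) \<le> norm (indicator window x *\<^sub>R D)"
      proof (intro AE_I2)
        fix x
        show "norm (indicator window x *\<^sub>R f x) \<le> norm (indicator window x *\<^sub>R D)"
        proof (cases "x \<in> window")
          case True
          then have "\<bar>f x\<bar> \<le> \<bar>D\<bar>" using that(2)[of x] by linarith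
          then show ?thesis using True by simp
        qed simp
      qed
    qed
  qed
  have lnb: "\<bar>W x * ln (q x)\<bar> \<le> R\<^sup>2 * B" if "x \<in> window" "1 \<le> q x" "q x \<le> B" for q x
  proof -
    have "0 \<le> ln (q x)" "ln (q x) \<le> B" using ln_le_minus_one[of "q x"] that by auto
    then show ?thesis unfolding abs_mult using W_bounds(1)[OF that(1)] W_bounds(2)[of x] by (intro mult_mono) auto
  qed
  have ik: "set_integrable lborel window (\<lambda>x. W x * ln (k x))" using k lnb by (intro sI[of _ "R\<^sup>2 * B"]) auto
  have ig: "set_integrable lborel window (\<lambda>x. W x * ln (g x))" using gm g lnb by (intro sI[of _ "R\<^sup>2 * B"]) auto
  have id: "set_integrable lborel window (\<lambda>x. \<bar>k x - g x\<bar>)"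
  proof (rule sI)
    show "(\<lambda>x. \<bar>k x - g x\<bar>) \<in> borel_measurable borel" using gm k(1) by measurable
    show "\<bar>\<bar>k x - g x\<bar>\<bar> \<le> 2 * B" for x using kb[of x] by linarith
  qed
  have "(LINT x:window|lborel. W x * ln (k x)) \<le> (LINT x:window|lborel. W x * ln (g x) + R\<^sup>2 * \<bar>k x - g x\<bar>)"
  proof (rule set_integral_mono[OF ik])
    show "set_integrable lborel window (\<lambda>x. W x * ln (g x) + R\<^sup>2 * \<bar>k x - g x\<bar>)"
      by (intro set_integral_add(1) ig set_integrable_mult_right id)
    fix x assume x: "x \<in> window"
    have "ln (k x) \<le> ln (g x) + \<bar>k x - g x\<bar>" using ln_diff_le[OF k(2) g(2), of x x] by linarith
    then have "W x * ln (k x) \<le> W x * (ln (g x) + \<bar>k x - g x\<bar>)" by (rule mult_left_mono) (rule W_bounds(1)[OF x])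
    also have "\<dots> \<le> W x * ln (g x) + R\<^sup>2 * \<bar>k x - g x\<bar>"
      unfolding distrib_left using W_bounds(2)[of x] by (intro add_left_mono mult_right_mono) auto
    finally show "W x * ln (k x) \<le> W x * ln (g x) + R\<^sup>2 * \<bar>k x - g x\<bar>" .
  qed
  also have "\<dots> = (LINT x:window|lborel. W x * ln (g x)) + R\<^sup>2 * (LINT x:window|lborel. \<bar>k x - g x\<bar>)"
    by (subst set_integral_add(2)[OF ig set_integrable_mult_right]) (auto intro: id)
  also have "\<dots> \<le> (R\<^sup>2 * (8 * pi) * (\<integral>x. g x \<partial>\<mu>) + A) + R\<^sup>2 * e"
    using continuous_log_bound[OF g(1-3)] g(5) by (intro add_mono mult_left_mono) auto
  also have "(\<integral>x. g x \<partial>\<mu>) \<le> (\<integral>x. k x \<partial>\<mu>) + e"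
  proof -
    have i1: "integrable \<mu> g" by (rule integrable_finite_bounded[OF sets_mu finite_measure_mu gm kb(2)])
    have i2: "integrable \<mu> k" by (rule integrable_finite_bounded[OF sets_mu finite_measure_mu k(1) kb(1)])
    have "(\<integral>x. g x \<partial>\<mu>) \<le> (\<integral>x. k x + \<bar>k x - g x\<bar> \<partial>\<mu>)" using i1 i2 by (intro integral_mono) auto
    also have "\<dots> = (\<integral>x. k x \<partial>\<mu>) + (\<integral>x. \<bar>k x - g x\<bar> \<partial>\<mu>)" using i1 i2 by simp
    finally show ?thesis using g(4) by linarith
  qed
  finally have "(LINT x:window|lborel. W x * ln (k x)) \<le> R\<^sup>2 * (8 * pi) * ((\<integral>x. k x \<partial>\<mu>) + e) + A + R\<^sup>2 * e"
    by (simp add: mult_left_mono)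
  also have "\<dots> \<le> R\<^sup>2 * (8 * pi) * (\<integral>x. k x \<partial>\<mu>) + A + C * e" using e by (simp add: C_def algebra_simps)
  also have "C * e = d" using C by (simp add: e_def)
  finally show "(LINT x:window|lborel. W x * ln (k x)) \<le> R\<^sup>2 * (8 * pi) * (\<integral>x. k x \<partial>\<mu>) + A + d" .
qed

text \<open>Testing with k close to 1/f makes the integral of k d\<mu> bounded, because f k is at
  most f + 1, while the integral of ln k approaches that of the negative part of log f.\<close>

lemma log_density_bound:
  assumes ac: "ac_density \<mu> f" and cd: "x0 - R < c" "d < x0 + R"
  shows "(\<integral>\<^sup>+x\<in>{c..d}. e2ennreal (- elog (f x)) \<partial>lborel) < \<infinity>"
proof (cases "c \<le> d")
  case False
  then show ?thesis by simp
next
  case True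
  obtain \<mu>s N where fm: "f \<in> borel_measurable borel" and f0: "\<And>x. 0 \<le> f x"
    and \<mu>s: "sets \<mu>s = sets borel" "emeasure \<mu>s (UNIV - N) = 0" and N: "N \<in> null_sets lborel"
    and dec: "\<And>A. A \<in> sets borel \<Longrightarrow> emeasure \<mu> A = (\<integral>\<^sup>+x\<in>A. ennreal (f x) \<partial>lborel) + emeasure \<mu>s A"
    using ac unfolding ac_density_def by blast
  interpret finite_measure \<mu> by (rule finite_measure_mu)
  have Nb: "N \<in> sets borel" using N by auto
  \<comment> \<open>Truncation at j + 1 makes the test function bounded, the outer maximum with 1
    makes its logarithm nonnegative, and the value 1 on N prevents the singular part of \<mu> from
    being weighted by 1/f.\<close>
  define k where "k j x = (if x \<in> N \<or> x \<notin> window then 1 else max 1 (1 / max (f x) (1 / real (Suc j))))" for j x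
  have km: "k j \<in> borel_measurable borel" for j
    unfolding k_def using Nb fm by measurable
  have k1: "1 \<le> k j x" for j x by (simp add: k_def)
  have kB: "k j x \<le> real (Suc j)" for j x
  proof -
    have "1 / max (f x) (1 / real (Suc j)) \<le> 1 / (1 / real (Suc j))"
      by (intro divide_left_mono mult_pos_pos) (auto simp: less_max_iff_disj simp del: of_nat_Suc)
    then show ?thesis by (simp add: k_def)
  qed
  have kabs: "\<bar>k j x\<bar> \<le> real (Suc j)" for j x using k1[of j x] kB[of j x] by linarith
  \<comment> \<open>One \<open>mass_total\<close> comes from the summand 1 that covers the places
    where k = 1; the other, with the length 2 R of the window, comes from f k \<le> f + 1.\<close>
  define E where "E = 2 * mass_total + 2 * R"
  have kE: "(\<integral>x. k j x \<partial>\<mu>) \<le> E" for j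
  proof -
    let ?X = "window - N"
    have X: "?X \<in> sets borel" using Nb by auto
    have E0: "0 \<le> E" using R by (simp add: E_def mass_total_def)
    have "(\<integral>\<^sup>+x. ennreal (k j x) \<partial>\<mu>) \<le> (\<integral>\<^sup>+x. 1 + indicator ?X x * ennreal (k j x) \<partial>\<mu>)"
      by (intro nn_integral_mono) (auto simp: k_def indicator_def)
    also have "\<dots> = emeasure \<mu> UNIV + (\<integral>\<^sup>+x. indicator ?X x * ennreal (k j x) \<partial>\<mu>)"
      using km X by (subst nn_integral_add) auto
    also have "(\<integral>\<^sup>+x. indicator ?X x * ennreal (k j x) \<partial>\<mu>) = (\<integral>\<^sup>+x. ennreal (k j x) \<partial>density \<mu> (indicator ?X))"
      using km X by (subst nn_integral_density) auto
    \<comment> \<open>Off N the singular part has no mass, so there \<mu> restricted to the window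
      is f dx.\<close>
    also have "density \<mu> (indicator ?X) = density lborel (\<lambda>x. indicator ?X x * ennreal (f x))"
    proof (rule measure_eqI)
      fix A assume "A \<in> sets (density \<mu> (indicator ?X))"
      then have Ab: "A \<in> sets borel" by simp
      have XA: "?X \<inter> A \<in> sets borel" using X Ab by auto
      have "emeasure (density \<mu> (indicator ?X)) A = emeasure \<mu> (?X \<inter> A)"
        using X Ab by (simp add: emeasure_density indicator_inter_arith[symmetric])
      also have "\<dots> = (\<integral>\<^sup>+x\<in>?X \<inter> A. ennreal (f x) \<partial>lborel) + emeasure \<mu>s (?X \<inter> A)" by (rule dec[OF XA])
      also have "emeasure \<mu>s (?X \<inter> A) = 0"
        using emeasure_mono[of "?X \<inter> A" "UNIV - N" \<mu>s] \<mu>s Nb by auto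
      also have "(\<integral>\<^sup>+x\<in>?X \<inter> A. ennreal (f x) \<partial>lborel) + 0 = emeasure (density lborel (\<lambda>x. indicator ?X x * ennreal (f x))) A"
        using X Ab fm by (subst emeasure_density) (auto simp: indicator_inter_arith mult_ac)
      finally show "emeasure (density \<mu> (indicator ?X)) A = emeasure (density lborel (\<lambda>x. indicator ?X x * ennreal (f x))) A" .
    qed simp
    also have "(\<integral>\<^sup>+x. ennreal (k j x) \<partial>density lborel (\<lambda>x. indicator ?X x * ennreal (f x))) = (\<integral>\<^sup>+x. indicator ?X x * ennreal (f x) * ennreal (k j x) \<partial>lborel)"
      using km X fm by (subst nn_integral_density) auto
    also have "\<dots> \<le> (\<integral>\<^sup>+x. ennreal (f x) + indicator window x \<partial>lborel)"
    proof (intro nn_integral_mono)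
      fix x
      have "f x * k j x \<le> f x + 1" if "x \<in> ?X"
      proof -
        let ?y = "max (f x) (1 / real (Suc j))"
        have y: "0 < ?y" by (simp add: less_max_iff_disj del: of_nat_Suc)
        have "f x \<le> 1 * ?y" by simp
        then have "f x / ?y \<le> 1" unfolding pos_divide_le_eq[OF y] .
        then have "f x * (1 / ?y) \<le> 1" by (simp only: times_divide_eq_right mult_1_right)
        moreover have "v * max 1 s \<le> v + 1" if "0 \<le> v" "v * s \<le> 1" for v s :: real
          using that by (cases "1 \<le> s") (auto simp: max_def)
        ultimately have "f x * max 1 (1 / ?y) \<le> f x + 1" using f0[of x] by blast
        then show ?thesis using that by (simp add: k_def)
      qed
      then show "indicator ?X x * ennreal (f x) * ennreal (k j x) \<le> ennreal (f x) + indicator window x"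
        using f0[of x] k1[of j x] by (auto simp: indicator_def ennreal_mult[symmetric] ennreal_1[symmetric] ennreal_plus[symmetric] simp del: ennreal_1 ennreal_plus intro!: ennreal_leI)
    qed
    also have "\<dots> = (\<integral>\<^sup>+x. ennreal (f x) \<partial>lborel) + emeasure lborel window"
      using fm by (subst nn_integral_add) auto
    also have "(\<integral>\<^sup>+x. ennreal (f x) \<partial>lborel) \<le> emeasure \<mu> UNIV" using dec[of UNIV] by simp
    also have "emeasure \<mu> UNIV + (emeasure \<mu> UNIV + emeasure lborel window) = ennreal E"
      using R by (simp add: E_def emeasure_eq_measure mass_total_def ennreal_plus[symmetric] del: ennreal_plus)
    finally have "(\<integral>\<^sup>+x. ennreal (k j x) \<partial>\<mu>) \<le> ennreal E" by (simp add: add_left_mono add_right_mono)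
    moreover have "(\<integral>\<^sup>+x. ennreal (k j x) \<partial>\<mu>) = ennreal (\<integral>x. k j x \<partial>\<mu>)"
      using integrable_finite_bounded[OF sets_mu finite_measure_mu km kabs]
      by (intro nn_integral_eq_integral AE_I2) (auto intro: order_trans[OF zero_le_one k1])
    ultimately show ?thesis using E0 by simp
  qed
  define w0 where "w0 = min (W c) (W d)"
  have w0: "0 < w0"
  proof -
    have "0 < W x" if "x0 - R < x" "x < x0 + R" for x
    proof -
      have "\<bar>x - x0\<bar> < R" using that by (auto simp: abs_less_iff)
      then have "\<bar>x - x0\<bar>\<^sup>2 < R\<^sup>2" by (intro power_strict_mono) auto
      then show ?thesis by simp
    qed
    then show ?thesis using cd True by (simp add: w0_def)
  qed
  have wW: "w0 \<le> W x" if "x \<in> {c..d}" for x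
  proof -
    have "\<bar>x - x0\<bar> \<le> max \<bar>c - x0\<bar> \<bar>d - x0\<bar>" using that by auto
    then have "\<bar>x - x0\<bar> \<le> \<bar>c - x0\<bar> \<or> \<bar>x - x0\<bar> \<le> \<bar>d - x0\<bar>" by linarith
    then have "(x - x0)\<^sup>2 \<le> (c - x0)\<^sup>2 \<or> (x - x0)\<^sup>2 \<le> (d - x0)\<^sup>2" by (simp only: abs_le_square_iff)
    then show ?thesis by (auto simp: w0_def)
  qed
  define D where "D = R\<^sup>2 * (8 * pi) * E + A"
  have nb: "(\<integral>\<^sup>+x\<in>{c..d}. ennreal (ln (k j x)) \<partial>lborel) \<le> ennreal (D / w0)" for j
  proof -
    have fI: "emeasure lborel window < \<infinity>" using R by (simp add: ennreal_less_top)
    have lnk: "0 \<le> ln (k j x)" "ln (k j x) \<le> real (Suc j)" for x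
      using k1[of j x] kB[of j x] ln_le_minus_one[of "k j x"] by auto
    have i: "integrable lborel (\<lambda>x. indicator window x *\<^sub>R (W x * ln (k j x)))"
    proof (rule Bochner_Integration.integrable_bound)
      show "integrable lborel (\<lambda>x. indicator window x *\<^sub>R (R\<^sup>2 * real (Suc j)))" using fI by simp
      show "(\<lambda>x. indicator window x *\<^sub>R (W x * ln (k j x))) \<in> borel_measurable lborel" using km by measurable
      show "AE x in lborel. norm (indicator window x *\<^sub>R (W x * ln (k j x))) \<le> norm (indicator window x *\<^sub>R (R\<^sup>2 * real (Suc j)))"
      proof (intro AE_I2)
        fix x
        have "\<bar>W x * ln (k j x)\<bar> \<le> R\<^sup>2 * real (Suc j)" if "x \<in> window"
          unfolding abs_mult using W_bounds(1)[OF that] W_bounds(2)[of x] lnk[of x] by (intro mult_mono) auto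
        then show "norm (indicator window x *\<^sub>R (W x * ln (k j x))) \<le> norm (indicator window x *\<^sub>R (R\<^sup>2 * real (Suc j)))"
          by (auto simp: indicator_def)
      qed
    qed
    have "ennreal w0 * (\<integral>\<^sup>+x\<in>{c..d}. ennreal (ln (k j x)) \<partial>lborel) = (\<integral>\<^sup>+x. ennreal w0 * (ennreal (ln (k j x)) * indicator {c..d} x) \<partial>lborel)"
      using km by (subst nn_integral_cmult) auto
    also have "\<dots> \<le> (\<integral>\<^sup>+x. ennreal (indicator window x *\<^sub>R (W x * ln (k j x))) \<partial>lborel)"
    proof (intro nn_integral_mono)
      fix x
      have "w0 * ln (k j x) \<le> W x * ln (k j x)" if "x \<in> {c..d}"
        using wW[OF that] lnk(1) by (intro mult_right_mono)
      then show "ennreal w0 * (ennreal (ln (k j x)) * indicator {c..d} x) \<le> ennreal (indicator window x *\<^sub>R (W x * ln (k j x)))"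
        using cd w0 lnk(1)[of x] by (auto simp: indicator_def ennreal_mult[symmetric] intro!: ennreal_leI)
    qed
    also have "\<dots> = ennreal (LINT x:window|lborel. W x * ln (k j x))"
      unfolding set_lebesgue_integral_def using W_bounds(1) lnk(1)
      by (intro nn_integral_eq_integral[OF i]) (auto simp: indicator_def intro!: AE_I2 mult_nonneg_nonneg)
    also have "\<dots> \<le> ennreal D"
    proof (intro ennreal_leI)
      have "(LINT x:window|lborel. W x * ln (k j x)) \<le> R\<^sup>2 * (8 * pi) * (\<integral>x. k j x \<partial>\<mu>) + A"
        by (rule measurable_log_bound[OF km k1 kB])
      also have "\<dots> \<le> D" unfolding D_def using kE[of j] by (intro add_right_mono mult_left_mono) auto
      finally show "(LINT x:window|lborel. W x * ln (k j x)) \<le> D" .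
    qed
    finally have "ennreal w0 * (\<integral>\<^sup>+x\<in>{c..d}. ennreal (ln (k j x)) \<partial>lborel) \<le> ennreal D" .
    then have "ennreal (1 / w0) * (ennreal w0 * (\<integral>\<^sup>+x\<in>{c..d}. ennreal (ln (k j x)) \<partial>lborel)) \<le> ennreal (1 / w0) * ennreal D"
      by (rule mult_left_mono) simp
    moreover have "ennreal (1 / w0) * ennreal w0 = 1" using w0 by (simp add: ennreal_mult[symmetric])
    moreover have "ennreal (1 / w0) * ennreal D = ennreal (D / w0)" using w0 by (simp add: ennreal_mult'[symmetric])
    ultimately show ?thesis by (simp add: mult.assoc[symmetric])
  qed
  have AEN: "AE x in lborel. x \<notin> N" using N by (rule AE_not_in)
  have "(\<integral>\<^sup>+x\<in>{c..d}. e2ennreal (- elog (f x)) \<partial>lborel) \<le> (\<integral>\<^sup>+x. liminf (\<lambda>j. ennreal (ln (k j x)) * indicator {c..d} x) \<partial>lborel)"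
  proof (rule nn_integral_mono_AE)
    show "AE x in lborel. e2ennreal (- elog (f x)) * indicator {c..d} x \<le> liminf (\<lambda>j. ennreal (ln (k j x)) * indicator {c..d} x)"
      using AEN
    proof eventually_elim
      case (elim x)
      show ?case
      proof (cases "x \<in> {c..d}")
        case x: True
        then have kx: "k j x = max 1 (1 / max (f x) (1 / real (Suc j)))" for j using elim cd by (auto simp: k_def)
        have "e2ennreal (- elog (f x)) \<le> liminf (\<lambda>j. ennreal (ln (k j x)))"
        \<comment> \<open>At zeros of f the truncations run off to infinity, matching log 0 =
          -\<infinity>; where f is positive the sequence is eventually constant.\<close>
        proof (cases "f x = 0")
          case True
          have "k j x = real (Suc j)" for j using True by (simp add: kx max_def)
          moreover have "(\<lambda>j. ennreal (ln (real (Suc j)))) \<longlonglongrightarrow> \<infinity>"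
          proof -
            have "filterlim (\<lambda>j. ln (real (Suc j))) at_top sequentially"
              by (intro filterlim_compose[OF ln_at_top] filterlim_compose[OF filterlim_real_sequentially] filterlim_Suc)
            then show ?thesis by (simp add: tendsto_PInfty_eq_at_top[symmetric] ennreal_tendsto_top_eq_at_top)
          qed
          ultimately show ?thesis using lim_imp_Liminf[of sequentially "\<lambda>j. ennreal (ln (real (Suc j)))" \<infinity>] by simp
        next
          case False
          then have fp: "0 < f x" using f0[of x] by simp
          obtain j0 where j0: "inverse (real (Suc j0)) < f x" using reals_Archimedean[OF fp] by blast
          have ev: "ennreal (ln (k j x)) = e2ennreal (- elog (f x))" if "j0 \<le> j" for j
          proof -
            have "1 / real (Suc j) \<le> 1 / real (Suc j0)" using that by (intro divide_left_mono) auto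
            then have "max (f x) (1 / real (Suc j)) = f x" using j0 by (simp add: inverse_eq_divide max_def)
            then have kk: "k j x = max 1 (1 / f x)" using kx[of j] by simp
            show ?thesis
            proof (cases "f x \<le> 1")
              case True
              then have "k j x = 1 / f x" using kk fp by (simp add: max_def)
              then show ?thesis using fp by (simp add: elog_def ln_div e2ennreal_ereal)
            next
              case False
              then have "k j x = 1" using kk fp by (simp add: max_def)
              moreover have "0 < ln (f x)" using False by simp
              ultimately show ?thesis using fp by (simp add: elog_def e2ennreal_ereal ennreal_neg)
            qed
          qed
          have "(\<lambda>j. ennreal (ln (k j x))) \<longlonglongrightarrow> e2ennreal (- elog (f x))"
            by (rule tendsto_eventually) (use ev in \<open>auto simp: eventually_sequentially\<close>)
          then show ?thesis using lim_imp_Liminf[of sequentially] by fastforce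
        qed
        then show ?thesis using x by simp
      qed simp
    qed
  qed
  also have "\<dots> \<le> liminf (\<lambda>j. \<integral>\<^sup>+x. ennreal (ln (k j x)) * indicator {c..d} x \<partial>lborel)"
    using km by (intro nn_integral_liminf) auto
  also have "\<dots> \<le> liminf (\<lambda>j. ennreal (D / w0))"
    by (intro Liminf_mono always_eventually allI nb)
  also have "\<dots> < \<infinity>" by (simp add: Liminf_const ennreal_less_top)
  finally show ?thesis .
qed

end

end

subsection \<open>The absolutely continuous spectrum\<close>

lemma summable_on_square_diff:
  fixes g :: "nat \<Rightarrow> real"
  assumes "(\<lambda>n. \<bar>g (n + 1) - g n\<bar>\<^sup>2) summable_on {1..}"
  shows "\<exists>s. \<forall>m\<ge>1. \<forall>N. (\<Sum>k<N. (g (Suc (m + k)) - g (m + k))\<^sup>2) \<le> s"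
    and "(\<lambda>n. g (Suc n) - g n) \<longlonglongrightarrow> 0"
proof -
  let ?h = "\<lambda>n. \<bar>g (n + 1) - g n\<bar>\<^sup>2"
  have s: "(\<Sum>k<N. (g (Suc (m + k)) - g (m + k))\<^sup>2) \<le> infsum ?h {1..}" if "1 \<le> m" for m N
  proof -
    have "(\<Sum>k<N. (g (Suc (m + k)) - g (m + k))\<^sup>2) = sum ?h ((\<lambda>k. m + k) ` {..<N})"
      by (subst sum.reindex) auto
    also have "\<dots> \<le> infsum ?h {1..}" by (rule finite_sum_le_infsum[OF assms]) (use that in auto)
    finally show ?thesis .
  qed
  then show "\<exists>s. \<forall>m\<ge>1. \<forall>N. (\<Sum>k<N. (g (Suc (m + k)) - g (m + k))\<^sup>2) \<le> s" by blast
  have "summable (\<lambda>k. (g (Suc (1 + k)) - g (1 + k))\<^sup>2)"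
    by (rule summableI_nonneg_bounded[OF _ s]) auto
  then have "(\<lambda>k. (g (Suc (1 + k)) - g (1 + k))\<^sup>2) \<longlonglongrightarrow> 0" by (rule summable_LIMSEQ_zero)
  then have "(\<lambda>k. sqrt ((g (Suc (1 + k)) - g (1 + k))\<^sup>2)) \<longlonglongrightarrow> sqrt 0" by (rule tendsto_real_sqrt)
  then have "(\<lambda>k. g (Suc (Suc k)) - g (Suc k)) \<longlonglongrightarrow> 0" by (simp add: tendsto_rabs_zero_iff)
  then show "(\<lambda>n. g (Suc n) - g n) \<longlonglongrightarrow> 0"
    using filterlim_sequentially_Suc[of "\<lambda>n. g (Suc n) - g n"] by simp
qed

context jacobi_measure
begin

text \<open>The margin \<gamma> is spent three times: on enlarging the interval to a window, on
  replacing a_n by the geometric mean, and on staying a relative distance \<eta> away from the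
  edges. All three are possible from some index m on.\<close>

lemma log_density_in_band:
  assumes ac: "ac_density \<mu> f"
    and va: "\<And>m N. 1 \<le> m \<Longrightarrow> (\<Sum>k<N. (a (Suc (m + k)) - a (m + k))\<^sup>2) \<le> Sa"
    and vb: "\<And>m N. 1 \<le> m \<Longrightarrow> (\<Sum>k<N. (b (Suc (m + k)) - b (m + k))\<^sup>2) \<le> Sb"
    and da: "(\<lambda>n. a (Suc n) - a n) \<longlonglongrightarrow> 0" and db: "(\<lambda>n. b (Suc n) - b n) \<longlonglongrightarrow> 0"
    and cd: "c \<le> d" and \<gamma>: "0 < \<gamma>"
    and lo: "eventually (\<lambda>n. b n - 2 * a n < c - 2 * \<gamma>) sequentially"
    and hi: "eventually (\<lambda>n. d + 2 * \<gamma> < b n + 2 * a n) sequentially"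
  shows "(\<integral>\<^sup>+x\<in>{c..d}. e2ennreal (- elog (f x)) \<partial>lborel) < \<infinity>"
proof -
  \<comment> \<open>The extra \<gamma> in R makes [c, d] interior to the window, where the weight is
    bounded below. The value \<gamma> / (4 K) gives 2 \<eta> alpha_n \<le> \<gamma> / 2.\<close>
  define x0 R \<eta> where "x0 = (c + d) / 2" and "R = (d - c) / 2 + \<gamma>" and "\<eta> = min 1 (\<gamma> / (4 * K))"
  interpret D: wkb_domain a b c0 K x0 R \<eta>
    by unfold_locales (use cd \<gamma> K_pos in \<open>auto simp: R_def \<eta>_def intro!: add_nonneg_pos\<close>)
  have ddl: "D.step_size \<longlonglongrightarrow> 0"
  proof -
    have "(\<lambda>n. \<bar>a (Suc n) - a n\<bar> + \<bar>b (Suc n) - b n\<bar>) \<longlonglongrightarrow> \<bar>0\<bar> + \<bar>0\<bar>" by (intro tendsto_intros da db)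
    then show ?thesis by (simp add: D.step_size_def[abs_def])
  qed
  have ddl': "(\<lambda>n. D.L * (D.step_size (n - 1) + D.step_size n)) \<longlonglongrightarrow> D.L * (0 + 0)"
    by (intro tendsto_intros ddl filterlim_compose[OF ddl]) (simp add: filterlim_minus_const_nat_at_top)
  have e1: "eventually (\<lambda>n. D.L * (D.step_size (n - 1) + D.step_size n) < D.c / (16 * D.C)) sequentially"
    using order_tendstoD(2)[OF ddl', of "D.c / (16 * D.C)"] D.const_pos by simp
  have dal: "(\<lambda>n. \<bar>a (Suc (n - 1)) - a (n - 1)\<bar>) \<longlonglongrightarrow> \<bar>0\<bar>"
    by (intro tendsto_rabs filterlim_compose[OF da]) (simp add: filterlim_minus_const_nat_at_top)
  have e2: "eventually (\<lambda>n. \<bar>a (Suc (n - 1)) - a (n - 1)\<bar> < \<gamma> / 4) sequentially"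
    using order_tendstoD(2)[OF dal, of "\<gamma> / 4"] \<gamma> by simp
  obtain m0 where m0: "\<And>n. m0 \<le> n \<Longrightarrow> D.L * (D.step_size (n - 1) + D.step_size n) < D.c / (16 * D.C)"
      "\<And>n. m0 \<le> n \<Longrightarrow> \<bar>a (Suc (n - 1)) - a (n - 1)\<bar> < \<gamma> / 4"
      "\<And>n. m0 \<le> n \<Longrightarrow> b n - 2 * a n < c - 2 * \<gamma>" "\<And>n. m0 \<le> n \<Longrightarrow> d + 2 * \<gamma> < b n + 2 * a n"
    using eventually_conj[OF e1 eventually_conj[OF e2 eventually_conj[OF lo hi]]]
    unfolding eventually_sequentially by blast
  define m where "m = max 2 m0"
  have m: "2 \<le> m" "m0 \<le> m" by (auto simp: m_def)
  define S0 where "S0 = D.L\<^sup>2 * (8 * (Sa + Sb))"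
  interpret W: wkb a b c0 K x0 R \<eta> m S0
  proof unfold_locales
    show "2 \<le> m" by (rule m)
  next
    fix n x assume n: "m \<le> n" and x: "\<bar>x - x0\<bar> \<le> R"
    have n1: "1 \<le> n" "2 \<le> n" "m0 \<le> n" "1 \<le> n - 1" "Suc (n - 1) = n" using n m by linarith+
    have "c - \<gamma> \<le> x" "x \<le> d + \<gamma>" using x by (auto simp: x0_def R_def abs_le_iff field_simps)
    then have 1: "\<bar>x - b n\<bar> \<le> 2 * a n - \<gamma>" using m0(3,4)[OF n1(3)] by (simp add: abs_le_iff)
    note al = D.alpha_bounds[OF n1(2)] and ap = a_pos[OF n1(1)]
    have "(a n - D.alpha n) * (a n + D.alpha n) = a n * (a n - a (n - 1))"
      using al(4) by (simp add: algebra_simps power2_eq_square)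
    also have "\<dots> \<le> a n * (\<gamma> / 4)"
    proof (rule mult_left_mono)
      have "\<bar>a n - a (n - 1)\<bar> < \<gamma> / 4" using m0(2)[OF n1(3)] unfolding n1(5) .
      then show "a n - a (n - 1) \<le> \<gamma> / 4" by linarith
    qed (use ap in simp)
    also have "\<dots> \<le> (\<gamma> / 4) * (a n + D.alpha n)" using al(3) \<gamma> by (simp add: algebra_simps)
    \<comment> \<open>The distance to the edges measured with a_n is \<gamma>; passing to the
      geometric mean costs 2 * \<gamma> / 4, and the remaining \<gamma> / 2 pays for \<eta>.\<close>
    finally have "a n - D.alpha n \<le> \<gamma> / 4" using ap al(3) by (simp add: mult_le_cancel_right)
    moreover have "2 * (\<eta> * D.alpha n) \<le> \<gamma> / 2"
    proof -
      have "\<eta> * D.alpha n \<le> \<gamma> / (4 * K) * K" using al K_pos \<gamma> by (intro mult_mono) (auto simp: \<eta>_def)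
      then show ?thesis using K_pos by simp
    qed
    ultimately show "\<bar>x - b n\<bar> \<le> 2 * (1 - \<eta>) * D.alpha n" using 1 by (simp add: algebra_simps)
  next
    fix n assume "m \<le> n"
    then show "D.L * (D.step_size (n - 1) + D.step_size n) \<le> D.c / (16 * D.C)" using m0(1)[of n] m by simp
  next
    fix N
    have dsum: "(\<Sum>k<N. (D.step_size (i + k))\<^sup>2) \<le> 2 * (Sa + Sb)" if "1 \<le> i" for i
    proof -
      have sq: "(\<bar>p\<bar> + \<bar>q\<bar>)\<^sup>2 \<le> 2 * p\<^sup>2 + 2 * q\<^sup>2" for p q :: real
        using zero_le_power2[of "\<bar>p\<bar> - \<bar>q\<bar>"] by (simp add: power2_sum power2_diff)
      have "(\<Sum>k<N. (D.step_size (i + k))\<^sup>2) \<le> (\<Sum>k<N. 2 * (a (Suc (i + k)) - a (i + k))\<^sup>2 + 2 * (b (Suc (i + k)) - b (i + k))\<^sup>2)"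
        unfolding D.step_size_def by (intro sum_mono sq)
      also have "\<dots> = 2 * (\<Sum>k<N. (a (Suc (i + k)) - a (i + k))\<^sup>2) + 2 * (\<Sum>k<N. (b (Suc (i + k)) - b (i + k))\<^sup>2)"
        by (simp add: sum.distrib sum_distrib_left)
      also have "\<dots> \<le> 2 * (Sa + Sb)" using va[OF that, of N] vb[OF that, of N] by simp
      finally show ?thesis .
    qed
    have "(D.L * (D.step_size (m + k - 1) + D.step_size (m + k)))\<^sup>2 \<le> D.L\<^sup>2 * (2 * (D.step_size ((m - 1) + k))\<^sup>2 + 2 * (D.step_size (m + k))\<^sup>2)" for k
    proof -
      have i: "m + k - 1 = (m - 1) + k" using m by simp
      have "(p + q)\<^sup>2 \<le> 2 * p\<^sup>2 + 2 * q\<^sup>2" for p q :: real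
        using zero_le_power2[of "p - q"] by (simp add: power2_sum power2_diff)
      then show ?thesis unfolding i power_mult_distrib by (intro mult_left_mono) auto
    qed
    then have "(\<Sum>k<N. (D.L * (D.step_size (m + k - 1) + D.step_size (m + k)))\<^sup>2) \<le> (\<Sum>k<N. D.L\<^sup>2 * (2 * (D.step_size ((m - 1) + k))\<^sup>2 + 2 * (D.step_size (m + k))\<^sup>2))"
      by (rule sum_mono)
    also have "\<dots> = D.L\<^sup>2 * (2 * (\<Sum>k<N. (D.step_size ((m - 1) + k))\<^sup>2) + 2 * (\<Sum>k<N. (D.step_size (m + k))\<^sup>2))"
      by (simp only: sum_distrib_left[symmetric] sum.distrib)
    also have "\<dots> \<le> D.L\<^sup>2 * (2 * (2 * (Sa + Sb)) + 2 * (2 * (Sa + Sb)))"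
      using dsum[of "m - 1"] dsum[of m] m by (intro mult_left_mono add_mono) auto
    finally show "(\<Sum>k<N. (D.L * (D.step_size (m + k - 1) + D.step_size (m + k)))\<^sup>2) \<le> S0" by (simp add: S0_def)
  qed
  obtain A where A: "\<And>N. m \<le> N \<Longrightarrow> integral {-R..R} (\<lambda>x. (R\<^sup>2 - x\<^sup>2) * ln (Phi_sq N (x0 + x))) \<le> A"
    using W.Phi_log_bound by blast
  show ?thesis
    by (rule log_density_bound[OF D.R _ A ac]) (use m \<gamma> in \<open>auto simp: x0_def R_def field_simps\<close>)
qed

end

text \<open>The integrand is infinite where f vanishes, so a finite integral leaves only a null set
  of zeros.\<close>

lemma pos_of_log_integrable:
  assumes f: "f \<in> borel_measurable borel" and fin: "(\<integral>\<^sup>+x\<in>I. e2ennreal (- elog (f x)) \<partial>lborel) < \<infinity>" and I: "I \<in> sets borel"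
  shows "{x\<in>I. \<not> 0 < f x} \<in> null_sets lborel"
proof -
  let ?X = "{x\<in>I. \<not> 0 < f x}"
  have "?X = I \<inter> {x\<in>space borel. \<not> 0 < f x}" by auto
  also have "\<dots> \<in> sets borel" using I f by measurable
  finally have X: "?X \<in> sets borel" .
  have "\<infinity> * emeasure lborel ?X = (\<integral>\<^sup>+x. \<infinity> * indicator ?X x \<partial>lborel)"
    using X by (subst nn_integral_cmult_indicator) auto
  also have "\<dots> \<le> (\<integral>\<^sup>+x\<in>I. e2ennreal (- elog (f x)) \<partial>lborel)"
    by (intro nn_integral_mono) (auto simp: indicator_def elog_def)
  finally have "\<infinity> * emeasure lborel ?X < \<infinity>" using fin by (rule order.strict_trans1)
  then have "emeasure lborel ?X = 0" by (metis ennreal_top_mult infinity_ennreal_def less_irrefl)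
  then show ?thesis using X by auto
qed

theorem corollary1p3:
  fixes a b :: "nat \<Rightarrow> real" and \<mu> :: "real measure" and f :: "real \<Rightarrow> real"
    and S :: "real set"
  assumes a_pos: "\<And>n. n \<ge> 1 \<Longrightarrow> a n > 0"
    and bdd_inv_a: "bdd_above ((\<lambda>n. inverse (a n)) ` {1..})"
    and bdd_a: "bdd_above (a ` {1..})"
    and bdd_b: "bdd_above ((\<lambda>n. \<bar>b n\<bar>) ` {1..})"
    and a_var: "(\<lambda>n. \<bar>a (n + 1) - a n\<bar>\<^sup>2) summable_on {1..}"
    and b_var: "(\<lambda>n. \<bar>b (n + 1) - b n\<bar>\<^sup>2) summable_on {1..}"
    and spectral: "canonical_spectral_measure a b \<mu>"
    and density: "ac_density \<mu> f"
  defines "S \<equiv> {x. limsup (\<lambda>n. ereal (b n - 2 * a n)) \<le> ereal x \<and>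
                   ereal x \<le> liminf (\<lambda>n. ereal (b n + 2 * a n))}"
  shows "eq_mod_null (sigma_ac f) S \<and>
         (\<forall>c d. {c..d} \<subseteq> interior S \<longrightarrow> eintegral_on {c..d} (\<lambda>x. elog (f x)) > -\<infinity>)"
proof -
  obtain B1 where B1: "\<And>n. 1 \<le> n \<Longrightarrow> inverse (a n) \<le> B1" using bdd_inv_a by (auto simp: bdd_above_def)
  obtain B2 where B2: "\<And>n. 1 \<le> n \<Longrightarrow> a n \<le> B2" using bdd_a by (auto simp: bdd_above_def)
  obtain B3 where B3: "\<And>n. 1 \<le> n \<Longrightarrow> \<bar>b n\<bar> \<le> B3" using bdd_b by (auto simp: bdd_above_def)
  define c0 K where "c0 = 1 / max 1 B1" and "K = max B2 B3"
  interpret jacobi_measure a b c0 K \<mu>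
  proof unfold_locales
    show "0 < c0" by (simp add: c0_def)
    show "canonical_spectral_measure a b \<mu>" by fact
    fix n :: nat assume n: "1 \<le> n"
    have "inverse (a n) \<le> max 1 B1" using B1[OF n] by simp
    then have "inverse (max 1 B1) \<le> inverse (inverse (a n))" using a_pos[OF n] by (intro le_imp_inverse_le) auto
    then show "c0 \<le> a n" by (simp add: c0_def inverse_eq_divide)
    show "a n \<le> K" "\<bar>b n\<bar> \<le> K" using B2[OF n] B3[OF n] by (auto simp: K_def)
  qed
  have fm: "f \<in> borel_measurable borel" using density by (simp add: ac_density_def)
  note va = summable_on_square_diff[OF a_var] and vb = summable_on_square_diff[OF b_var]
  obtain Sa Sb where Sa: "\<And>m N. 1 \<le> m \<Longrightarrow> (\<Sum>k<N. (a (Suc (m + k)) - a (m + k))\<^sup>2) \<le> Sa"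
    and Sb: "\<And>m N. 1 \<le> m \<Longrightarrow> (\<Sum>k<N. (b (Suc (m + k)) - b (m + k))\<^sup>2) \<le> Sb"
    using va(1) vb(1) by blast
  let ?lo = "\<lambda>n. ereal (b n - 2 * a n)" and ?hi = "\<lambda>n. ereal (b n + 2 * a n)"
  have ev: "eventually (\<lambda>n. - (3 * K) \<le> b n - 2 * a n \<and> b n - 2 * a n \<le> 3 * K \<and> - (3 * K) \<le> b n + 2 * a n \<and> b n + 2 * a n \<le> 3 * K) sequentially"
    using eventually_ge_at_top[of 1]
  proof eventually_elim
    case (elim n)
    then show ?case using a_le[OF elim] b_le[OF elim] a_pos[OF elim] by (simp add: abs_le_iff)
  qed
  have bounds: "ereal (- (3 * K)) \<le> liminf ?lo" "limsup ?lo \<le> ereal (3 * K)" "ereal (- (3 * K)) \<le> liminf ?hi" "limsup ?hi \<le> ereal (3 * K)"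
    by (intro Liminf_bounded Limsup_bounded; use ev in eventually_elim; simp)+
  have "ereal (- (3 * K)) \<le> limsup ?lo" "liminf ?hi \<le> ereal (3 * K)"
    using bounds Liminf_le_Limsup[of sequentially ?lo] Liminf_le_Limsup[of sequentially ?hi] by (auto intro: order_trans)
  then obtain l1 l2 where l: "limsup ?lo = ereal l1" "liminf ?hi = ereal l2"
    using bounds by (cases "limsup ?lo"; cases "liminf ?hi") auto
  have S: "S = {l1..l2}" by (auto simp: S_def l)
  have up: "eventually (\<lambda>n. b n - 2 * a n < t) sequentially" if "l1 < t" for t
  proof -
    have "limsup ?lo < ereal t" using that l by simp
    from Limsup_lessD[OF this] show ?thesis by simp
  qed
  have dn: "eventually (\<lambda>n. t < b n + 2 * a n) sequentially" if "t < l2" for t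
  proof -
    have "ereal t < liminf ?hi" using that l by simp
    from less_LiminfD[OF this] show ?thesis by simp
  qed
  have fup: "frequently (\<lambda>n. t < b n - 2 * a n) sequentially" if "t < l1" for t
  proof (rule ccontr)
    assume "\<not> frequently (\<lambda>n. t < b n - 2 * a n) sequentially"
    then have "eventually (\<lambda>n. ?lo n \<le> ereal t) sequentially" by (simp add: not_frequently not_less)
    then have "limsup ?lo \<le> ereal t" by (rule Limsup_bounded)
    then show False using that l by simp
  qed
  have fdn: "frequently (\<lambda>n. b n + 2 * a n < t) sequentially" if "l2 < t" for t
  proof (rule ccontr)
    assume "\<not> frequently (\<lambda>n. b n + 2 * a n < t) sequentially"
    then have "eventually (\<lambda>n. ereal t \<le> ?hi n) sequentially" by (simp add: not_frequently not_less)
    then have "ereal t \<le> liminf ?hi" by (rule Liminf_bounded)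
    then show False using that l by simp
  qed
  have fin: "(\<integral>\<^sup>+x\<in>{c..d}. e2ennreal (- elog (f x)) \<partial>lborel) < \<infinity>" if "c \<le> d \<Longrightarrow> l1 < c \<and> d < l2" for c d
  proof (cases "c \<le> d")
    case True
    define \<gamma> where "\<gamma> = min (c - l1) (l2 - d) / 4"
    have \<gamma>: "0 < \<gamma>" "l1 < c - 2 * \<gamma>" "d + 2 * \<gamma> < l2" using that[OF True] by (auto simp: \<gamma>_def min_def field_simps)
    show ?thesis by (rule log_density_in_band[OF density Sa Sb va(2) vb(2) True \<gamma>(1) up[OF \<gamma>(2)] dn[OF \<gamma>(3)]])
  qed simp
  have "eq_mod_null (sigma_ac f) S"
  proof -
    \<comment> \<open>Two families cover positive density beyond the edges, the last one vanishing
      density inside. If l1 > l2 the inner sets are empty and the outer ones cover the line.\<close>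
    define X where "X = (\<Union>k. {x. 1 * x \<le> l1 - 1 / real (Suc k) \<and> 0 < f x}) \<union> (\<Union>k. {x. (-1) * x \<le> - (l2 + 1 / real (Suc k)) \<and> 0 < f x})
       \<union> ({l1, l2} \<union> (\<Union>k. {x\<in>{l1 + 1 / real (Suc k)..l2 - 1 / real (Suc k)}. \<not> 0 < f x}))"
    have gen: "l - t < l - t / 2" "- (l + t) < - (l + t / 2)" if "0 < t" for l t :: real using that by simp_all
    have half: "0 < 1 / real (Suc k) / 2" for k by simp
    \<comment> \<open>The edge argument needs a strict gap between the set and the level exceeded
      infinitely often; half of 1 / (k + 1) is given to each side.\<close>
    have n1: "{x. 1 * x \<le> l1 - 1 / real (Suc k) \<and> 0 < f x} \<in> null_sets lborel" for k
    proof (rule ac_null_beyond_edge[OF density va(2) vb(2), where d' = "l1 - 1 / real (Suc k) / 2"])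
      show "l1 - 1 / real (Suc k) < l1 - 1 / real (Suc k) / 2" by (rule gen(1)) simp
      show "frequently (\<lambda>n. l1 - 1 / real (Suc k) / 2 < 1 * b n - 2 * a n) sequentially"
        using fup[of "l1 - 1 / real (Suc k) / 2"] half[of k] by simp
    qed simp
    have n2: "{x. (-1) * x \<le> - (l2 + 1 / real (Suc k)) \<and> 0 < f x} \<in> null_sets lborel" for k
    proof (rule ac_null_beyond_edge[OF density va(2) vb(2), where d' = "- (l2 + 1 / real (Suc k) / 2)"])
      show "- (l2 + 1 / real (Suc k)) < - (l2 + 1 / real (Suc k) / 2)" by (rule gen(2)) simp
      have "frequently (\<lambda>n. b n + 2 * a n < l2 + 1 / real (Suc k) / 2) sequentially"
        by (rule fdn) (use half[of k] in linarith)
      then show "frequently (\<lambda>n. - (l2 + 1 / real (Suc k) / 2) < -1 * b n - 2 * a n) sequentially"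
        by (rule frequently_elim1) simp
    qed simp
    have n3: "{x\<in>{l1 + 1 / real (Suc k)..l2 - 1 / real (Suc k)}. \<not> 0 < f x} \<in> null_sets lborel" for k
    proof (rule pos_of_log_integrable[OF fm fin])
      have "0 < 1 / real (Suc k)" by simp
      then show "l1 < l1 + 1 / real (Suc k) \<and> l2 - 1 / real (Suc k) < l2" by linarith
    qed simp
    \<comment> \<open>At the two edges themselves neither argument applies.\<close>
    have n4: "{l1, l2} \<in> null_sets lborel" by (rule countable_imp_null_set_lborel) auto
    have Xn: "X \<in> null_sets lborel" unfolding X_def by (intro null_sets.Un null_sets_UN n1 n2 n3 n4)
    have "sym_diff (sigma_ac f) S \<subseteq> X"
    proof
      fix x assume x: "x \<in> sym_diff (sigma_ac f) S"
      have arch: "\<exists>k. 1 / real (Suc k) < e" if "0 < e" for e :: real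
        using reals_Archimedean[OF that] by (simp add: inverse_eq_divide)
      consider "x < l1" "0 < f x" | "l2 < x" "0 < f x" | "l1 \<le> x" "x \<le> l2" "\<not> 0 < f x"
        using x by (auto simp: S sigma_ac_def not_le)
      then show "x \<in> X"
      proof cases
        case 1
        then obtain k where "1 / real (Suc k) < l1 - x" using arch[of "l1 - x"] by auto
        then have "1 * x \<le> l1 - 1 / real (Suc k) \<and> 0 < f x" using 1 by simp
        then show ?thesis unfolding X_def by blast
      next
        case 2
        then obtain k where "1 / real (Suc k) < x - l2" using arch[of "x - l2"] by auto
        then have "(-1) * x \<le> - (l2 + 1 / real (Suc k)) \<and> 0 < f x" using 2 by simp
        then show ?thesis unfolding X_def by blast
      next
        case 3
        show ?thesis
        proof (cases "x = l1 \<or> x = l2")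
          case True
          then show ?thesis unfolding X_def by blast
        next
          case False
          then have "0 < min (x - l1) (l2 - x)" using 3 by auto
          then obtain k where "1 / real (Suc k) < min (x - l1) (l2 - x)" using arch by blast
          then have "x \<in> {x\<in>{l1 + 1 / real (Suc k)..l2 - 1 / real (Suc k)}. \<not> 0 < f x}" using 3 by simp
          then show ?thesis unfolding X_def by blast
        qed
      qed
    qed
    moreover have "sym_diff (sigma_ac f) S \<in> sets lborel"
    proof -
      have "sigma_ac f = {x\<in>space borel. 0 < f x}" by (simp add: sigma_ac_def)
      also have "\<dots> \<in> sets borel" using fm by measurable
      finally show ?thesis by (auto simp: S)
    qed
    ultimately show ?thesis unfolding eq_mod_null_def by (intro null_sets_subset[OF Xn])
  qed
  moreover have "eintegral_on {c..d} (\<lambda>x. elog (f x)) > -\<infinity>" if "{c..d} \<subseteq> interior S" for c d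
  proof -
    \<comment> \<open>For c > d the interval is empty and lies in every interior, so its endpoints
      are located only under this condition; the integral over the empty set is finite
      anyway.\<close>
    have "l1 < c \<and> d < l2" if "c \<le> d"
    proof -
      have "c \<in> interior S" "d \<in> interior S" using \<open>{c..d} \<subseteq> interior S\<close> that by auto
      then show ?thesis by (simp add: S interior_atLeastAtMost_real)
    qed
    from fin[OF this] have "enn2ereal (\<integral>\<^sup>+x\<in>{c..d}. e2ennreal (- elog (f x)) \<partial>lborel) < \<infinity>"
      by (metis enn2ereal_top infinity_ennreal_def less_ennreal.rep_eq)
    moreover have "0 \<le> enn2ereal (\<integral>\<^sup>+x\<in>{c..d}. e2ennreal (elog (f x)) \<partial>lborel)" by (rule enn2ereal_nonneg)
    \<comment> \<open>The negative part is finite, and a nonnegative value, even \<infinity>, minus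
      a finite one stays above -\<infinity>.\<close>
    ultimately show ?thesis unfolding eintegral_on_def
      by (cases "enn2ereal (\<integral>\<^sup>+x\<in>{c..d}. e2ennreal (- elog (f x)) \<partial>lborel)";
          cases "enn2ereal (\<integral>\<^sup>+x\<in>{c..d}. e2ennreal (elog (f x)) \<partial>lborel)") auto
  qed
  ultimately show ?thesis by blast
qed

end
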